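(* Let $\omega$ be a radial weight, let $Y_1\in\{H(\infty,1),H^1,D^1_0,HL(1)\}$ and let $T\in\{H_\omega,\widetilde{H_\omega}\}$. Put $$m_1(\omega)=\operatorname*{ess\,sup}_{t\in[0,1)}\ \omega(t)\left(1+\int_0^t\frac{ds}{\widehat{\omega}(s)}\right).$$ Then the following statements are equivalent: (i) $T:L^1_{[0,1)}\to Y_1$ is bounded; (ii) $\omega\in\mathcal{D}$ and $m_1(\omega)<\infty$; (iii) $\omega\in\widehat{\mathcal{D}}$ and $m_1(\omega)<\infty$.
   Context: $\mathbb{D}$ is the open unit disc of $\mathbb{C}$, $\mathcal{H}(\mathbb{D})$ the space of analytic functions on $\mathbb{D}$, $dA=\frac{dx\,dy}{\pi}$. $L^1_{[0,1)}$ is the Lebesgue space of measurable functions on $[0,1)$ with $\|f\|=\int_0^1|f(t)|\,dt<\infty$. Radial weights: a radial weight is a nonnegative $\omega\in L^1([0,1))$, extended to $\mathbb{D}$ by $\omega(z)=\omega(|z|)$; standing assumption: $\widehat{\omega}(r)=\int_r^1\omega(s)\,ds>0$ for all $0\le r<1$. Moments: $\omega_x=\int_0^1 r^x\omega(r)\,dr$, $x\ge0$. $\omega\in\widehat{\mathcal{D}}$ if there is $C>1$ with $\widehat{\omega}(r)\le C\,\widehat{\omega}(\frac{1+r}{2})$ for all $0\le r<1$. $\omega\in\check{\mathcal{D}}$ if there are $K>1$, $C>1$ with $\widehat{\omega}(r)\ge C\,\widehat{\omega}(1-\frac{1-r}{K})$ for all $0\le r<1$. $\mathcal{D}=\widehat{\mathcal{D}}\cap\check{\mathcal{D}}$.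 Operators: $B^\omega_z(\zeta)=\sum_{n\ge0}\frac{(\overline{z}\zeta)^n}{2\omega_{2n+1}}$ is the reproducing kernel of the Bergman space $A^2_\omega=\{f\in\mathcal{H}(\mathbb{D}):\int_{\mathbb{D}}|f|^2\omega\,dA<\infty\}$, and $$H_\omega(f)(z)=\int_0^1 f(t)\left(\frac1z\int_0^zB^\omega_t(\zeta)\,d\zeta\right)\omega(t)\,dt,\qquad \widetilde{H_\omega}(f)(z)=\int_0^1|f(t)|\left(\frac1z\int_0^zB^\omega_t(\zeta)\,d\zeta\right)\omega(t)\,dt.$$ $T:X\to Y$ is bounded if $T(f)$ is well defined and belongs to $Y$ for every $f\in X$, and $\sup_{\|f\|_X\le1}\|T(f)\|_Y<\infty$. Spaces (of $f(z)=\sum_{n\ge 0}\widehat f(n)z^n\in\mathcal{H}(\mathbb{D})$ with finite norm): $H^1$: $\|f\|_{H^1}=\sup_{0<r<1}\frac1{2\pi}\int_0^{2\pi}|f(re^{i\theta})|d\theta$; $D^1_0$: $\|f\|=|f(0)|+\int_{\mathbb{D}}|f'(z)|\,dA(z)$; $HL(1)$: $\|f\|=\sum_{n\ge0}|\widehat f(n)|(n+1)^{-1}$; $H(\infty,1)$: $\|f\|=\int_0^1M_\infty(r,f)\,dr$ with $M_\infty(r,f)=\max_\theta|f(re^{i\theta})|$. *)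

theory Defs
  imports "HOL-Complex_Analysis.Complex_Analysis" "HOL-Probability.Essential_Supremum"
begin

section \<open>Radial weights\<close>

definition weight_tail :: "(real \<Rightarrow> real) \<Rightarrow> real \<Rightarrow> real" where
  "weight_tail \<omega> r = (LINT s:{r..<1}|lebesgue. \<omega> s)"

definition moment :: "(real \<Rightarrow> real) \<Rightarrow> real \<Rightarrow> real" where
  "moment \<omega> x = (LINT r:{0..<1}|lebesgue. r powr x * \<omega> r)"

text \<open>A radial weight is represented by its profile on \<open>[0,1)\<close>; values of the profile
  outside \<open>[0,1)\<close> are irrelevant.  Positivity of the tails is part of the notion.\<close>

definition radial_weight :: "(real \<Rightarrow> real) \<Rightarrow> bool" where
  "radial_weight \<omega> \<longleftrightarrow>
     (\<forall>r\<in>{0..<1}. 0 \<le> \<omega> r) \<and>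
     set_integrable lebesgue {0..<1} \<omega> \<and>
     (\<forall>r\<in>{0..<1}. 0 < weight_tail \<omega> r)"

definition D_hat :: "(real \<Rightarrow> real) set" where
  "D_hat = {\<omega>. radial_weight \<omega> \<and>
     (\<exists>C>1. \<forall>r\<in>{0..<1}. weight_tail \<omega> r \<le> C * weight_tail \<omega> ((1 + r) / 2))}"

definition D_check :: "(real \<Rightarrow> real) set" where
  "D_check = {\<omega>. radial_weight \<omega> \<and>
     (\<exists>K>1. \<exists>C>1. \<forall>r\<in>{0..<1}. weight_tail \<omega> r \<ge> C * weight_tail \<omega> (1 - (1 - r) / K))}"

definition D_class :: "(real \<Rightarrow> real) set" where
  "D_class = D_hat \<inter> D_check"

text \<open>The essential supremum is taken in the extended reals, so that it may be infinite.\<close>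

definition m1 :: "(real \<Rightarrow> real) \<Rightarrow> ereal" where
  "m1 \<omega> = esssup (lebesgue_on {0..<1})
     (\<lambda>t. ereal (\<omega> t * (1 + (LINT s:{0..t}|lebesgue. 1 / weight_tail \<omega> s))))"

section \<open>The Bergman kernel and the Hilbert-type operators\<close>

definition bergman_kernel :: "(real \<Rightarrow> real) \<Rightarrow> complex \<Rightarrow> complex \<Rightarrow> complex" where
  "bergman_kernel \<omega> z \<zeta> =
     (\<Sum>n. (cnj z * \<zeta>) ^ n / complex_of_real (2 * moment \<omega> (2 * real n + 1)))"

text \<open>The mean \<open>(1/z) \<integral>\<^sub>0\<^sup>z B\<^sub>t(\<zeta>) d\<zeta>\<close>.  At \<open>z = 0\<close> the quotient has a removable singularity
  and is given its limit \<open>B\<^sub>t(0)\<close>.\<close>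

definition kernel_mean :: "(real \<Rightarrow> real) \<Rightarrow> real \<Rightarrow> complex \<Rightarrow> complex" where
  "kernel_mean \<omega> t z =
     (if z = 0 then bergman_kernel \<omega> (complex_of_real t) 0
      else contour_integral (linepath 0 z) (bergman_kernel \<omega> (complex_of_real t)) / z)"

text \<open>An integral operator yields no function (\<open>None\<close>) if, at some point of the disc, the
  defining integral over \<open>[0,1)\<close> fails to exist; the Lebesgue integral alone would then
  silently be \<open>0\<close>.\<close>

definition integral_transform :: "(complex \<Rightarrow> real \<Rightarrow> complex) \<Rightarrow> (complex \<Rightarrow> complex) option" where
  "integral_transform F =
     (if \<forall>z\<in>ball 0 1. set_integrable lebesgue {0..<1} (F z)
      then Some (\<lambda>z. LINT t:{0..<1}|lebesgue. F z t) else None)"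

definition H_op :: "(real \<Rightarrow> real) \<Rightarrow> (real \<Rightarrow> complex) \<Rightarrow> (complex \<Rightarrow> complex) option" where
  "H_op \<omega> f = integral_transform
     (\<lambda>z t. f t * kernel_mean \<omega> t z * complex_of_real (\<omega> t))"

definition H_tilde_op :: "(real \<Rightarrow> real) \<Rightarrow> (real \<Rightarrow> complex) \<Rightarrow> (complex \<Rightarrow> complex) option" where
  "H_tilde_op \<omega> f = integral_transform
     (\<lambda>z t. complex_of_real (norm (f t)) * kernel_mean \<omega> t z * complex_of_real (\<omega> t))"

section \<open>Function spaces\<close>

definition L1_space :: "(real \<Rightarrow> complex) set" where
  "L1_space = {f. set_integrable lebesgue {0..<1} f}"

definition L1_norm :: "(real \<Rightarrow> complex) \<Rightarrow> real" where
  "L1_norm f = (LINT t:{0..<1}|lebesgue. norm (f t))"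

text \<open>The norms on analytic functions take values in \<open>[0,\<infinity>]\<close>; each space consists of the
  analytic functions on the disc of finite norm.\<close>

definition M_inf :: "real \<Rightarrow> (complex \<Rightarrow> complex) \<Rightarrow> ennreal" where
  "M_inf r g = (SUP \<theta>\<in>{0..2*pi}. ennreal (norm (g (complex_of_real r * cis \<theta>))))"

definition H_inf_1_norm :: "(complex \<Rightarrow> complex) \<Rightarrow> ennreal" where
  "H_inf_1_norm g = (\<integral>\<^sup>+r\<in>{0..<1}. M_inf r g \<partial>lebesgue)"

definition Hardy_1_norm :: "(complex \<Rightarrow> complex) \<Rightarrow> ennreal" where
  "Hardy_1_norm g = (SUP r\<in>{0<..<1}. ennreal (1 / (2 * pi)) *
     (\<integral>\<^sup>+\<theta>\<in>{0..2*pi}. ennreal (norm (g (complex_of_real r * cis \<theta>))) \<partial>lebesgue))"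

text \<open>The factor \<open>1/\<pi>\<close> is the normalisation \<open>dA = dx dy / \<pi>\<close> of area measure.\<close>

definition Dirichlet_1_norm :: "(complex \<Rightarrow> complex) \<Rightarrow> ennreal" where
  "Dirichlet_1_norm g = ennreal (norm (g 0)) +
     ennreal (1 / pi) * (\<integral>\<^sup>+z\<in>ball 0 1. ennreal (norm (deriv g z)) \<partial>lebesgue)"

definition HL_1_norm :: "(complex \<Rightarrow> complex) \<Rightarrow> ennreal" where
  "HL_1_norm g = (\<Sum>n. ennreal (norm (fps_nth (fps_expansion g 0) n) / (real n + 1)))"

definition analytic_space :: "((complex \<Rightarrow> complex) \<Rightarrow> ennreal) \<Rightarrow> (complex \<Rightarrow> complex) set" where
  "analytic_space N = {g. g holomorphic_on ball 0 1 \<and> N g < \<infinity>}"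

text \<open>Boundedness of \<open>T\<close> from \<open>L\<^sup>1[0,1)\<close> to the space with norm \<open>N\<close>.\<close>

definition bounded_from_L1 ::
    "((real \<Rightarrow> complex) \<Rightarrow> (complex \<Rightarrow> complex) option) \<Rightarrow> ((complex \<Rightarrow> complex) \<Rightarrow> ennreal) \<Rightarrow> bool" where
  "bounded_from_L1 T N \<longleftrightarrow>
     (\<forall>f\<in>L1_space. \<exists>g\<in>analytic_space N. T f = Some g) \<and>
     (SUP f\<in>{f \<in> L1_space. L1_norm f \<le> 1}. N (the (T f))) < \<infinity>"

end

theory Submission
  imports Defs
begin

text \<open>The kernel mean is \<open>K\<^sub>t(z) = \<Sum>n. (t z)\<^sup>n / ((n + 1) m\<^sub>n)\<close> with \<open>m\<^sub>n = 2 \<omega>\<^sub>2\<^sub>n\<^sub>+\<^sub>1\<close>, and boundedness of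
  either operator amounts to \<open>\<omega>(t) \<parallel>K\<^sub>t\<parallel> \<le> C\<close> for almost every \<open>t\<close>.  For all four norms \<open>\<parallel>K\<^sub>t\<parallel>\<close> is comparable to
  \<open>S(t) = \<Sum>n. t\<^sup>n / ((n + 1)\<^sup>2 m\<^sub>n)\<close>.  The lower bound holds for every series with nonnegative coefficients
  (Hardy's inequality).  The upper bound for \<open>H\<^sup>1\<close> and \<open>D\<^sup>1\<^sub>0\<close> uses that doubling of the moments makes
  \<open>1 / m\<^sub>n\<close> vary slowly up to second differences, so that summation by parts applies.  Under doubling,
  \<open>S(t)\<close> is comparable to \<open>1 + \<integral>\<^sub>0\<^sup>t ds / W(s)\<close>, where \<open>W\<close> is the tail of \<open>\<omega>\<close>.  That boundedness forces doubling is seen by testing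
  on \<open>t\<^sup>N\<close>, and \<open>\<omega>(t) (1 + \<integral>\<^sub>0\<^sup>t ds / W(s)) \<le> M\<close> alone implies the reverse doubling condition.\<close>

section \<open>Polar coordinates\<close>

text \<open>The two factors \<open>1 / (n + 1)\<close> in \<open>S\<close> have different origins:
  one comes from averaging the Bergman kernel over the segment from 0 to \<open>z\<close>, the other
  is the net gain of the norm. For \<open>HL(1)\<close> the second factor is built into the norm,
  and for \<open>H(inf,1)\<close> it is a radial integral. For \<open>H^1\<close> and
  \<open>D^1_0\<close> it must come from cancellation on the circle, which the triangle inequality
  destroys. One summation by parts would give the \<open>n\<close>-th term a weight of about
  \<open>min 1 (1 / (n * d))\<close> at distance \<open>d\<close> from the point 1, with mean of
  order \<open>log n / n\<close>; a second one improves the decay to \<open>1 / (n * d)^2\<close>,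
  with mean of order \<open>1 / n\<close>. This is why second differences of \<open>1 / m n\<close>
  have to be controlled. As \<open>f\<close> is merely integrable, the moments of
  \<open>f * \<omega>\<close> have no regularity to offer, so the summation by parts is done on the
  kernel for each fixed \<open>t\<close>, before integrating against \<open>f * \<omega>\<close>. In
  the necessity direction doubling must be established before the bound on \<open>m1\<close>,
  because the comparison of \<open>1 + G\<close> with \<open>S\<close> rests on it.\<close>

no_notation fps_nth (infixl "$" 75)

text \<open>The Jacobian formula applied below lives on \<open>real^2\<close>; this lemma and the
  next carry Lebesgue measure from there to \<open>complex\<close> and to pairs
  \<open>(r, s)\<close>.\<close>

lemma lborel_real2_complex:
  "distr lborel borel (\<lambda>x::real^2. Complex (x $ 1) (x $ 2)) = lborel"
proof (rule lborel_eqI[symmetric])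
  show "emeasure (distr lborel borel (\<lambda>x::real^2. Complex (x $ 1) (x $ 2))) (box l u) = (\<Prod>b\<in>Basis. (u - l) \<bullet> b)"
    if "\<And>b. b \<in> Basis \<Longrightarrow> l \<bullet> b \<le> u \<bullet> b" for l u
  proof -
    have meas: "(\<lambda>x::real^2. Complex (x $ 1) (x $ 2)) \<in> borel_measurable borel"
      by (intro borel_measurable_continuous_onI) (auto simp: Complex_eq intro!: continuous_intros)
    let ?l = "vector [Re l, Im l] :: real^2" and ?u = "vector [Re u, Im u] :: real^2"
    have le: "Re l \<le> Re u" "Im l \<le> Im u" using that[of 1] that[of \<i>] by (auto simp: Basis_complex_def)
    have "(\<lambda>x::real^2. Complex (x $ 1) (x $ 2)) -` box l u = box ?l ?u"

      by (auto simp: mem_box(1)[of _ l u] Basis_complex_def mem_box_cart forall_2)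
    moreover have "emeasure lborel (box ?l ?u) = ennreal ((Re u - Re l) * (Im u - Im l))"
      using le
      by (subst emeasure_lborel_box_eq)
         (auto simp: Basis_vec_def inner_axis axis_eq_axis forall_2 UNIV_2 algebra_simps)
    ultimately show ?thesis using meas
      by (simp add: emeasure_distr Basis_complex_def)
  qed
qed simp

lemma lborel_real2_prod:
  "distr lborel borel (\<lambda>x::real^2. (x $ 1, x $ 2)) = lborel"
proof (rule lborel_eqI[symmetric])
  show "emeasure (distr lborel borel (\<lambda>x::real^2. (x $ 1, x $ 2))) (box l u) = (\<Prod>b\<in>Basis. (u - l) \<bullet> b)"
    if "\<And>b. b \<in> Basis \<Longrightarrow> l \<bullet> b \<le> u \<bullet> b" for l u
  proof -
    have meas: "(\<lambda>x::real^2. (x $ 1, x $ 2)) \<in> borel_measurable borel"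
      by (intro borel_measurable_continuous_onI) (auto intro!: continuous_intros)
    let ?l = "vector [fst l, snd l] :: real^2" and ?u = "vector [fst u, snd u] :: real^2"
    have le: "fst l \<le> fst u" "snd l \<le> snd u" 
      using that[of "(1,0)"] that[of "(0,1)"] by (auto simp: Basis_prod_def inner_prod_def)
    have "(\<lambda>x::real^2. (x $ 1, x $ 2)) -` box l u = box ?l ?u"
      by (auto simp: mem_box(1)[of _ l u] Basis_prod_def mem_box_cart forall_2 inner_prod_def)
    moreover have "emeasure lborel (box ?l ?u) = ennreal ((fst u - fst l) * (snd u - snd l))"
      using le
      by (subst emeasure_lborel_box_eq)
         (auto simp: Basis_vec_def inner_axis axis_eq_axis forall_2 UNIV_2 algebra_simps)
    moreover have "(\<Prod>b\<in>Basis. (u - l) \<bullet> b) = (fst u - fst l) * (snd u - snd l)"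
      by (cases l; cases u) (simp add: Basis_prod_def)
    ultimately show ?thesis using meas
      by (simp add: emeasure_distr)
  qed
qed simp

lemma rcis_inj:
  assumes "rcis r s = rcis r' s'" "0 < r" "0 < r'" "0 < s" "s < 2*pi" "0 < s'" "s' < 2*pi"
  shows "r = r' \<and> s = s'"
proof
  show 1: "r = r'" using arg_cong[OF assms(1), of norm] assms(2,3) by (simp add: rcis_def norm_mult)
  then have "cis s = cis s'" using assms by (simp add: rcis_def)
  then have "cos s = cos s'" "sin s = sin s'" by (auto simp: complex_eq_iff)
  then show "s = s'" using sincos_total_2pi_le sin_cos_eq_iff[of s' s] assms
    using Arg2pi_unique[of 1 s] Arg2pi_unique[of 1 s'] \<open>cis s = cis s'\<close>
    by (metis Arg2pi_unique exp_eq_polar le_less mult.commute of_real_1 mult_1 cis_conv_exp less_numeral_extra(1))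
qed

text \<open>The identity is an equality of two measures: the image under \<open>P\<close> of the
  density \<open>r\<close> on the open strip, and Lebesgue measure on the disc. On a Borel set
  \<open>E\<close> this is the formula for the measure of an injective differentiable image with
  Jacobian \<open>r\<close>. The open angle interval makes the polar map injective and loses only
  part of the real axis.\<close>

lemma set_nn_integral_polar:
  fixes h :: "complex \<Rightarrow> ennreal"
  assumes h [measurable]: "h \<in> borel_measurable borel"
  shows "(\<integral>\<^sup>+z\<in>ball 0 1. h z \<partial>lborel) =
    (\<integral>\<^sup>+r\<in>{0<..<1}. ennreal r * (\<integral>\<^sup>+s\<in>{0<..<2*pi}. h (rcis r s) \<partial>lborel) \<partial>lborel)"
proof -
  define S where "S = {0<..<1::real} \<times> {0<..<2*pi}"
  define P where "P = (\<lambda>(r, s). rcis r s)"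
  have P [measurable]: "P \<in> borel_measurable borel"
    unfolding P_def rcis_def split_def cis.code
    by (intro borel_measurable_continuous_onI) (auto simp: Complex_eq intro!: continuous_intros)
  have S [measurable]: "S \<in> sets borel" by (auto simp: S_def intro!: borel_open open_Times)
  have fstm [measurable]: "(fst :: real \<times> real \<Rightarrow> real) \<in> borel_measurable borel"
    by (intro borel_measurable_continuous_onI continuous_intros)
  have ballm [measurable]: "(indicator (ball 0 1) :: complex \<Rightarrow> ennreal) \<in> borel_measurable borel"
    by (intro borel_measurable_indicator) simp
  define D where "D = density (lborel :: (real\<times>real) measure) (\<lambda>p. ennreal (fst p) * indicator S p)"
  have eq: "distr D borel P = density lborel (indicator (ball 0 1))"
  proof (rule measure_eqI)
    show "sets (distr D borel P) = sets (density lborel (indicator (ball 0 1)))" by simp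
    fix E assume "E \<in> sets (distr D borel P)"
    then have E [measurable]: "E \<in> sets borel" by simp
    define c2 where "c2 = (\<lambda>x::real^2. Complex (x $ 1) (x $ 2))"
    define p2 where "p2 = (\<lambda>x::real^2. (x $ 1, x $ 2))"
    have c2 [measurable]: "c2 \<in> borel_measurable borel" unfolding c2_def
      by (intro borel_measurable_continuous_onI) (auto simp: Complex_eq intro!: continuous_intros)
    have p2 [measurable]: "p2 \<in> borel_measurable borel" unfolding p2_def
      by (intro borel_measurable_continuous_onI) (auto intro!: continuous_intros)
    \<comment> \<open>The part of the strip that the polar map sends into \<open>E\<close>, seen in
      \<open>real^2\<close>; \<open>g\<close> is the polar map there.\<close>
    define S' where "S' = p2 -` (S \<inter> P -` E)"
    have "S \<inter> P -` E \<in> sets borel" using measurable_sets[OF P E] by auto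
    then have S'm [measurable]: "S' \<in> sets borel"
      unfolding S'_def using measurable_sets[OF p2] by auto
    define g where "g = (\<lambda>x::real^2. (vector [x $ 1 * cos (x $ 2), x $ 1 * sin (x $ 2)] :: real^2))"
    define g' where "g' = (\<lambda>(x::real^2) (v::real^2). (vector [v $ 1 * cos (x $ 2) - x $ 1 * sin (x $ 2) * v $ 2,
         v $ 1 * sin (x $ 2) + x $ 1 * cos (x $ 2) * v $ 2] :: real^2))"
    have c2g: "c2 (g x) = P (p2 x)" for x
      by (simp add: c2_def g_def P_def p2_def rcis_def complex_eq_iff)
    have c2inj: "c2 x = c2 y \<Longrightarrow> x = y" for x y by (simp add: c2_def vec_eq_iff forall_2)
    have inj: "inj_on g S'"
    proof (rule inj_onI)
      fix x y assume xy: "x \<in> S'" "y \<in> S'" "g x = g y"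
      then have "P (p2 x) = P (p2 y)" using c2g by metis
      then have "p2 x = p2 y" using rcis_inj xy by (auto simp: P_def p2_def S'_def S_def)
      then show "x = y" by (simp add: p2_def vec_eq_iff forall_2)
    qed
    have der: "(g has_derivative g' x) (at x within S')" for x :: "real^2"
    proof -
      have *: "g = (\<lambda>x. (x $ 1 * cos (x $ 2)) *\<^sub>R axis 1 1 + (x $ 1 * sin (x $ 2)) *\<^sub>R axis 2 1)"
        by (auto simp: g_def vec_eq_iff forall_2 axis_def)
      have **: "g' x = (\<lambda>v. (v $ 1 * cos (x $ 2) - x $ 1 * sin (x $ 2) * v $ 2) *\<^sub>R axis 1 1
          + (v $ 1 * sin (x $ 2) + x $ 1 * cos (x $ 2) * v $ 2) *\<^sub>R axis 2 1)"
        by (auto simp: g'_def vec_eq_iff forall_2 axis_def)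
      have nth: "((\<lambda>x::real^2. x $ i) has_derivative (\<lambda>v. v $ i)) (at x within S')" for i
        by (rule bounded_linear_imp_has_derivative) (rule bounded_linear_vec_nth)
      show ?thesis unfolding * **
        by (rule derivative_eq_intros nth refl | simp add: algebra_simps)+
    qed
    have det: "\<bar>det (matrix (g' x))\<bar> = \<bar>x $ 1\<bar>" for x
    proof -
      have "det (matrix (g' x)) = cos (x $ 2) * (x $ 1 * cos (x $ 2)) + x $ 1 * sin (x $ 2) * sin (x $ 2)"
        by (simp add: det_2 matrix_def g'_def axis_def)
      also have "\<dots> = x $ 1 * (cos (x $ 2) ^ 2 + sin (x $ 2) ^ 2)"
        by (simp only: power2_eq_square algebra_simps)
      finally show ?thesis by simp
    qed
    have bnd: "S' \<subseteq> box 0 (vector [1, 2*pi])"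
      by (auto simp: S'_def S_def p2_def mem_box_cart forall_2)
    have ai: "(\<lambda>x::real^2. \<bar>x $ 1\<bar>) absolutely_integrable_on S'"
    proof (rule set_integrable_subset)
      show "(\<lambda>x::real^2. \<bar>x $ 1\<bar>) absolutely_integrable_on cbox 0 (vector [1, 2*pi])"
        by (intro absolutely_integrable_continuous continuous_intros)
      show "S' \<subseteq> cbox 0 (vector [1, 2*pi])" using bnd box_subset_cbox by (rule order_trans)
      show "S' \<in> sets lebesgue" using S'm by (simp add: sets_completionI_sets)
    qed
    let ?C = "c2 -` (E \<inter> ball 0 1)"
    have C [measurable]: "?C \<in> sets borel" using measurable_sets[OF c2, of "E \<inter> ball 0 1"] by simp
    have S'l: "S' \<in> sets lebesgue" using S'm by (simp add: sets_completionI_sets)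
    have io: "(\<lambda>x. \<bar>det (matrix (g' x))\<bar>) integrable_on S'"
      unfolding det using ai by (rule set_lebesgue_integral_eq_integral(1))
    have img: "g ` S' \<in> lmeasurable"
      using measurable_differentiable_image_eq[OF S'l der inj] io by blast
    have img_eq: "measure lebesgue (g ` S') = integral S' (\<lambda>x. \<bar>x $ 1\<bar>)"
      using measure_differentiable_image_eq[OF S'l der inj io] unfolding det .
    have sub: "g ` S' \<subseteq> ?C"
      by (auto simp: S'_def S_def c2g P_def p2_def rcis_def norm_mult)
    \<comment> \<open>Whatever the image misses lies on the real axis, a null set.\<close>
    have sub2: "?C \<subseteq> g ` S' \<union> {x. x $ 2 = 0}"
    proof
      fix x assume x: "x \<in> ?C"
      show "x \<in> g ` S' \<union> {x. x $ 2 = 0}"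
      proof (cases "x $ 2 = 0")
        case False
        then have nz: "c2 x \<noteq> 0" by (auto simp: c2_def complex_eq_iff)
        define s where "s = Arg2pi (c2 x)"
        have e: "c2 x = rcis (norm (c2 x)) s"
          using Arg2pi_eq[of "c2 x"] by (simp add: s_def rcis_def cis_conv_exp)
        have "s \<noteq> 0" using False e by (auto simp: c2_def rcis_def complex_eq_iff)
        then have s: "0 < s" "s < 2*pi" using Arg2pi_ge_0[of "c2 x"] Arg2pi_lt_2pi[of "c2 x"] by (auto simp: s_def)
        define y where "y = (vector [norm (c2 x), s] :: real^2)"
        have y: "P (p2 y) = c2 x" using e by (simp add: P_def p2_def y_def)
        then have "x = g y" using c2g c2inj by metis
        moreover have "y \<in> S'" using x s nz y by (auto simp: S'_def S_def p2_def y_def)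
        ultimately show ?thesis by blast
      qed simp
    qed
    have null: "{x::real^2. x $ 2 = 0} \<in> null_sets lebesgue"
      using negligible_standard_hyperplane_cart[of 2] by (simp add: negligible_iff_null_sets)
    have "emeasure (distr D borel P) E = emeasure D (P -` E)"
      by (subst emeasure_distr) (auto simp: D_def)
    also have "\<dots> = (\<integral>\<^sup>+p. ennreal (fst p) * indicator (S \<inter> P -` E) p \<partial>lborel)"
    proof -
      have [measurable]: "P -` E \<in> sets borel" using measurable_sets[OF P E] by simp
      have "(\<lambda>p. ennreal (fst p) * indicator S p) \<in> borel_measurable borel"
        by (intro borel_measurable_times_ennreal borel_measurable_indicator measurable_compose[OF fstm measurable_ennreal] S)
      then have "(\<lambda>p. ennreal (fst p) * indicator S p) \<in> borel_measurable lborel" by simp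
      then show ?thesis unfolding D_def
        by (subst emeasure_density) (auto intro!: nn_integral_cong simp: indicator_def split: if_splits)
    qed
    also have "\<dots> = (\<integral>\<^sup>+x. ennreal \<bar>x $ 1\<bar> * indicator S' x \<partial>lborel)"
      unfolding lborel_real2_prod[folded p2_def, symmetric]
    proof (subst nn_integral_distr)
      show "(\<integral>\<^sup>+ x. ennreal (fst (p2 x)) * indicator (S \<inter> P -` E) (p2 x) \<partial>lborel) =
        (\<integral>\<^sup>+ x. ennreal \<bar>x $ 1\<bar> * indicator S' x \<partial>lborel)"
        by (intro nn_integral_cong) (auto simp: S'_def p2_def S_def indicator_def)
    qed (use \<open>S \<inter> P -` E \<in> sets borel\<close> in auto)
    also have "\<dots> = (\<integral>\<^sup>+x\<in>S'. ennreal \<bar>x $ 1\<bar> \<partial>lebesgue)"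
      by (rule nn_integral_completion[symmetric])
    also have "\<dots> = ennreal (integral S' (\<lambda>x. \<bar>x $ 1\<bar>))"
    proof -
      have "(\<integral>\<^sup>+x\<in>S'. ennreal \<bar>x $ 1\<bar> \<partial>lebesgue) = (\<integral>\<^sup>+x. ennreal (indicator S' x *\<^sub>R \<bar>x $ 1\<bar>) \<partial>lebesgue)"
        by (intro nn_integral_cong) (simp add: indicator_def)
      also have "\<dots> = ennreal (LINT x:S'|lebesgue. \<bar>x $ 1\<bar>)"
        unfolding set_lebesgue_integral_def
        by (rule nn_integral_eq_integral) (use ai in \<open>auto simp: set_integrable_def\<close>)
      finally show ?thesis using set_lebesgue_integral_eq_integral(2)[OF ai] by simp
    qed
    also have "\<dots> = emeasure lebesgue (g ` S')"
      using img img_eq by (simp add: emeasure_eq_measure2)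
    also have "\<dots> = emeasure lebesgue ?C"
    proof (rule emeasure_eq_AE)
      show "AE x in lebesgue. (x \<in> g ` S') = (x \<in> ?C)"
        using AE_not_in[OF null] by eventually_elim (use sub sub2 in auto)
    qed (use img C in auto)
    also have "\<dots> = emeasure lborel ?C" using C by simp
    also have "\<dots> = emeasure (distr lborel borel c2) (E \<inter> ball 0 1)"
      by (subst emeasure_distr) auto
    also have "\<dots> = emeasure lborel (E \<inter> ball 0 1)"
      unfolding c2_def lborel_real2_complex ..
    also have "\<dots> = emeasure (density lborel (indicator (ball 0 1))) E"
      by (subst emeasure_density) (auto simp: Int_commute ballm simp flip: indicator_inter_arith)
    finally show "emeasure (distr D borel P) E = emeasure (density lborel (indicator (ball 0 1))) E" .
  qed
  have "(\<integral>\<^sup>+z\<in>ball 0 1. h z \<partial>lborel) = (\<integral>\<^sup>+z. h z \<partial>density lborel (indicator (ball 0 1)))"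
    by (subst nn_integral_density) (auto simp: mult.commute ballm)
  also have "\<dots> = (\<integral>\<^sup>+p. h (P p) \<partial>D)"
    unfolding eq[symmetric] by (subst nn_integral_distr) (auto simp: D_def)
  also have "\<dots> = (\<integral>\<^sup>+p. ennreal (fst p) * indicator S p * h (P p) \<partial>(lborel \<Otimes>\<^sub>M lborel))"
    unfolding D_def lborel_prod by (subst nn_integral_density) auto
  also have "\<dots> = (\<integral>\<^sup>+r. \<integral>\<^sup>+s. ennreal r * indicator S (r, s) * h (rcis r s) \<partial>lborel \<partial>lborel)"
  proof -
    have "(\<lambda>p. ennreal (fst p) * indicator S p * h (P p)) \<in> borel_measurable borel"
      by (intro borel_measurable_times_ennreal borel_measurable_indicator
          measurable_compose[OF fstm measurable_ennreal] measurable_compose[OF P h] S)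
    then have "(\<lambda>p. ennreal (fst p) * indicator S p * h (P p)) \<in> borel_measurable (lborel \<Otimes>\<^sub>M lborel)"
      by (simp add: lborel_prod)
    from lborel.nn_integral_fst[OF this] show ?thesis by (simp add: P_def)
  qed
  also have "\<dots> = (\<integral>\<^sup>+r\<in>{0<..<1}. ennreal r * (\<integral>\<^sup>+s\<in>{0<..<2*pi}. h (rcis r s) \<partial>lborel) \<partial>lborel)"
  proof (intro nn_integral_cong)
    fix r :: real
    have [measurable]: "(\<lambda>s. rcis r s) \<in> borel_measurable borel"
      unfolding rcis_def cis.code
      by (intro borel_measurable_continuous_onI) (auto simp: Complex_eq intro!: continuous_intros)
    have "(\<integral>\<^sup>+s. ennreal r * indicator S (r, s) * h (rcis r s) \<partial>lborel)
      = (\<integral>\<^sup>+s. (ennreal r * indicator {0<..<1} r) * (h (rcis r s) * indicator {0<..<2*pi} s) \<partial>lborel)"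
      by (intro nn_integral_cong) (auto simp: S_def indicator_def)
    also have "\<dots> = (ennreal r * indicator {0<..<1} r) * (\<integral>\<^sup>+s\<in>{0<..<2*pi}. h (rcis r s) \<partial>lborel)"
      by (subst nn_integral_cmult) auto
    finally show "(\<integral>\<^sup>+s. ennreal r * indicator S (r, s) * h (rcis r s) \<partial>lborel) =
       ennreal r * (\<integral>\<^sup>+s\<in>{0<..<2*pi}. h (rcis r s) \<partial>lborel) * indicator {0<..<1} r"
      by (simp add: ac_simps)
  qed
  finally show ?thesis .
qed

section \<open>Power series with slowly varying coefficients\<close>

text \<open>A discrete symbol estimate: every difference gains a factor \<open>1 / (n + 1)\<close>.
  The majorant \<open>\<beta>\<close> is kept apart from \<open>b\<close>, so that a shift of
  \<open>b\<close> or a bounded factor can be accommodated without changing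
  \<open>\<beta>\<close>.\<close>

definition slow :: "real \<Rightarrow> (nat \<Rightarrow> real) \<Rightarrow> (nat \<Rightarrow> real) \<Rightarrow> bool" where
  "slow A b \<beta> \<longleftrightarrow> (\<forall>n. \<bar>b n\<bar> \<le> A * \<beta> n \<and> \<bar>b (n + 1) - b n\<bar> \<le> A * \<beta> n / (real n + 1) \<and>
     \<bar>b (n + 2) - 2 * b (n + 1) + b n\<bar> \<le> A * \<beta> n / (real n + 1)^2)"

text \<open>Summing by parts twice from \<open>N = \<lfloor>1 / d\<rfloor>\<close> on, where \<open>d\<close> bounds \<open>\<bar>1 - w\<bar>\<close> from below, the \<open>n\<close>-th
  coefficient contributes with weight \<open>1\<close> before \<open>N\<close>, as a boundary term at \<open>N\<close>, and through its second
  difference from \<open>N\<close> on.\<close>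

definition cutoff :: "nat \<Rightarrow> real \<Rightarrow> real" where
  "cutoff n d = (if n < nat \<lfloor>1/d\<rfloor> then 1 else 0) + (if n = nat \<lfloor>1/d\<rfloor> then 2/d else 0) +
     (if nat \<lfloor>1/d\<rfloor> \<le> n then 1 / ((n + 1)^2 * d^2) else 0)"

lemma cutoff_nonneg: "d > 0 \<Longrightarrow> 0 \<le> cutoff n d"
  by (simp add: cutoff_def)

lemma cutoff_measurable [measurable]: "cutoff n \<in> borel_measurable borel"
  unfolding cutoff_def by measurable

lemma summation_by_parts:
  fixes c :: "nat \<Rightarrow> complex"
  assumes "summable (\<lambda>n. c n * w ^ n)"
  shows "summable (\<lambda>n. (c (n + 1) - c n) * w ^ n)"
    and "(1 - w) * (\<Sum>n. c n * w ^ n) = c 0 + w * (\<Sum>n. (c (n + 1) - c n) * w ^ n)"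
proof -
  have 1: "summable (\<lambda>n. c (Suc n) * w ^ Suc n)" using assms by (subst summable_Suc_iff)
  have head: "(\<Sum>n. c (Suc n) * w ^ Suc n) = (\<Sum>n. c n * w ^ n) - c 0"
    using suminf_split_head[OF assms] by simp
  have *: "summable (\<lambda>n. (c (n + 1) - c n) * w ^ n)" 
  proof (cases "w = 0")
    case True
    then show ?thesis by (intro summable_finite[of "{0}"]) auto
  next
    case False
    then have "summable (\<lambda>n. c (Suc n) * w ^ n)"
      using summable_mult[OF 1, of "1/w"] by (simp add: field_simps)
    from summable_diff[OF this assms] show ?thesis by (simp add: algebra_simps)
  qed
  then show "summable (\<lambda>n. (c (n + 1) - c n) * w ^ n)" .
  have "w * (\<Sum>n. (c (n + 1) - c n) * w ^ n) = (\<Sum>n. c (Suc n) * w ^ Suc n - w * (c n * w ^ n))"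
    using * by (subst suminf_mult[symmetric]) (auto simp: algebra_simps)
  also have "\<dots> = (\<Sum>n. c n * w ^ n) - c 0 - w * (\<Sum>n. c n * w ^ n)"
    using suminf_diff[OF 1 summable_mult[OF assms, of w]] head suminf_mult[OF assms, of w] by simp
  finally show "(1 - w) * (\<Sum>n. c n * w ^ n) = c 0 + w * (\<Sum>n. (c (n + 1) - c n) * w ^ n)"
    by (simp add: algebra_simps)
qed

text \<open>Terms below \<open>N\<close> are estimated trivially. The rest is \<open>w ^ N\<close>
  times a shifted series, to which summation by parts is applied twice; each application costs a
  division by \<open>1 - w\<close>, hence at most a factor \<open>1 / d\<close>, and leaves a
  boundary term at \<open>N\<close>.\<close>

lemma slow_power_series_bound:
  fixes w :: complex
  assumes slow: "slow A b \<beta>" and \<beta>: "\<And>n. 0 \<le> \<beta> n" and A: "0 \<le> A" and d: "0 < d" "d \<le> norm (1 - w)"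
    and w: "norm w < 1" and sm: "summable (\<lambda>n. \<beta> n * norm w ^ n)"
  shows "norm (\<Sum>n. of_real (b n) * w ^ n) \<le> A * (\<Sum>n. \<beta> n * norm w ^ n * cutoff n d)"
    and "summable (\<lambda>n. \<beta> n * norm w ^ n * cutoff n d)"
proof -
  define N where "N = nat \<lfloor>1/d\<rfloor>"
  \<comment> \<open>This keeps the weights beyond \<open>N\<close> at most 1, which gives
    summability, and it turns the gain \<open>1 / (N + 1)\<close> of a first difference into a
    factor \<open>d\<close>.\<close>
  have Nd: "1 \<le> (real N + 1) * d"
  proof -
    have "1 / d \<le> real N + 1" using d unfolding N_def by linarith
    then show ?thesis using d by (simp add: field_simps)
  qed
  have b0: "\<bar>b n\<bar> \<le> A * \<beta> n" and b1: "\<bar>b (n+1) - b n\<bar> \<le> A * \<beta> n / (real n + 1)"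
    and b2: "\<bar>b (n + 2) - 2 * b (n + 1) + b n\<bar> \<le> A * \<beta> n / (real n + 1)^2" for n
    using slow by (auto simp: slow_def)
  let ?h = "\<lambda>n. \<beta> n * norm w ^ n * cutoff n d"
  have tailq: "cutoff (n + N) d = (if n = 0 then 2/d else 0) + 1 / ((real (n + N) + 1)^2 * d^2)" for n
    by (auto simp: cutoff_def N_def)
  have tail_le: "1 / ((real (n + N) + 1)^2 * d^2) \<le> 1" for n
  proof -
    have "(real N + 1) * d \<le> (real (n + N) + 1) * d" using d by (intro mult_right_mono) auto
    then have "1 \<le> (real (n + N) + 1) * d" using Nd by simp
    then have "1 \<le> ((real (n + N) + 1) * d)^2" by simp
    then show ?thesis by (simp add: power_mult_distrib)
  qed
  have smN: "summable (\<lambda>n. \<beta> (n + N) * norm w ^ (n + N))"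
    using sm by (subst summable_iff_shift)
  have sm2: "summable (\<lambda>n. \<beta> (n + N) * norm w ^ (n + N) * (1 / ((real (n + N) + 1)^2 * d^2)))"
  proof (rule summable_comparison_test'[OF smN, of 0])
    fix n
    have "\<beta> (n + N) * norm w ^ (n + N) * (1 / ((real (n + N) + 1)^2 * d^2)) \<le> \<beta> (n + N) * norm w ^ (n + N) * 1"
      by (intro mult_left_mono tail_le) (auto simp: \<beta>)
    then show "norm (\<beta> (n + N) * norm w ^ (n + N) * (1 / ((real (n + N) + 1)^2 * d^2))) \<le> \<beta> (n + N) * norm w ^ (n + N)"
      by (simp add: \<beta>)
  qed
  have sm3: "summable (\<lambda>n. \<beta> (n + N) * norm w ^ (n + N) * (if n = 0 then 2/d else 0))"
    by (rule summable_finite[of "{0}"]) auto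
  have smt: "summable (\<lambda>n. ?h (n + N))"
    using summable_add[OF sm3 sm2] unfolding tailq by (simp only: distrib_left)
  then show smh: "summable ?h" by (subst (asm) summable_iff_shift)
  have sb: "summable (\<lambda>n. of_real (b n) * w ^ n)"
    by (rule summable_comparison_test'[OF summable_mult[OF sm, of A], of 0])
       (use b0 in \<open>auto simp: norm_mult norm_power mult.assoc[symmetric] intro!: mult_right_mono\<close>)
  define c where "c = (\<lambda>n. complex_of_real (b (n + N)))"
  define e where "e = (\<lambda>n. c (n + 1) - c n)"
  define e' where "e' = (\<lambda>n. e (n + 1) - e n)"
  define s where "s = (\<Sum>n. c n * w ^ n)"
  have sc: "summable (\<lambda>n. c n * w ^ n)"
  proof (cases "w = 0")
    case True
    then show ?thesis by (intro summable_finite[of "{0}"]) auto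
  next
    case False
    have "summable (\<lambda>n. of_real (b (n + N)) * w ^ (n + N))" using sb by (subst summable_iff_shift)
    from summable_mult[OF this, of "1 / w ^ N"] show ?thesis
      using False by (simp add: c_def power_add field_simps)
  qed
  have e's: "\<bar>b (n + N + 2) - 2 * b (n + N + 1) + b (n + N)\<bar> = norm (e' n)" for n
  proof -
    have "e' n = complex_of_real (b (n + N + 2) - 2 * b (n + N + 1) + b (n + N))"
      by (simp add: e'_def e_def c_def algebra_simps)
    then show ?thesis by (simp only: norm_of_real)
  qed
  have e_eq: "c (n + 1) - c n = e n" and e'_eq: "e (n + 1) - e n = e' n" for n
    by (simp_all add: e_def e'_def)
  note p1 = summation_by_parts[OF sc, folded s_def, unfolded e_eq]
  note p2 = summation_by_parts[OF p1(1), unfolded e'_eq]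
  have w1: "1 - w \<noteq> 0" using d by auto
  \<comment> \<open>Both summations by parts, solved for \<open>s\<close>: \<open>c 0\<close> and
    \<open>e 0\<close> are the boundary terms, and only second differences remain in the
    series.\<close>
  have s_eq: "s = (c 0 + w * ((e 0 + w * (\<Sum>n. e' n * w ^ n)) / (1 - w))) / (1 - w)"
  proof -
    have "(\<Sum>n. e n * w ^ n) = (e 0 + w * (\<Sum>n. e' n * w ^ n)) / (1 - w)"
      using p2(2) w1 by (simp add: eq_divide_eq mult.commute)
    then show ?thesis using p1(2) w1 by (simp add: eq_divide_eq mult.commute)
  qed
  have se': "summable (\<lambda>n. norm (e' n) * norm w ^ n)" and
    e'_le: "norm w ^ N * (\<Sum>n. norm (e' n) * norm w ^ n) / d^2
       \<le> A * (\<Sum>n. \<beta> (n + N) * norm w ^ (n + N) * (1 / ((real (n + N) + 1)^2 * d^2)))"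
  proof -
    show *: "summable (\<lambda>n. norm (e' n) * norm w ^ n)"
    proof (cases "w = 0")
      case True
      then show ?thesis by (intro summable_finite[of "{0}"]) auto
    next
      case False
      show ?thesis
      proof (rule summable_comparison_test'[OF summable_mult[OF smN, of "A / norm w ^ N"], of 0])
        fix n
        have "norm (e' n) \<le> A * \<beta> (n + N) / (real (n + N) + 1)^2"
          using b2[of "n + N"] unfolding e's by (simp add: add_ac)
        also have "\<dots> \<le> A * \<beta> (n + N) / 1"
          by (rule divide_left_mono) (use mult_nonneg_nonneg[OF A \<beta>[of "n + N"]] in auto)
        also have "\<dots> = A * \<beta> (n + N)" by simp
        finally show "norm (norm (e' n) * norm w ^ n) \<le> A / norm w ^ N * (\<beta> (n + N) * norm w ^ (n + N))"
          using False by (simp add: power_add mult_right_mono mult.assoc[symmetric])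
      qed
    qed
    have "norm w ^ N * (\<Sum>n. norm (e' n) * norm w ^ n) / d^2
       = (\<Sum>n. norm w ^ N / d^2 * (norm (e' n) * norm w ^ n))"
      using suminf_mult[OF *, of "norm w ^ N / d^2"] by simp
    also have "\<dots> \<le> (\<Sum>n. A * (\<beta> (n + N) * norm w ^ (n + N) * (1 / ((real (n + N) + 1)^2 * d^2))))"
    proof (rule suminf_le[OF _ summable_mult[OF *] summable_mult[OF sm2]])
      fix n
      have "norm (e' n) \<le> A * \<beta> (n + N) / (real (n + N) + 1)^2"
        using b2[of "n + N"] unfolding e's by (simp add: add_ac)
      then have "norm (e' n) * (norm w ^ (n + N) / d^2) \<le> A * \<beta> (n + N) / (real (n + N) + 1)^2 * (norm w ^ (n + N) / d^2)"
        by (rule mult_right_mono) simp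
      then show "norm w ^ N / d\<^sup>2 * (norm (e' n) * norm w ^ n)
         \<le> A * (\<beta> (n + N) * norm w ^ (n + N) * (1 / ((real (n + N) + 1)\<^sup>2 * d\<^sup>2)))"
        by (simp add: power_add mult_ac)
    qed
    also have "\<dots> = A * (\<Sum>n. \<beta> (n + N) * norm w ^ (n + N) * (1 / ((real (n + N) + 1)^2 * d^2)))"
      using suminf_mult[OF sm2] by simp
    finally show "norm w ^ N * (\<Sum>n. norm (e' n) * norm w ^ n) / d^2
       \<le> A * (\<Sum>n. \<beta> (n + N) * norm w ^ (n + N) * (1 / ((real (n + N) + 1)^2 * d^2)))" .
  qed
  have s_le: "norm s \<le> norm (c 0) / d + norm (e 0) / d^2 + (\<Sum>n. norm (e' n) * norm w ^ n) / d^2"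
  proof -
    have i: "norm (\<Sum>n. e' n * w ^ n) \<le> (\<Sum>n. norm (e' n) * norm w ^ n)"
      using summable_norm[of "\<lambda>n. e' n * w ^ n"] se' by (simp add: norm_mult norm_power)
    have "norm (e 0 + w * (\<Sum>n. e' n * w ^ n)) \<le> norm (e 0) + norm w * norm (\<Sum>n. e' n * w ^ n)"
      by (metis norm_mult norm_triangle_ineq)
    also have "norm w * norm (\<Sum>n. e' n * w ^ n) \<le> 1 * (\<Sum>n. norm (e' n) * norm w ^ n)"
      by (rule mult_mono) (use w i in auto)
    finally have ii: "norm (e 0 + w * (\<Sum>n. e' n * w ^ n)) \<le> norm (e 0) + (\<Sum>n. norm (e' n) * norm w ^ n)" by simp
    have iii: "norm ((e 0 + w * (\<Sum>n. e' n * w ^ n)) / (1 - w)) \<le> (norm (e 0) + (\<Sum>n. norm (e' n) * norm w ^ n)) / d"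
      unfolding norm_divide by (rule frac_le) (use ii d order_trans[OF norm_ge_zero ii] in auto)
    let ?X = "(e 0 + w * (\<Sum>n. e' n * w ^ n)) / (1 - w)"
    have "norm (c 0 + w * ?X) \<le> norm (c 0) + norm w * norm ?X"
      by (metis norm_mult norm_triangle_ineq)
    also have "norm w * norm ?X \<le> 1 * ((norm (e 0) + (\<Sum>n. norm (e' n) * norm w ^ n)) / d)"
      by (rule mult_mono) (use w iii in auto)
    finally have iv: "norm (c 0 + w * ?X) \<le> norm (c 0) + (norm (e 0) + (\<Sum>n. norm (e' n) * norm w ^ n)) / d" by simp
    have "norm s \<le> (norm (c 0) + (norm (e 0) + (\<Sum>n. norm (e' n) * norm w ^ n)) / d) / d"
      unfolding s_eq norm_divide[of _ "1 - w"]
      by (rule frac_le) (use iv d order_trans[OF norm_ge_zero iv] in auto)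
    also have "\<dots> = norm (c 0) / d + norm (e 0) / d^2 + (\<Sum>n. norm (e' n) * norm w ^ n) / d^2"
      using d by (simp add: field_simps power2_eq_square)
    finally show ?thesis .
  qed
  have c0: "norm (c 0) / d \<le> A * \<beta> N / d" using b0[of N] d by (simp add: c_def divide_right_mono)
  \<comment> \<open>The gain of the first difference cancels one of the two factors
    \<open>1 / d\<close>. This boundary term is thus no larger than the bound for the other one, and
    together they make the weight \<open>2 / d\<close> in \<open>cutoff\<close>.\<close>
  have e0: "norm (e 0) / d^2 \<le> A * \<beta> N / d"
  proof -
    have "norm (e 0) = \<bar>b (N + 1) - b N\<bar>" 
      by (simp add: e_def c_def flip: of_real_diff)
    also have "\<dots> \<le> A * \<beta> N / (real N + 1)" using b1[of N] by (simp add: add_ac)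
    also have "\<dots> \<le> A * \<beta> N * d" 
      using Nd A \<beta>[of N] mult_left_mono[OF Nd, of "A * \<beta> N"] by (simp add: field_simps)
    finally show ?thesis using d by (simp add: field_simps power2_eq_square)
  qed
  have "(\<Sum>n. of_real (b n) * w ^ n) = (\<Sum>n. of_real (b (n + N)) * w ^ (n + N)) + (\<Sum>n<N. of_real (b n) * w ^ n)"
    by (rule suminf_split_initial_segment[OF sb])
  also have "(\<Sum>n. of_real (b (n + N)) * w ^ (n + N)) = w ^ N * s"
    unfolding s_def c_def[symmetric] using suminf_mult[OF sc, of "w ^ N"] 
    by (simp add: c_def power_add mult_ac)
  finally have "norm (\<Sum>n. of_real (b n) * w ^ n) \<le> norm w ^ N * norm s + norm (\<Sum>n<N. of_real (b n) * w ^ n)"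
    by (metis norm_mult norm_power norm_triangle_ineq)
  also have "norm (\<Sum>n<N. of_real (b n) * w ^ n) \<le> (\<Sum>n<N. A * ?h n)"
  proof (rule order_trans[OF norm_sum], rule sum_mono)
    fix n assume "n \<in> {..<N}"
    then have "cutoff n d = 1" by (simp add: cutoff_def N_def)
    then show "norm (of_real (b n) * w ^ n) \<le> A * ?h n"
      using b0[of n] by (simp add: norm_mult norm_power mult.assoc[symmetric] mult_right_mono)
  qed
  also have "norm w ^ N * norm s \<le> (\<Sum>n. A * ?h (n + N))"
  proof -
    have "norm w ^ N * norm s \<le> norm w ^ N * (A * \<beta> N / d + A * \<beta> N / d + (\<Sum>n. norm (e' n) * norm w ^ n) / d^2)"
      using s_le c0 e0 by (intro mult_left_mono) auto
    also have "\<dots> = A * (\<beta> N * norm w ^ N * (2 / d)) + norm w ^ N * (\<Sum>n. norm (e' n) * norm w ^ n) / d^2"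
      by (simp add: algebra_simps)
    also have "\<dots> \<le> A * (\<beta> N * norm w ^ N * (2 / d)) + A * (\<Sum>n. \<beta> (n + N) * norm w ^ (n + N) * (1 / ((real (n + N) + 1)^2 * d^2)))"
      using e'_le by simp
    also have "\<beta> N * norm w ^ N * (2 / d) = (\<Sum>n. \<beta> (n + N) * norm w ^ (n + N) * (if n = 0 then 2/d else 0))"
      by (subst suminf_finite[of "{0}"]) auto
    also have "A * \<dots> + A * (\<Sum>n. \<beta> (n + N) * norm w ^ (n + N) * (1 / ((real (n + N) + 1)^2 * d^2)))
       = A * (\<Sum>n. ?h (n + N))"
      unfolding distrib_left[symmetric] suminf_add[OF sm3 sm2] tailq by (simp only: distrib_left)
    finally show ?thesis using suminf_mult[OF smt] by simp
  qed
  finally have "norm (\<Sum>n. of_real (b n) * w ^ n) \<le> (\<Sum>n. A * ?h (n + N)) + (\<Sum>n<N. A * ?h n)" by simp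
  also have "\<dots> = (\<Sum>n. A * ?h n)"
    by (rule suminf_split_initial_segment[symmetric]) (rule summable_mult[OF smh])
  finally show "norm (\<Sum>n. of_real (b n) * w ^ n) \<le> A * (\<Sum>n. ?h n)"
    using suminf_mult[OF smh] by simp
qed

section \<open>Means of the cutoff weights over the circle\<close>

text \<open>Here the factor \<open>1 / (n + 1)\<close> is gained. The weight 1 is present only for
  \<open>u \<le> 1 / (n + 1)\<close>; the weight \<open>2 / u\<close> only between
  \<open>1 / (n + 1)\<close> and \<open>1 / n\<close>, an interval so short that its contribution is
  at most \<open>4 / (n + 1)\<close>; and \<open>1 / ((n + 1)^2 * u^2)\<close> is integrated from
  \<open>1 / (n + 1)\<close> on. The sum of the constants is 1 + 4 + 1.\<close>

lemma nn_integral_cutoff: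
  "(\<integral>\<^sup>+u\<in>{0<..1}. ennreal (cutoff n u) \<partial>lborel) \<le> ennreal (6 / (real n + 1))"
proof -
  let ?a = "1 / (real n + 1)"
  let ?f = "\<lambda>u. ennreal (indicator {0..?a} u)" 
  \<comment> \<open>For \<open>n = 0\<close> the interval is empty, as \<open>1 / 0 = 0\<close>.
    This is consistent: \<open>u \<le> 1\<close> makes the floor of \<open>1 / u\<close> at least 1,
    so there is no boundary term at 0.\<close>
  let ?g = "\<lambda>u. ennreal (2 * (real n + 1) * indicator {?a..1 / n} u)"
  let ?h = "\<lambda>u. ennreal (1 / ((real n + 1)^2 * u^2)) * indicator {?a..1} u"
  have le: "ennreal (cutoff n u) * indicator {0<..1} u \<le> ?f u + ?g u + ?h u" for u
  proof (cases "u \<in> {0<..1}")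
    case True
    then have u: "0 < u" "u \<le> 1" by auto
    have 1: "u \<le> ?a" if "n < nat \<lfloor>1/u\<rfloor>"
    proof -
      have "real n + 1 \<le> 1 / u" using that by linarith
      then show ?thesis using u by (simp add: field_simps)
    qed
    have 2: "?a \<le> u" if "nat \<lfloor>1/u\<rfloor> \<le> n"
    proof -
      have "1 / u \<le> real n + 1" using that by linarith
      then show ?thesis using u by (simp add: field_simps)
    qed
    have 3: "u \<le> 1 / n \<and> 2 / u \<le> 2 * (real n + 1)" if "n = nat \<lfloor>1/u\<rfloor>"
    proof -
      have "1 \<le> 1 / u" using u by simp
      then have n: "n \<ge> 1" "real n \<le> 1 / u" using that by linarith+
      have "1 / u \<le> real n + 1" using that by linarith
      then show ?thesis using n u by (auto simp: field_simps)
    qed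
    show ?thesis
    proof (cases "n < nat \<lfloor>1/u\<rfloor>")
      case True
      then show ?thesis using 1 u by (auto simp: cutoff_def)
    next
      case F: False
      show ?thesis
      proof (cases "n = nat \<lfloor>1/u\<rfloor>")
        case True
        then have "cutoff n u \<le> 2 * (real n + 1) + 1 / ((real n + 1)^2 * u^2)"
          using 3 by (simp add: cutoff_def)
        then have "ennreal (cutoff n u) \<le> ennreal (2 * (real n + 1)) + ennreal (1 / ((real n + 1)^2 * u^2))"
          by (metis add_nonneg_nonneg ennreal_leI ennreal_plus mult_nonneg_nonneg of_nat_0_le_iff zero_le_divide_1_iff zero_le_numeral zero_le_one zero_le_power2)
        moreover have "?g u = ennreal (2 * (real n + 1))" "?h u = ennreal (1 / ((real n + 1)^2 * u^2))"
          using 2 3 True u by auto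
        ultimately show ?thesis using u 
          by (auto simp: add.assoc intro: add_increasing)
      next
        case False
        then show ?thesis using F 2 u by (auto simp: cutoff_def)
      qed
    qed
  qed simp
  have h: "(\<integral>\<^sup>+u. ?h u \<partial>lborel) = ennreal ((- 1 / ((real n + 1)^2 * 1)) - (- 1 / ((real n + 1)^2 * ?a)))"
  proof (rule nn_integral_has_integral_lebesgue')
    show "((\<lambda>u. 1 / ((real n + 1)^2 * u^2)) has_integral
       (- 1 / ((real n + 1)^2 * 1)) - (- 1 / ((real n + 1)^2 * ?a))) {?a..1}"
    proof (rule fundamental_theorem_of_calculus)
      fix x assume "x \<in> {?a..1}"
      then have "x > 0" by (smt (verit) atLeastAtMost_iff divide_pos_pos of_nat_0_le_iff)
      moreover have "((\<lambda>u. - 1 / (k * u)) has_real_derivative 1 / (k * x\<^sup>2)) (at x within {?a..1})"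
        if "k > 0" "x > 0" for k
        using that by (auto intro!: derivative_eq_intros simp: field_simps power2_eq_square)
      ultimately show "((\<lambda>u. - 1 / ((real n + 1)^2 * u)) has_vector_derivative 1 / ((real n + 1)\<^sup>2 * x\<^sup>2)) (at x within {?a..1})"
        by (simp add: has_real_derivative_iff_has_vector_derivative)
    qed simp
  qed simp
  have "(\<integral>\<^sup>+u\<in>{0<..1}. ennreal (cutoff n u) \<partial>lborel) \<le> (\<integral>\<^sup>+u. ?f u + ?g u + ?h u \<partial>lborel)"
    using le by (intro nn_integral_mono) auto
  also have "\<dots> = (\<integral>\<^sup>+u. ?f u \<partial>lborel) + (\<integral>\<^sup>+u. ?g u \<partial>lborel) + (\<integral>\<^sup>+u. ?h u \<partial>lborel)"
    by (simp add: nn_integral_add)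
  also have "(\<integral>\<^sup>+u. ?f u \<partial>lborel) = ennreal ?a"
    by (simp add: ennreal_indicator)
  also have "(\<integral>\<^sup>+u. ?g u \<partial>lborel) = ennreal (2 * (real n + 1)) * emeasure lborel {?a..1 / n}"
    by (simp add: ennreal_mult ennreal_indicator nn_integral_cmult)
  also have "\<dots> \<le> ennreal (4 / (real n + 1))"
  proof (cases "n = 0")
    case False
    have "2 * (real n + 1) * (1 / real n - ?a) = 2 / n"
    proof -
      have "1 / real n - ?a = ?a / n" using False by (simp add: divide_simps)
      moreover have "2 * x * (1 / x / y) = 2 / y" if "x > 0" for x y :: real using that by simp
      from this[of "real n + 1" "real n"] have "2 * (real n + 1) * (?a / n) = 2 / n" by linarith
      ultimately show ?thesis by metis
    qed
    also have "\<dots> \<le> 4 / (real n + 1)" using False by (simp add: field_simps)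
    finally have le: "2 * (real n + 1) * (1 / real n - ?a) \<le> 4 / (real n + 1)" .
    have "?a \<le> 1 / real n" using False by (simp add: frac_le)
    then have "ennreal (2 * (real n + 1)) * emeasure lborel {?a..1 / n} = ennreal (2 * (real n + 1) * (1 / real n - ?a))"
      by (subst ennreal_mult) auto
    then show ?thesis using le by (simp only: ennreal_leI)
  qed simp
  also have "(\<integral>\<^sup>+u. ?h u \<partial>lborel) \<le> ennreal ?a"
  proof -
    have "- 1 / ((real n + 1)^2 * 1) - (- 1 / ((real n + 1)^2 * ?a)) = ?a - 1 / (real n + 1)^2"
      by (simp add: power2_eq_square)
    also have "\<dots> \<le> ?a" by simp
    finally show ?thesis unfolding h by (rule ennreal_leI)
  qed
  finally have "(\<integral>\<^sup>+u\<in>{0<..1}. ennreal (cutoff n u) \<partial>lborel) \<le> ennreal ?a + ennreal (4 / (real n + 1)) + ennreal ?a"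
    by (simp add: add_mono)
  also have "\<dots> = ennreal (6 / (real n + 1))" 
    by (simp flip: ennreal_plus add: add_divide_distrib[symmetric])
  finally show ?thesis .
qed

text \<open>Jordan's inequality with half its constant, which follows from the cubic Taylor bound
  together with \<open>x \<le> 2\<close> and \<open>3 < pi\<close>.\<close>

lemma sin_ge_pi_frac:
  assumes "0 \<le> x" "x \<le> pi / 2"
  shows "x / pi \<le> sin x"
proof -
  have "\<bar>sin x - (\<Sum>m<3. sin_coeff m * x ^ m)\<bar> \<le> inverse (fact 3) * \<bar>x\<bar> ^ 3"
    by (rule Maclaurin_sin_bound)
  then have "\<bar>sin x - x\<bar> \<le> x ^ 3 / 6"
    using assms by (simp add: sin_coeff_def eval_nat_numeral fact_numeral field_simps)
  then have "x - x ^ 3 / 6 \<le> sin x" by linarith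
  moreover have "x / pi \<le> x - x ^ 3 / 6"
  proof -
    have "x \<le> 2" using assms pi_less_4 by linarith
    then have "x ^ 2 \<le> 4" using assms power_mono[of x 2 2] by simp
    then have "x * (x^2 / 6) \<le> x * (2/3)" using assms by (intro mult_left_mono) auto
    moreover have "x / pi \<le> x / 3" using assms pi_gt3 by (intro divide_left_mono) auto
    ultimately show ?thesis by (simp add: power2_eq_square power3_eq_cube)
  qed
  ultimately show ?thesis by linarith
qed

text \<open>For \<open>s \<le> pi / 2\<close>, \<open>sin s\<close> is the distance from 1 to the
  line through 0 in direction \<open>s\<close>; for larger \<open>s\<close> the real part of
  \<open>1 - rcis r s\<close> is already at least 1.\<close>

lemma norm_one_minus_rcis_ge:
  assumes "0 \<le> r" "0 \<le> s" "s \<le> pi"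
  shows "s / pi \<le> norm (1 - rcis r s)"
proof (cases "s \<le> pi / 2")
  case True
  have "norm (1 - rcis r s)^2 = (r - cos s)^2 + (sin s)^2"
    using sin_cos_squared_add[of s]
    by (simp add: cmod_power2 rcis_def power2_diff power_mult_distrib) (simp add: algebra_simps power2_eq_square flip: distrib_left)
  then have "(sin s)^2 \<le> norm (1 - rcis r s)^2" by simp
  moreover have "0 \<le> sin s" using assms sin_ge_zero by auto
  ultimately have "sin s \<le> norm (1 - rcis r s)" by (meson norm_ge_zero power2_le_imp_le)
  then show ?thesis using sin_ge_pi_frac[of s] assms True by linarith
next
  case False
  then have "cos s \<le> 0" using cos_monotone_0_pi_le[of "pi/2" s] assms by auto
  then have "r * cos s \<le> 0" using assms by (simp add: mult_nonneg_nonpos)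
  then have "1 \<le> Re (1 - rcis r s)" by (simp add: rcis_def)
  moreover have "s / pi \<le> 1" using assms by simp
  ultimately show ?thesis using complex_Re_le_cmod[of "1 - rcis r s"] by linarith
qed

text \<open>The angular distance of \<open>s\<close> from 0 on the circle. Division by
  \<open>pi\<close> makes it a lower bound for the distance from 1 to \<open>rcis r s\<close>
  uniformly in \<open>r\<close>, and gives it values in the range \<open>{0<..1}\<close> of
  \<open>nn_integral_cutoff\<close> when \<open>0 < s < 2 * pi\<close>.\<close>

definition circle_gap :: "real \<Rightarrow> real" where
  "circle_gap s = min s (2 * pi - s) / pi"

lemma circle_gap_measurable [measurable]: "circle_gap \<in> borel_measurable borel"
  unfolding circle_gap_def by measurable

lemma circle_gap_le:
  assumes "0 \<le> r" "0 < s" "s < 2 * pi"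
  shows "circle_gap s \<le> norm (1 - rcis r s)"
proof (cases "s \<le> pi")
  case True
  then show ?thesis using norm_one_minus_rcis_ge[of r s] assms by (simp add: circle_gap_def min_def)
next
  case False
  have "rcis r s = cnj (rcis r (2 * pi - s))" by (simp add: complex_eq_iff rcis_def)
  then have "norm (1 - rcis r s) = norm (cnj (1 - rcis r (2 * pi - s)))" by simp
  also have "\<dots> = norm (1 - rcis r (2 * pi - s))" by (rule complex_mod_cnj)
  finally show ?thesis using norm_one_minus_rcis_ge[of r "2 * pi - s"] assms False
    by (simp add: circle_gap_def min_def)
qed

text \<open>Each half of the circle is mapped to the unit interval by an affine map of slope
  \<open>1 / pi\<close> or \<open>- 1 / pi\<close>, so the constant is twice
  \<open>pi * 6\<close>.\<close>

lemma nn_integral_cutoff_circle_gap: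
  "(\<integral>\<^sup>+s\<in>{0<..<2*pi}. ennreal (cutoff n (circle_gap s)) \<partial>lborel) \<le> ennreal (12 * pi / (real n + 1))"
proof -
  let ?f = "\<lambda>u. ennreal (cutoff n u) * indicator {0<..1} u"
  have "(\<integral>\<^sup>+s\<in>{0<..<2*pi}. ennreal (cutoff n (circle_gap s)) \<partial>lborel)
      \<le> (\<integral>\<^sup>+s. ?f (0 + (1/pi) * s) + ?f (2 + (- 1/pi) * s) \<partial>lborel)"
  proof (intro nn_integral_mono)
    fix s :: real
    show "ennreal (cutoff n (circle_gap s)) * indicator {0<..<2*pi} s \<le> ?f (0 + (1/pi) * s) + ?f (2 + (- 1/pi) * s)"
    proof (cases "0 < s \<and> s < 2 * pi")
      case True
      have *: "2 + (- 1/pi) * s = (2 * pi - s) / pi" by (simp add: field_simps)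
      show ?thesis
      proof (cases "s \<le> pi")
        case F: True
        then have "circle_gap s = s / pi" by (simp add: circle_gap_def min_def)
        then show ?thesis using True F by (simp add: indicator_def)
      next
        case F: False
        then have "circle_gap s = (2 * pi - s) / pi" by (simp add: circle_gap_def min_def)
        then show ?thesis unfolding * using True F by (simp add: indicator_def)
      qed
    qed auto
  qed
  also have "\<dots> = (\<integral>\<^sup>+s. ?f (0 + (1/pi) * s) \<partial>lborel) + (\<integral>\<^sup>+s. ?f (2 + (- 1/pi) * s) \<partial>lborel)"
    by (rule nn_integral_add) measurable
  also have "(\<integral>\<^sup>+s. ?f (0 + (1/pi) * s) \<partial>lborel) = ennreal pi * (\<integral>\<^sup>+u. ?f u \<partial>lborel)"
    by (subst nn_integral_real_affine[of ?f "1/pi" 0]) (auto simp: mult.assoc[symmetric] simp flip: ennreal_mult)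
  also have "(\<integral>\<^sup>+s. ?f (2 + (- 1/pi) * s) \<partial>lborel) = ennreal pi * (\<integral>\<^sup>+u. ?f u \<partial>lborel)"
    by (subst nn_integral_real_affine[of ?f "- 1/pi" 2]) (auto simp: mult.assoc[symmetric] simp flip: ennreal_mult)
  also have "ennreal pi * (\<integral>\<^sup>+u. ?f u \<partial>lborel) + ennreal pi * (\<integral>\<^sup>+u. ?f u \<partial>lborel)
    \<le> ennreal pi * ennreal (6 / (real n + 1)) + ennreal pi * ennreal (6 / (real n + 1))"
    using nn_integral_cutoff[of n] by (intro add_mono mult_left_mono) auto
  also have "\<dots> = ennreal (12 * pi / (real n + 1))"
    by (simp flip: ennreal_mult ennreal_plus add: add_divide_distrib[symmetric])
  finally show ?thesis .
qed

text \<open>Integration by parts against \<open>pi - s\<close>, whose jump at \<open>0\<close> produces the value of the primitive.\<close>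

lemma circle_mean_primitive:
  assumes der: "\<And>z. z \<in> ball 0 1 \<Longrightarrow> (H has_field_derivative h z) (at z)"
    and h: "h holomorphic_on ball 0 1" and r: "0 < r" "r < 1"
  shows "ennreal (2 * norm (H (of_real r) - H 0))
    \<le> ennreal r * (\<integral>\<^sup>+s\<in>{0..2*pi}. ennreal (norm (h (rcis r s))) \<partial>lborel)"
proof -
  have inb: "rcis r s \<in> ball 0 1" for s using r by (simp add: rcis_def norm_mult)
  have hH: "H holomorphic_on ball 0 1" using der unfolding holomorphic_on_open[OF open_ball] by blast
  define g where "g = (\<lambda>s. of_real (pi - s) * (\<i> * rcis r s * h (rcis r s)))"
  have rc: "((\<lambda>s. rcis r s) has_vector_derivative \<i> * rcis r s) (at s within S)" for s S
    unfolding rcis_def cis_conv_exp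
    by (rule has_vector_derivative_real_field[of "\<lambda>z. of_real r * exp (\<i> * z)"])
       (auto intro!: derivative_eq_intros)
  have d1: "((\<lambda>s. H (rcis r s)) has_vector_derivative (\<i> * rcis r s) * h (rcis r s)) (at s within S)" for s S
    using field_vector_diff_chain_within[OF rc has_field_derivative_at_within[OF der[OF inb]]] 
    by (simp add: o_def)
  have d2: "((\<lambda>s. of_real (pi - s) * H (rcis r s)) has_vector_derivative
      (of_real (pi - s) * (\<i> * rcis r s * h (rcis r s)) - H (rcis r s))) (at s within S)" for s S
    by (rule has_vector_derivative_eq_rhs[OF has_vector_derivative_mult[OF _ d1, of "\<lambda>s. of_real (pi - s)" "-1"]])
       (auto intro!: derivative_eq_intros simp: has_vector_derivative_def scaleR_conv_of_real)
  have "((\<lambda>s. of_real (pi - s) * (\<i> * rcis r s * h (rcis r s)) - H (rcis r s)) has_integral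
      (of_real (pi - 2 * pi) * H (rcis r (2 * pi)) - of_real (pi - 0) * H (rcis r 0))) {0..2*pi}"
    by (rule fundamental_theorem_of_calculus) (use d2 in auto)
  note ftc = this
  have eq: "of_real (pi - 2 * pi) * H (rcis r (2 * pi)) - of_real (pi - 0) * H (rcis r 0) = - (2 * pi * H r)"
    by (simp add: rcis_def)
  have i1: "((\<lambda>s. g s - H (rcis r s)) has_integral - (2 * pi * H r)) {0..2*pi}"
    using ftc unfolding g_def eq .
  \<comment> \<open>The mean value property, from Cauchy's formula at the centre. Subtracting the
    mean of \<open>H\<close> from its boundary value at \<open>r\<close> leaves
    \<open>H r - H 0\<close>.\<close>
  have i2: "((\<lambda>s. H (rcis r s)) has_integral 2 * pi * H 0) {0..2*pi}"
  proof -
    have "((\<lambda>u. H u / (u - 0)) has_contour_integral (2 * of_real pi * \<i> * H 0)) (circlepath 0 r)"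
    proof (rule Cauchy_integral_circlepath_simple)
      show "H holomorphic_on cball 0 r" by (rule holomorphic_on_subset[OF hH]) (use r in auto)
    qed (use r in auto)
    then have "((\<lambda>s. H (0 + of_real r * cis s) / (0 + of_real r * cis s - 0) * of_real r * \<i> * cis s)
        has_integral (2 * of_real pi * \<i> * H 0)) {0..2*pi}"
      unfolding circlepath_def by (subst (asm) has_contour_integral_part_circlepath_iff) simp_all
    then have "((\<lambda>s. \<i> * H (rcis r s)) has_integral (2 * of_real pi * \<i> * H 0)) {0..2*pi}"
      by (rule has_integral_eq[rotated]) (use r in \<open>simp add: rcis_def field_simps\<close>)
    from has_integral_mult_right[OF this, of "-\<i>"]
    have A: "((\<lambda>s. - \<i> * (\<i> * H (rcis r s))) has_integral - \<i> * (2 * of_real pi * \<i> * H 0)) {0..2*pi}" .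
    have eq1: "- \<i> * (\<i> * x) = x" for x :: complex by (simp flip: mult.assoc)
    have eq2: "- \<i> * (2 * of_real pi * \<i> * H 0) = 2 * pi * H 0"
      by (simp add: mult.commute mult.left_commute)
    show ?thesis using A unfolding eq2 eq1 .
  qed
  have i3: "(g has_integral - (2 * pi * (H r - H 0))) {0..2*pi}"
    using has_integral_add[OF i1 i2] by (simp add: algebra_simps)
  have ch: "continuous_on {0..2*pi} (\<lambda>s. h (rcis r s))"
    by (rule continuous_on_compose2[OF holomorphic_on_imp_continuous_on[OF h]])
       (use inb in \<open>auto simp: rcis_def cis_conv_exp intro!: continuous_intros\<close>)
  then have ci: "(\<lambda>s. norm (h (rcis r s))) integrable_on {0..2*pi}"
    by (intro integrable_continuous_real continuous_intros)
  \<comment> \<open>On the interval \<open>\<bar>pi - s\<bar> \<le> pi\<close>; cancelling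
    \<open>pi\<close> against \<open>2 * pi\<close> leaves the factor 2 of the claim.\<close>
  have "norm (- (2 * pi * (H r - H 0))) \<le> integral {0..2*pi} (\<lambda>s. pi * r * norm (h (rcis r s)))"
  proof -
    have "norm (integral {0..2*pi} g) \<le> integral {0..2*pi} (\<lambda>s. pi * r * norm (h (rcis r s)))"
    proof (rule integral_norm_bound_integral)
      show "g integrable_on {0..2 * pi}" using i3 by blast
      show "(\<lambda>s. pi * r * norm (h (rcis r s))) integrable_on {0..2*pi}"
        using integrable_on_cmult_left[OF ci, of "pi * r"] by simp
      fix s assume "s \<in> {0..2*pi}"
      then have "\<bar>pi - s\<bar> \<le> pi" by auto
      then show "norm (g s) \<le> pi * r * norm (h (rcis r s))"
        using r by (auto simp: g_def norm_mult rcis_def abs_mult mult.assoc simp del: of_real_diff intro!: mult_mono)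
    qed
    then show ?thesis using i3 by (simp add: integral_unique)
  qed
  then have "2 * norm (H r - H 0) \<le> r * integral {0..2*pi} (\<lambda>s. norm (h (rcis r s)))"
    by (simp add: norm_mult mult.assoc)
  then have "ennreal (2 * norm (H r - H 0)) \<le> ennreal (r * integral {0..2*pi} (\<lambda>s. norm (h (rcis r s))))"
    by (rule ennreal_leI)
  also have "\<dots> = ennreal r * ennreal (integral {0..2*pi} (\<lambda>s. norm (h (rcis r s))))"
    using r by (simp add: ennreal_mult')
  also have "ennreal (integral {0..2*pi} (\<lambda>s. norm (h (rcis r s)))) = (\<integral>\<^sup>+s\<in>{0..2*pi}. ennreal (norm (h (rcis r s))) \<partial>lborel)"
    by (rule sym, rule nn_integral_has_integral_lebesgue') (use ci in \<open>auto intro: integrable_integral\<close>)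
  finally show ?thesis .
qed

section \<open>Tails and moments of a radial weight\<close>

lemma one_minus_ge_exp:
  fixes x :: real
  assumes "0 \<le> x" "x \<le> 1/2"
  shows "exp (- 2 * x) \<le> 1 - x"
proof -
  have "x * x \<le> x * (1/2)" using assms by (intro mult_left_mono) auto
  then have "1 \<le> (1 + 2 * x) * (1 - x)" using assms by (simp add: algebra_simps)
  also have "\<dots> \<le> exp (2 * x) * (1 - x)"
    using assms exp_ge_add_one_self[of "2 * x"] by (intro mult_right_mono) auto
  finally show ?thesis by (simp add: exp_minus field_simps)
qed

lemma power_le_exp:
  fixes x :: real
  assumes "0 \<le> x" "x \<le> 1"
  shows "(1 - x) ^ n \<le> exp (- x * n)"
proof -
  have "1 - x \<le> exp (- x)" using exp_ge_add_one_self[of "- x"] by simp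
  then have "(1 - x) ^ n \<le> exp (- x) ^ n" using assms by (intro power_mono) auto
  then show ?thesis by (simp add: exp_of_nat_mult[symmetric] mult.commute)
qed

lemma power_ge_exp:
  fixes x :: real
  assumes "0 \<le> x" "x \<le> 1/2"
  shows "exp (- 2 * x * n) \<le> (1 - x) ^ n"
proof -
  have "exp (- 2 * x) ^ n \<le> (1 - x) ^ n" using one_minus_ge_exp[OF assms] by (intro power_mono) auto
  then show ?thesis by (simp add: exp_of_nat_mult[symmetric] mult.commute mult.left_commute)
qed

locale weight =
  fixes \<omega> :: "real \<Rightarrow> real"
  assumes weight: "radial_weight \<omega>"
begin

abbreviation W :: "real \<Rightarrow> real" where "W \<equiv> weight_tail \<omega>"

definition I :: "(real \<Rightarrow> real) \<Rightarrow> real" where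
  "I \<phi> = (LINT s:{0..<1}|lebesgue. \<phi> s * \<omega> s)"

definition mom :: "nat \<Rightarrow> real" where "mom n = I (\<lambda>s. s ^ n)"

lemma omega_nonneg: "0 \<le> s \<Longrightarrow> s < 1 \<Longrightarrow> 0 \<le> \<omega> s"
  using weight by (auto simp: radial_weight_def)

lemma omega_integrable: "set_integrable lebesgue {0..<1} \<omega>"
  using weight by (auto simp: radial_weight_def)

lemma W_pos: "0 \<le> r \<Longrightarrow> r < 1 \<Longrightarrow> 0 < W r"
  using weight by (auto simp: radial_weight_def)

lemma integrable_mult_omega:
  assumes [measurable]: "\<phi> \<in> borel_measurable borel" and K: "\<And>s. 0 \<le> s \<Longrightarrow> s < 1 \<Longrightarrow> \<bar>\<phi> s\<bar> \<le> K"
  shows "set_integrable lebesgue {0..<1} (\<lambda>s. \<phi> s * \<omega> s)"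
proof (rule set_integrable_bound)
  show "set_integrable lebesgue {0..<1} (\<lambda>s. K * \<omega> s)" using omega_integrable by simp
  have m: "\<phi> \<in> borel_measurable lebesgue" by (intro measurable_completion) simp
  have "(\<lambda>x. indicator {0..<1} x *\<^sub>R \<omega> x) \<in> borel_measurable lebesgue"
    using omega_integrable by (auto simp: set_integrable_def)
  then have "(\<lambda>x. \<phi> x * (indicator {0..<1} x *\<^sub>R \<omega> x)) \<in> borel_measurable lebesgue"
    using m by (rule borel_measurable_times[rotated])
  then show "set_borel_measurable lebesgue {0..<1} (\<lambda>s. \<phi> s * \<omega> s)"
    by (simp add: set_borel_measurable_def mult_ac)
  show "AE x in lebesgue. x \<in> {0..<1} \<longrightarrow> norm (\<phi> x * \<omega> x) \<le> norm (K * \<omega> x)"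
  proof (intro AE_I2 impI)
    fix x :: real assume "x \<in> {0..<1}"
    then show "norm (\<phi> x * \<omega> x) \<le> norm (K * \<omega> x)"
      using K[of x] by (auto simp: abs_mult intro!: mult_right_mono)
  qed
qed

lemma I_mono:
  assumes "\<phi> \<in> borel_measurable borel" "\<psi> \<in> borel_measurable borel"
    and "\<And>s. 0 \<le> s \<Longrightarrow> s < 1 \<Longrightarrow> \<bar>\<phi> s\<bar> \<le> K" "\<And>s. 0 \<le> s \<Longrightarrow> s < 1 \<Longrightarrow> \<bar>\<psi> s\<bar> \<le> K'"
    and "\<And>s. 0 \<le> s \<Longrightarrow> s < 1 \<Longrightarrow> \<phi> s \<le> \<psi> s"
  shows "I \<phi> \<le> I \<psi>"
  unfolding I_def
  by (rule set_integral_mono[OF integrable_mult_omega[OF assms(1,3)] integrable_mult_omega[OF assms(2,4)]])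
     (auto intro!: mult_right_mono assms(5) omega_nonneg)

lemma I_add:
  assumes "\<phi> \<in> borel_measurable borel" "\<psi> \<in> borel_measurable borel"
    and "\<And>s. 0 \<le> s \<Longrightarrow> s < 1 \<Longrightarrow> \<bar>\<phi> s\<bar> \<le> K" "\<And>s. 0 \<le> s \<Longrightarrow> s < 1 \<Longrightarrow> \<bar>\<psi> s\<bar> \<le> K'"
  shows "I (\<lambda>s. \<phi> s + \<psi> s) = I \<phi> + I \<psi>"
  unfolding I_def
  using set_integral_add(2)[OF integrable_mult_omega[OF assms(1,3)] integrable_mult_omega[OF assms(2,4)]]
  by (simp add: distrib_right)

lemma I_cmult: "I (\<lambda>s. c * \<phi> s) = c * I \<phi>"
  unfolding I_def by (simp add: mult.assoc)

lemma power_bounded: "0 \<le> s \<Longrightarrow> s < 1 \<Longrightarrow> \<bar>s ^ n\<bar> \<le> (1::real)"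
  by (simp add: power_abs power_le_one)

lemma W_eq_I: "0 \<le> r \<Longrightarrow> W r = I (indicator {r..})"
  unfolding weight_tail_def I_def set_lebesgue_integral_def
  by (intro Bochner_Integration.integral_cong) (auto simp: indicator_def)

lemma W_antimono: "0 \<le> r \<Longrightarrow> r \<le> s \<Longrightarrow> W s \<le> W r"
  by (simp add: W_eq_I) (rule I_mono[where K=1 and K'=1], auto simp: indicator_def)

lemma mom_nonneg: "0 \<le> mom n"
  unfolding mom_def I_def set_lebesgue_integral_def
  by (rule integral_nonneg_AE) (auto simp: omega_nonneg indicator_def)

lemma mom_ge:
  assumes r: "0 \<le> r"
  shows "r ^ n * W r \<le> mom n"
proof (cases "r < 1")
  case True
  have "r ^ n * W r = I (\<lambda>s. r ^ n * indicator {r..} s)" using r by (simp add: W_eq_I I_cmult)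
  also have "\<dots> \<le> mom n" unfolding mom_def
    by (rule I_mono[where K=1 and K'=1])
       (use r True in \<open>auto simp: indicator_def power_bounded power_le_one intro: power_mono\<close>)
  finally show ?thesis .
next
  case False
  then have "W r = 0" by (simp add: weight_tail_def set_lebesgue_integral_def)
  then show ?thesis using mom_nonneg by simp
qed

lemma mom_pos: "0 < mom n"
proof -
  have "0 < (1/2) ^ n * W (1/2)" using W_pos[of "1/2"] by simp
  then show ?thesis using mom_ge[of "1/2" n] by linarith
qed

lemma mom_antimono: "n \<le> k \<Longrightarrow> mom k \<le> mom n"
  unfolding mom_def
  by (rule I_mono[where K=1 and K'=1]) (auto simp: power_le_one intro: power_decreasing)

lemma mom_le_W0: "mom n \<le> W 0"
  unfolding mom_def
  by (simp add: W_eq_I) (rule I_mono[where K=1 and K'=1], auto simp: power_bounded indicator_def power_le_one)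

lemma moment_eq_mom: "moment \<omega> (2 * real n + 1) = mom (2 * n + 1)"
  unfolding moment_def mom_def I_def set_lebesgue_integral_def
proof (intro Bochner_Integration.integral_cong refl)
  fix s :: real
  have "s powr (2 * real n + 1) = s ^ (2 * n + 1)" if "0 \<le> s"
  proof (cases "s = 0")
    case False
    then have "s powr real (2 * n + 1) = s ^ (2 * n + 1)" using that by (intro powr_realpow) simp
    then show ?thesis by (simp add: add.commute)
  qed simp
  then show "indicator {0..<1} s *\<^sub>R (s powr (2 * real n + 1) * \<omega> s) = indicator {0..<1} s *\<^sub>R (s ^ (2 * n + 1) * \<omega> s)"
    by (auto simp: indicator_def)
qed

text \<open>The part of \<open>mom b\<close> living on \<open>[0, r)\<close> is absorbed into \<open>mom a\<close>.\<close>

lemma mom_le_tail: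
  assumes A: "mom a \<le> A * mom b" "a \<le> b" "0 \<le> A" and r: "0 \<le> r" "r < 1" "A * r ^ (b - a) \<le> 1/2"
  shows "mom a \<le> 2 * A * W r"
proof -
  have "mom b \<le> I (\<lambda>s. r ^ (b - a) * s ^ a + indicator {r..} s)"
    unfolding mom_def
  proof (rule I_mono[where K=1 and K'=2])
    fix s :: real assume s: "0 \<le> s" "s < 1"
    have "r ^ (b - a) * s ^ a \<le> 1 * 1" using s r by (intro mult_mono power_le_one) auto
    moreover have "0 \<le> r ^ (b - a) * s ^ a" using s r by simp
    ultimately have *: "r ^ (b - a) * s ^ a \<le> 1" "0 \<le> r ^ (b - a) * s ^ a" by auto
    then show "\<bar>r ^ (b - a) * s ^ a + indicator {r..} s\<bar> \<le> 2" by (auto simp: indicator_def)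
    show "s ^ b \<le> r ^ (b - a) * s ^ a + indicator {r..} s"
    proof (cases "r \<le> s")
      case True
      have "s ^ b \<le> 1" using s by (simp add: power_le_one)
      then show ?thesis using True * by (simp add: add_increasing)
    next
      case False
      have "s ^ b = s ^ (b - a) * s ^ a" using A by (simp flip: power_add)
      also have "\<dots> \<le> r ^ (b - a) * s ^ a" using False s by (intro mult_right_mono power_mono) auto
      finally show ?thesis using False by simp
    qed
  qed (auto simp: power_le_one)
  also have "\<dots> = r ^ (b - a) * mom a + W r"
    unfolding mom_def using r
    by (subst I_add[where K=1 and K'=1])
       (auto simp: I_cmult W_eq_I indicator_def abs_mult power_abs intro!: mult_le_one power_le_one)
  finally have "A * mom b \<le> A * (r ^ (b - a) * mom a + W r)" using A by (intro mult_left_mono) auto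
  moreover have "A * r ^ (b - a) * mom a \<le> 1/2 * mom a" using r mom_nonneg by (intro mult_right_mono) auto
  ultimately show ?thesis using A by (simp add: algebra_simps)
qed

text \<open>A moment of order about \<open>1 / d\<close> sees the tail at distance about
  \<open>d\<close> from 1. With \<open>d = (1 - r) / 2\<close> and \<open>N\<close> about
  \<open>L / d\<close>, \<open>mom_le_tail\<close> bounds \<open>mom (5 * N)\<close> above by the
  tail at \<open>1 - d = (1 + r) / 2\<close>, and \<open>mom_ge\<close> bounds it below by the tail
  at \<open>1 - 2 * d = r\<close>. Orders with ratio 6/5 serve as well as a doubling, since their
  gap \<open>N\<close> is comparable with both.\<close>

lemma D_hat_if_mom:
  assumes A: "\<And>N. 1 \<le> N \<Longrightarrow> mom (5 * N) \<le> A * mom (6 * N)"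
  shows "\<omega> \<in> D_hat"
proof -
  define A' where "A' = max A 1"
  have A': "mom (5 * N) \<le> A' * mom (6 * N)" if "1 \<le> N" for N
    using A[OF that] mult_right_mono[of A A' "mom (6 * N)"] mom_nonneg by (force simp: A'_def)
  have A1: "1 \<le> A'" by (simp add: A'_def)
  \<comment> \<open>Chosen so that \<open>A' * (1 - d) ^ N \<le> 1/2\<close> as soon as
    \<open>d * N \<ge> L\<close>.\<close>
  define L where "L = ln (2 * A')"
  have L: "exp (- L) = 1 / (2 * A')" "0 < L" using A1 by (auto simp: L_def exp_minus field_simps)
  \<comment> \<open>The quotient of tails serves \<open>r \<le> 1/2\<close>, where
    \<open>(1 + r) / 2 \<le> 3/4\<close>; the last summand serves the remaining \<open>r\<close>;
    the summand 2 ensures \<open>C > 1\<close>.\<close>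
  define C where "C = 2 + W 0 / W (3/4) + 2 * A' * exp (20 * (L + 1))"
  have W34: "0 < W (3/4)" "0 \<le> W 0" using W_pos[of "3/4"] W_pos[of 0] by auto
  then have C: "1 < C" "W 0 / W (3/4) \<le> C" "2 * A' * exp (20 * (L + 1)) \<le> C" 
    using A1 by (auto simp: C_def intro!: add_pos_nonneg add_increasing add_increasing2)
  have "W r \<le> C * W ((1 + r) / 2)" if r: "0 \<le> r" "r < 1" for r
  proof (cases "r \<le> 1/2")
    case True
    have "W r \<le> W 0" using r W_antimono by simp
    also have "\<dots> = W 0 / W (3/4) * W (3/4)" using W34 by simp
    also have "\<dots> \<le> C * W ((1 + r) / 2)"
      using C W34 r True by (intro mult_mono W_antimono) auto
    finally show ?thesis .
  next
    case False
    define d where "d = (1 - r) / 2"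
    have d: "0 < d" "d < 1/4" and rd: "r = 1 - 2 * d" and rd': "(1 + r) / 2 = 1 - d"
      using r False by (auto simp: d_def field_simps)
    define N where "N = nat \<lceil>L / d\<rceil>"
    have Ld: "0 < L / d" using L d by simp
    then have N: "1 \<le> N" "L / d \<le> N" "N \<le> L / d + 1" unfolding N_def by linarith+
    have "A' * (1 - d) ^ (6 * N - 5 * N) \<le> 1/2"
    proof -
      have "(1 - d) ^ N \<le> exp (- d * N)" using d by (intro power_le_exp) auto
      also have "\<dots> \<le> exp (- L)" using N(2) d by (simp add: field_simps)
      finally show ?thesis using L A1 by (simp add: field_simps)
    qed
    then have 1: "mom (5 * N) \<le> 2 * A' * W (1 - d)"
      using A1 d by (intro mom_le_tail[OF A'[OF N(1)]]) auto
    \<comment> \<open>The exponent for \<open>r = 1 - 2 * d\<close> at order \<open>5 * N\<close> is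
      \<open>20 * d * N\<close>, and \<open>d * N \<le> L + d\<close>.\<close>
    have "exp (- 20 * (L + 1)) \<le> exp (- 2 * (2 * d) * (5 * N))"
    proof -
      have "d * N \<le> L + d" using N(3) d by (simp add: field_simps)
      then show ?thesis using d by simp
    qed
    also have "\<dots> \<le> r ^ (5 * N)"
      unfolding rd using power_ge_exp[of "2 * d" "5 * N"] d by simp
    finally have "exp (- 20 * (L + 1)) * W r \<le> r ^ (5 * N) * W r"
      using W_pos[OF r] by (intro mult_right_mono) auto
    also have "\<dots> \<le> mom (5 * N)" using r by (intro mom_ge) auto
    also note 1
    finally have le: "exp (- 20 * (L + 1)) * W r \<le> 2 * A' * W (1 - d)" .
    have "exp (20 * (L + 1)) * exp (- 20 * (L + 1)) = 1" by (simp flip: exp_add)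
    then have "W r = exp (20 * (L + 1)) * (exp (- 20 * (L + 1)) * W r)" by (metis mult.assoc mult_1)
    also have "\<dots> \<le> exp (20 * (L + 1)) * (2 * A' * W (1 - d))" by (intro mult_left_mono le) simp
    finally have "W r \<le> 2 * A' * exp (20 * (L + 1)) * W (1 - d)" by (simp add: mult_ac)
    also have "\<dots> \<le> C * W (1 - d)" using C W_pos[of "1 - d"] d by (intro mult_right_mono) auto
    finally show ?thesis unfolding rd' .
  qed
  then show ?thesis using weight C(1) by (auto simp: D_hat_def)
qed

text \<open>The weight is only Lebesgue measurable. Replacing it by an almost everywhere equal Borel
  density gives a finite measure on the Borel sets, to which Fubini applies in
  \<open>mom_doubling\<close>.\<close>

lemma borel_representation:
  obtains \<mu> :: "real measure" where "sets \<mu> = sets borel" "finite_measure \<mu>"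
    "\<And>\<phi>. \<phi> \<in> borel_measurable borel \<Longrightarrow> (\<integral>\<^sup>+s. ennreal (\<phi> s) \<partial>\<mu>) = (\<integral>\<^sup>+s\<in>{0..<1}. ennreal (\<phi> s) * ennreal (\<omega> s) \<partial>lebesgue)"
proof -
  have m: "(\<lambda>x. indicator {0..<1} x *\<^sub>R \<omega> x) \<in> borel_measurable lebesgue"
    using omega_integrable by (auto simp: set_integrable_def)
  obtain v where v [measurable]: "v \<in> borel_measurable lborel" and ae: "AE x in lborel. indicator {0..<1} x *\<^sub>R \<omega> x = v x"
    using completion_ex_borel_measurable_real[OF m] by auto
  define \<mu> where "\<mu> = density lborel (\<lambda>x. ennreal (v x))"
  have vm: "v \<in> borel_measurable borel" using v by simp
  have eq: "(\<integral>\<^sup>+s. ennreal (\<phi> s) \<partial>\<mu>) = (\<integral>\<^sup>+s\<in>{0..<1}. ennreal (\<phi> s) * ennreal (\<omega> s) \<partial>lebesgue)"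
    if [measurable]: "\<phi> \<in> borel_measurable borel" for \<phi>
  proof -
    have "(\<integral>\<^sup>+s. ennreal (\<phi> s) \<partial>\<mu>) = (\<integral>\<^sup>+s. ennreal (v s) * ennreal (\<phi> s) \<partial>lborel)"
      unfolding \<mu>_def using vm by (subst nn_integral_density) auto
    also have "\<dots> = (\<integral>\<^sup>+s\<in>{0..<1}. ennreal (\<phi> s) * ennreal (\<omega> s) \<partial>lborel)"
      by (rule nn_integral_cong_AE) (use ae in eventually_elim, auto simp: indicator_def mult.commute split: if_splits)
    finally show ?thesis by (simp add: nn_integral_completion)
  qed
  have "emeasure \<mu> (space \<mu>) < \<infinity>"
  proof -
    have "emeasure \<mu> (space \<mu>) = (\<integral>\<^sup>+s. ennreal 1 \<partial>\<mu>)" by simp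
    also have "\<dots> = (\<integral>\<^sup>+s\<in>{0..<1}. ennreal 1 * ennreal (\<omega> s) \<partial>lebesgue)" by (rule eq) simp
    also have "\<dots> \<le> (\<integral>\<^sup>+s. ennreal (norm (indicator {0..<1} s *\<^sub>R \<omega> s)) \<partial>lebesgue)"
      by (rule nn_integral_mono) (auto simp: indicator_def omega_nonneg)
    also have "\<dots> < \<infinity>" using omega_integrable unfolding set_integrable_def integrable_iff_bounded by auto
    finally show ?thesis .
  qed
  then have "finite_measure \<mu>" by (intro finite_measureI) auto
  then show ?thesis by (intro that[OF _ _ eq]) (auto simp: \<mu>_def)
qed

lemma ennreal_I:
  assumes "\<phi> \<in> borel_measurable borel" "\<And>s. 0 \<le> s \<Longrightarrow> s < 1 \<Longrightarrow> 0 \<le> \<phi> s \<and> \<phi> s \<le> K"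
  shows "ennreal (I \<phi>) = (\<integral>\<^sup>+s\<in>{0..<1}. ennreal (\<phi> s) * ennreal (\<omega> s) \<partial>lebesgue)"
proof -
  have i: "set_integrable lebesgue {0..<1} (\<lambda>s. \<phi> s * \<omega> s)"
    using assms by (intro integrable_mult_omega[where K=K]) auto
  have "ennreal (I \<phi>) = (\<integral>\<^sup>+s. ennreal (indicator {0..<1} s *\<^sub>R (\<phi> s * \<omega> s)) \<partial>lebesgue)"
    unfolding I_def set_lebesgue_integral_def
    by (rule nn_integral_eq_integral[symmetric])
       (use i assms omega_nonneg in \<open>auto simp: set_integrable_def indicator_def\<close>)
  also have "\<dots> = (\<integral>\<^sup>+s\<in>{0..<1}. ennreal (\<phi> s) * ennreal (\<omega> s) \<partial>lebesgue)"
    using assms omega_nonneg by (intro nn_integral_cong) (auto simp: indicator_def ennreal_mult)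
  finally show ?thesis .
qed

text \<open>Layer cake: \<open>s\<^sup>n\<close> is the measure of \<open>{y. y \<le> s\<^sup>n}\<close>, and \<open>(1 + r) / 2 \<ge> sqrt r\<close> turns the
  doubling condition for the tails into one for the moments.\<close>

lemma mom_doubling:
  assumes C: "\<And>r. 0 \<le> r \<Longrightarrow> r < 1 \<Longrightarrow> W r \<le> C * W ((1 + r) / 2)" "0 \<le> C" and n: "1 \<le> n"
  shows "mom n \<le> C * mom (2 * n)"
proof -
  obtain \<mu> where sets_mu [measurable_cong]: "sets \<mu> = sets borel" and fin: "finite_measure \<mu>"
    and mu: "\<And>\<phi>. \<phi> \<in> borel_measurable borel \<Longrightarrow> (\<integral>\<^sup>+s. ennreal (\<phi> s) \<partial>\<mu>) = (\<integral>\<^sup>+s\<in>{0..<1}. ennreal (\<phi> s) * ennreal (\<omega> s) \<partial>lebesgue)"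
    using borel_representation by blast
  interpret finite_measure \<mu> by fact
  interpret pair_sigma_finite \<mu> lborel ..
  have layer: "ennreal (mom k) = (\<integral>\<^sup>+y\<in>{0<..<1}. ennreal (W (root k y)) \<partial>lborel)"
    and layer_meas: "(\<lambda>y. ennreal (W (root k y)) * indicator {0<..<1} y) \<in> borel_measurable lborel" if k: "1 \<le> k" for k
  proof -
    let ?f = "\<lambda>s y. indicator {0..<1::real} s * (indicator {0<..<1::real} y * (if y \<le> s ^ k then 1 else 0)) :: ennreal"
    \<comment> \<open>For \<open>0 < y < 1\<close> and \<open>s \<ge> 0\<close>,
      \<open>y \<le> s ^ k\<close> means \<open>root k y \<le> s\<close>; integrating over
      \<open>s\<close> first therefore produces a tail of the weight.\<close>
    have inner: "(\<integral>\<^sup>+s. ?f s y \<partial>\<mu>) = ennreal (W (root k y)) * indicator {0<..<1} y" for y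
      proof (cases "y \<in> {0<..<1}")
        case True
        define r where "r = root k y"
        have r: "0 \<le> r" "r ^ k = y" using True k by (auto simp: r_def)
        have "(\<integral>\<^sup>+s. ?f s y \<partial>\<mu>) = (\<integral>\<^sup>+s. ennreal (indicator {0..<1} s * indicator {r..} s) \<partial>\<mu>)"
        proof (rule nn_integral_cong)
          fix s :: real
          have "y \<le> s ^ k \<longleftrightarrow> r \<le> s" if "0 \<le> s"
            using power_mono_iff[of r s k] r that k by auto
          then show "?f s y = ennreal (indicator {0..<1} s * indicator {r..} s)"
            using True by (auto simp: indicator_def)
        qed
        also have "\<dots> = (\<integral>\<^sup>+s\<in>{0..<1}. ennreal (indicator {0..<1} s * indicator {r..} s) * ennreal (\<omega> s) \<partial>lebesgue)"
          by (rule mu) measurable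
        also have "\<dots> = (\<integral>\<^sup>+s\<in>{0..<1}. ennreal (indicator {r..} s) * ennreal (\<omega> s) \<partial>lebesgue)"
          by (intro nn_integral_cong) (auto simp: indicator_def)
        also have "\<dots> = ennreal (W r)" unfolding W_eq_I[OF r(1)]
          by (rule ennreal_I[where K=1, symmetric]) (auto simp: indicator_def)
        finally show ?thesis using True by (simp add: r_def)
      qed simp
    have "ennreal (mom k) = (\<integral>\<^sup>+s\<in>{0..<1}. ennreal (s ^ k) * ennreal (\<omega> s) \<partial>lebesgue)"
      unfolding mom_def by (rule ennreal_I[where K=1]) (auto simp: power_le_one)
    also have "\<dots> = (\<integral>\<^sup>+s\<in>{0..<1}. ennreal (indicator {0..<1} s * s ^ k) * ennreal (\<omega> s) \<partial>lebesgue)"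
      by (intro nn_integral_cong) (auto simp: indicator_def)
    also have "\<dots> = (\<integral>\<^sup>+s. ennreal (indicator {0..<1} s * s ^ k) \<partial>\<mu>)"
      by (rule mu[symmetric]) measurable
    also have "\<dots> = (\<integral>\<^sup>+s. \<integral>\<^sup>+y. ?f s y \<partial>lborel \<partial>\<mu>)"
    proof (rule nn_integral_cong)
      fix s :: real
      show "ennreal (indicator {0..<1} s * s ^ k) = (\<integral>\<^sup>+y. ?f s y \<partial>lborel)"
      proof (cases "s \<in> {0..<1}")
        case True
        then have sk: "0 \<le> s ^ k" "s ^ k < 1" using k by (auto simp: power_less_one_iff)
        have "(\<integral>\<^sup>+y. ?f s y \<partial>lborel) = (\<integral>\<^sup>+y. indicator {0<..s ^ k} y \<partial>lborel)"
          using True sk by (intro nn_integral_cong) (auto simp: indicator_def)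
        also have "\<dots> = ennreal (s ^ k)" using sk by simp
        finally show ?thesis using True by simp
      qed simp
    qed
    also have "\<dots> = (\<integral>\<^sup>+y. \<integral>\<^sup>+s. ?f s y \<partial>\<mu> \<partial>lborel)"
      by (rule Fubini'[symmetric]) measurable
    also have "\<dots> = (\<integral>\<^sup>+y\<in>{0<..<1}. ennreal (W (root k y)) \<partial>lborel)"
      unfolding inner ..
    finally show "ennreal (mom k) = (\<integral>\<^sup>+y\<in>{0<..<1}. ennreal (W (root k y)) \<partial>lborel)" .
    have "(\<lambda>y. \<integral>\<^sup>+s. ?f s y \<partial>\<mu>) \<in> borel_measurable lborel" by measurable
    then show "(\<lambda>y. ennreal (W (root k y)) * indicator {0<..<1} y) \<in> borel_measurable lborel"
      unfolding inner .
  qed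
  have "ennreal (mom n) \<le> (\<integral>\<^sup>+y. ennreal C * (ennreal (W (root (2 * n) y)) * indicator {0<..<1} y) \<partial>lborel)"
    unfolding layer[OF n]
  proof (rule nn_integral_mono)
    fix y :: real
    show "ennreal (W (root n y)) * indicator {0<..<1} y \<le> ennreal C * (ennreal (W (root (2 * n) y)) * indicator {0<..<1} y)"
    proof (cases "y \<in> {0<..<1}")
      case True
      define r where "r = root n y"
      have r: "0 \<le> r" "r < 1" using True n by (auto simp: r_def)
      have q: "root (2 * n) y = sqrt r" by (simp add: r_def sqrt_def real_root_mult_exp)
      have "W r \<le> C * W ((1 + r) / 2)" by (rule C(1)[OF r])
      also have "\<dots> \<le> C * W (sqrt r)" using r C(2) arith_geo_mean_sqrt[of 1 r]
        by (intro mult_left_mono W_antimono) auto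
      finally show ?thesis using True C(2) by (simp add: q r_def ennreal_leI flip: ennreal_mult')
    qed simp
  qed
  also have "\<dots> = ennreal C * ennreal (mom (2 * n))"
  proof -
    have k: "1 \<le> 2 * n" using n by simp
    show ?thesis unfolding layer[OF k] by (rule nn_integral_cmult[OF layer_meas[OF k]])
  qed
  also have "\<dots> = ennreal (C * mom (2 * n))" using C(2) by (simp add: ennreal_mult')
  finally show ?thesis using C(2) mom_nonneg by (simp add: ennreal_le_iff)
qed

section \<open>The primitive \<open>G\<close> of the reciprocal tail, and reverse doubling\<close>

text \<open>The factor multiplying \<open>\<omega> t\<close> in \<open>m1 \<omega>\<close> is \<open>1 + G t\<close>.\<close>

definition G :: "real \<Rightarrow> real" where "G t = integral {0..t} (\<lambda>s. 1 / W s)"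

lemma inverse_W_mono: "0 \<le> s \<Longrightarrow> s \<le> t \<Longrightarrow> t < 1 \<Longrightarrow> 1 / W s \<le> 1 / W t"
  using W_antimono[of s t] W_pos[of t] by (simp add: frac_le)

lemma inverse_W_integrable: "0 \<le> a \<Longrightarrow> b < 1 \<Longrightarrow> (\<lambda>s. 1 / W s) integrable_on {a..b}"
  by (rule integrable_on_mono_on) (auto intro!: mono_onI inverse_W_mono)

lemma G_diff:
  assumes "0 \<le> a" "a \<le> b" "b < 1"
  shows "(b - a) / W a \<le> G b - G a" "G b - G a \<le> (b - a) / W b"
proof -
  have "G a + integral {a..b} (\<lambda>s. 1 / W s) = G b"
    unfolding G_def using assms
    by (intro Henstock_Kurzweil_Integration.integral_combine inverse_W_integrable) auto
  moreover have "integral {a..b} (\<lambda>_. 1 / W a) \<le> integral {a..b} (\<lambda>s. 1 / W s)"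
    using assms by (intro integral_le inverse_W_integrable inverse_W_mono) auto
  moreover have "integral {a..b} (\<lambda>s. 1 / W s) \<le> integral {a..b} (\<lambda>_. 1 / W b)"
    using assms by (intro integral_le inverse_W_integrable inverse_W_mono) auto
  ultimately show "(b - a) / W a \<le> G b - G a" "G b - G a \<le> (b - a) / W b"
    using assms by simp_all
qed

lemma G_0: "G 0 = 0"
  by (simp add: G_def)

lemma G_mono: "0 \<le> a \<Longrightarrow> a \<le> b \<Longrightarrow> b < 1 \<Longrightarrow> G a \<le> G b"
  using G_diff(1)[of a b] W_pos[of a] by (smt (verit) divide_nonneg_pos)

lemma G_nonneg: "0 \<le> t \<Longrightarrow> t < 1 \<Longrightarrow> 0 \<le> G t"
  using G_mono[of 0 t] G_0 by simp

lemma LINT_inverse_W: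
  assumes "0 \<le> t" "t < 1"
  shows "(LINT s:{0..t}|lebesgue. 1 / W s) = G t"
  unfolding G_def
proof (rule set_lebesgue_integral_eq_integral(2), rule nonnegative_absolutely_integrable_1)
  show "0 \<le> 1 / W s" if "s \<in> {0..t}" for s using W_pos[of s] that assms by auto
qed (use assms inverse_W_integrable in auto)

text \<open>With \<open>\<omega> \<le> M / (1 + G)\<close> and \<open>1 + G (1 - (1 - r) / K) \<ge> (1 - 1 / K) (1 - r) / W r\<close>, the tail at
  \<open>1 - (1 - r) / K\<close> is at most \<open>M W r / (K - 1)\<close>.\<close>

lemma D_check_if_bounded:
  assumes M: "AE t in lebesgue_on {0..<1}. \<omega> t * (1 + G t) \<le> M"
  shows "\<omega> \<in> D_check"
proof -
  define M' where "M' = max M 1"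
  \<comment> \<open>This makes \<open>M' / (K - 1) = 1/2\<close>, so that reverse doubling holds
    with constant 2.\<close>
  define K where "K = 2 * M' + 1"
  have M': "1 \<le> M'" by (simp add: M'_def)
  then have K: "1 < K" by (simp add: K_def)
  have "W r \<ge> 2 * W (1 - (1 - r) / K)" if r: "0 \<le> r" "r < 1" for r
  proof -
    define q where "q = 1 - (1 - r) / K"
    have "(1 - r) / K < (1 - r) / 1" using r K by (intro divide_strict_left_mono) auto
    then have q: "r \<le> q" "q < 1" and rq: "r < q" using r K by (auto simp: q_def)
    have "(q - r) / W r \<le> G q" using G_diff(1)[OF r(1) q] G_nonneg[OF r] by linarith
    then have Gq: "(q - r) / W r \<le> 1 + G q" by simp
    have pos: "0 < (q - r) / W r" using rq W_pos[OF r] by simp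
    have ae: "AE s in lebesgue. s \<in> {q..<1} \<longrightarrow> \<omega> s \<le> M' * W r / (q - r)"
    proof -
      have "AE s in lebesgue. s \<in> {0..<1} \<longrightarrow> \<omega> s * (1 + G s) \<le> M"
        using M by (subst (asm) AE_restrict_space_iff) auto
      then show ?thesis
      proof eventually_elim
        case (elim s)
        show ?case
        proof
          assume s: "s \<in> {q..<1}"
          have "\<omega> s * ((q - r) / W r) \<le> \<omega> s * (1 + G s)"
            using s q r Gq G_mono[of q s] omega_nonneg[of s] by (intro mult_left_mono) auto
          also have "\<dots> \<le> M'" using elim s q r by (auto simp: M'_def)
          finally show "\<omega> s \<le> M' * W r / (q - r)" using pos W_pos[OF r] by (simp add: field_simps)
        qed
      qed
    qed
    have sub: "set_integrable lebesgue {q..<1} \<omega>"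
      by (rule set_integrable_subset[OF omega_integrable]) (use q r in auto)
    have "W q \<le> (LINT s:{q..<1}|lebesgue. M' * W r / (q - r))"
      unfolding weight_tail_def[of \<omega> q]
    proof (rule set_integral_mono_AE[OF sub _ ae])
      show "set_integrable lebesgue {q..<1} (\<lambda>s. M' * W r / (q - r))"
        unfolding set_integrable_def
        by (intro integrable_scaleR_left integrable_real_indicator) (use q in auto)
    qed
    also have "\<dots> = (1 - q) * (M' * W r / (q - r))"
      using q by (simp add: set_lebesgue_integral_def)
    also have "\<dots> = W r / 2"
    proof -
      have "q - r = (1 - q) * (K - 1)" using K by (simp add: q_def field_simps)
      moreover have "1 - q > 0" using q by simp
      moreover have "z * (M' * w / (z * (2 * M'))) = w / 2" if "z > 0" for z w using that M' by simp
      ultimately show ?thesis by (simp add: K_def)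
    qed
    finally show ?thesis by (simp add: q_def)
  qed
  then have "\<forall>r\<in>{0..<1}. W r \<ge> 2 * W (1 - (1 - r) / K)" by auto
  then show ?thesis using weight K unfolding D_check_def mem_Collect_eq
    by (intro conjI exI[of _ K] exI[of _ 2]) auto
qed

section \<open>The kernel coefficients and the sum \<open>S\<close>\<close>

definition m :: "nat \<Rightarrow> real" where "m n = 2 * mom (2 * n + 1)"

definition a :: "nat \<Rightarrow> real" where "a n = 1 / ((real n + 1)^2 * m n)"

text \<open>The integral over \<open>[0,1)\<close>, and equally the \<open>HL(1)\<close> norm, of the kernel mean with parameter \<open>t\<close>.\<close>

definition S :: "real \<Rightarrow> real" where "S t = (\<Sum>n. a n * t ^ n)"

lemma m_pos: "0 < m n" using mom_pos by (simp add: m_def)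

lemma m_antimono: "n \<le> k \<Longrightarrow> m k \<le> m n"
  by (simp add: m_def mom_antimono)

lemma a_pos: "0 < a n" using m_pos[of n] by (simp add: a_def)

text \<open>Positive tails prevent fast decay of the moments: \<open>m n\<close> is at least
  \<open>2 * r * W r * r ^ (2 * n)\<close> for every \<open>r\<close> strictly between 0 and 1. The
  choice \<open>r = (1 + t) / 2\<close> gives \<open>t < r^2\<close>, as
  \<open>4 * (r^2 - t) = (1 - t)^2\<close>, and hence a convergent geometric majorant.\<close>

lemma summable_inverse_m:
  assumes "0 \<le> t" "t < 1"
  shows "summable (\<lambda>n. t ^ n / m n)"
proof -
  define r where "r = (1 + t) / 2"
  have r: "0 < r" "r < 1" using assms by (auto simp: r_def)
  have Wr: "0 < W r" using W_pos r by simp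
  have "0 < (1 - t)^2" using assms by simp
  then have tr: "t < r^2" by (simp add: r_def power2_eq_square algebra_simps)
  have "summable (\<lambda>n. 1 / (2 * r * W r) * (t / r^2) ^ n)"
    using tr assms r by (intro summable_mult summable_geometric) auto
  then show ?thesis
  proof (rule summable_comparison_test'[of _ 0])
    fix n
    have pw: "r ^ (2 * n + 1) = r * (r^2) ^ n" by (simp add: power_mult)
    have "2 * (r * (r^2) ^ n * W r) \<le> m n"
      using mom_ge[OF less_imp_le[OF r(1)], of "2 * n + 1"] unfolding pw m_def by linarith
    moreover have "2 * (r * (r^2) ^ n * W r) = 2 * r * W r * (r^2) ^ n" by (simp only: mult_ac)
    ultimately have "2 * r * W r * (r^2) ^ n \<le> m n" by linarith
    then have "t ^ n / m n \<le> t ^ n / (2 * r * W r * (r^2) ^ n)"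
      using r Wr assms m_pos[of n] by (intro divide_left_mono) auto
    then show "norm (t ^ n / m n) \<le> 1 / (2 * r * W r) * (t / r^2) ^ n"
      using assms m_pos[of n] by (simp add: power_divide)
  qed
qed

lemma summable_S: "0 \<le> t \<Longrightarrow> t < 1 \<Longrightarrow> summable (\<lambda>n. a n * t ^ n)"
proof (rule summable_comparison_test'[OF summable_inverse_m, of t 0])
  fix n assume t: "0 \<le> t" "t < 1"
  have "a n \<le> 1 / m n" using m_pos[of n] by (simp add: a_def frac_le)
  then show "norm (a n * t ^ n) \<le> t ^ n / m n"
    using t a_pos[of n] mult_right_mono[of "a n" "1 / m n" "t ^ n"] by simp
qed

lemma S_nonneg: "0 \<le> t \<Longrightarrow> t < 1 \<Longrightarrow> 0 \<le> S t"
  unfolding S_def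
  by (intro suminf_nonneg summable_S mult_nonneg_nonneg less_imp_le[OF a_pos] zero_le_power)

lemma sum_a_le_S: "0 \<le> t \<Longrightarrow> t < 1 \<Longrightarrow> (\<Sum>n<M. a n * t ^ n) \<le> S t"
  unfolding S_def
  by (intro sum_le_suminf summable_S mult_nonneg_nonneg less_imp_le[OF a_pos] zero_le_power) auto

end

section \<open>Doubling of moments, and \<open>1 + G\<close> bounded by \<open>S\<close>\<close>

locale doubling_weight = weight +
  fixes C :: real
  assumes C: "1 < C" and hat: "0 \<le> r \<Longrightarrow> r < 1 \<Longrightarrow> W r \<le> C * W ((1 + r) / 2)"
begin

lemma W_iterate:
  assumes "0 < x" "2 ^ j * x \<le> 1"
  shows "W (1 - 2 ^ j * x) \<le> C ^ j * W (1 - x)"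
  using assms(2)
proof (induction j)
  case (Suc j)
  have "W (1 - 2 ^ Suc j * x) \<le> C * W ((1 + (1 - 2 ^ Suc j * x)) / 2)"
    using Suc.prems assms by (intro hat) auto
  also have "(1 + (1 - 2 ^ Suc j * x)) / 2 = 1 - 2 ^ j * x" by (simp add: field_simps)
  also have "W (1 - 2 ^ j * x) \<le> C ^ j * W (1 - x)" using Suc assms by simp
  finally show ?case using C by (simp add: mult.assoc)
qed simp

lemma moment_doubling: "1 \<le> n \<Longrightarrow> mom n \<le> C * mom (2 * n)"
  using hat C by (intro mom_doubling) auto

text \<open>Three doublings lead from order \<open>2 * k + 1\<close> to \<open>16 * k + 8\<close>,
  past the order \<open>6 * k + 5\<close> of the right-hand side; two would end at
  \<open>8 * k + 4\<close>, too small for \<open>k = 0\<close>. The index \<open>3 * k + 2\<close>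
  is the largest \<open>n\<close> with \<open>n div 3 = k\<close>, as needed in
  \<open>m_differences\<close>.\<close>

lemma m_le: "m k \<le> C ^ 3 * m (3 * k + 2)"
proof -
  have "mom (2 * k + 1) \<le> C * mom (2 * (2 * k + 1))" by (rule moment_doubling) simp
  also have "mom (2 * (2 * k + 1)) \<le> C * mom (2 * (2 * (2 * k + 1)))" by (rule moment_doubling) simp
  also have "mom (2 * (2 * (2 * k + 1))) \<le> C * mom (2 * (2 * (2 * (2 * k + 1))))" by (rule moment_doubling) simp
  also have "mom (2 * (2 * (2 * (2 * k + 1)))) \<le> mom (2 * (3 * k + 2) + 1)" by (rule mom_antimono) simp
  finally show ?thesis using C by (simp add: m_def power3_eq_cube mult_ac)
qed

text \<open>A converse of \<open>mom_ge\<close> at distance \<open>1 / (n + 2)\<close> from 1.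
  \<open>mom_le_tail\<close> yields the tail at a distance larger by a fixed factor
  \<open>2 ^ j\<close>, and \<open>W_iterate\<close> returns to the right distance at the price
  \<open>C ^ j\<close>.\<close>

lemma m_le_W: "\<exists>A>0. \<forall>n. m n \<le> A * W (1 - 1 / (real n + 2))"
proof -
  obtain L where L: "exp (- L) \<le> 1 / (2 * C)" "0 < L"
    using C by (intro that[of "ln (2 * C)"]) (auto simp: exp_minus field_simps)
  \<comment> \<open>With \<open>x = 1 / (n + 2)\<close> one has
    \<open>x * (2 * n + 1) \<ge> 1/2\<close>, so this \<open>j\<close> forces
    \<open>(1 - 2 ^ j * x) ^ (2 * n + 1) \<le> exp (- L)\<close>, small enough for
    \<open>mom_le_tail\<close>.\<close>
  obtain j where j: "2 * L < 2 ^ j" using real_arch_pow[of 2 "2 * L"] by auto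
  define q where "q = 1 - 1 / (2::real) ^ j"
  have q: "0 \<le> q" "q < 1" by (auto simp: q_def)
  \<comment> \<open>The first summand serves \<open>n + 2 \<ge> 2 ^ j\<close>; the second serves the
    finitely many other \<open>n\<close>, for which \<open>1 - 1 / (n + 2) \<le> q\<close>.\<close>
  define A where "A = 4 * C * C ^ j + 2 * W 0 / W q"
  have Wq: "0 < W q" "0 < W 0" using W_pos q by auto
  then have A: "0 < A" "4 * C * C ^ j \<le> A" "2 * W 0 / W q \<le> A"
    using C by (auto simp: A_def intro!: add_pos_nonneg)
  have "m n \<le> A * W (1 - 1 / (real n + 2))" for n
  proof (cases "2 ^ j * (1 / (real n + 2)) \<le> 1")
    case True
    define x where "x = 1 / (real n + 2)"
    have x: "0 < x" "x \<le> 1" by (auto simp: x_def)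
    have "C * (1 - 2 ^ j * x) ^ (2 * (2 * n + 1) - (2 * n + 1)) \<le> 1/2"
    proof -
      have "1/2 \<le> x * (2 * n + 1)" by (simp add: x_def field_simps)
      then have "L \<le> 2 ^ j * (x * (2 * n + 1))"
        using j L mult_mono[of "2 * L" "2 ^ j" "1/2" "x * (2 * n + 1)"] by simp
      then have "(1 - 2 ^ j * x) ^ (2 * n + 1) \<le> exp (- L)"
        using power_le_exp[of "2 ^ j * x" "2 * n + 1"] x True by (auto simp: x_def mult.assoc intro: order_trans)
      also have "\<dots> \<le> 1 / (2 * C)" by (rule L)
      finally show ?thesis using C by (simp add: field_simps)
    qed
    then have "mom (2 * n + 1) \<le> 2 * C * W (1 - 2 ^ j * x)"
      using moment_doubling[of "2 * n + 1"] C True x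
      by (intro mom_le_tail[of _ C "2 * (2 * n + 1)"]) (auto simp: x_def)
    also have "\<dots> \<le> 2 * C * (C ^ j * W (1 - x))"
      using W_iterate[of x j] x True C by (intro mult_left_mono) (auto simp: x_def)
    finally have "m n \<le> 4 * C * C ^ j * W (1 - x)" by (simp add: m_def)
    also have "\<dots> \<le> A * W (1 - x)" using A W_pos[of "1 - x"] x by (intro mult_right_mono) auto
    finally show ?thesis by (simp add: x_def)
  next
    case False
    then have "1 - 1 / (real n + 2) \<le> q" by (simp add: q_def field_simps)
    then have le: "W q \<le> W (1 - 1 / (real n + 2))" by (intro W_antimono) auto
    have "m n \<le> 2 * W 0" using mom_le_W0 by (simp add: m_def)
    also have "\<dots> = 2 * W 0 / W q * W q" using Wq by simp
    also have "\<dots> \<le> A * W (1 - 1 / (real n + 2))" using A le Wq by (intro mult_mono) auto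
    finally show ?thesis .
  qed
  then show ?thesis using A by blast
qed

text \<open>The points \<open>1 - 1 / (n + 1)\<close> cut the interval into pieces of length about
  \<open>1 / (n + 1)^2\<close>. On each of them \<open>1 / W\<close> is at most its value at the
  right end, hence at most \<open>A / m n\<close> by \<open>m_le_W\<close>, so \<open>G\<close>
  increases there by at most \<open>A * a n\<close>. Summing up to about \<open>1 / (1 - t)\<close>
  reaches \<open>t\<close>, and in that range the powers \<open>t ^ n\<close> stay above a
  constant.\<close>

lemma one_plus_G_le_S: "\<exists>K>0. \<forall>t. 0 \<le> t \<longrightarrow> t < 1 \<longrightarrow> 1 + G t \<le> K * S t"
proof -
  obtain A where A: "0 < A" "\<And>n. m n \<le> A * W (1 - 1 / (real n + 2))" using m_le_W by blast
  have G_le: "G (1 - 1 / (real M + 1)) \<le> A * (\<Sum>n<M. a n)" for M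
  proof (induction M)
    case (Suc M)
    let ?p = "1 - 1 / (real M + 1)" and ?q = "1 - 1 / (real M + 2)"
    have "G ?q - G ?p \<le> (?q - ?p) / W ?q" by (rule G_diff) (auto simp: frac_le)
    also have "?q - ?p = 1 / ((real M + 1) * (real M + 2))" by (simp add: field_simps)
    also have "\<dots> / W ?q \<le> 1 / (real M + 1)^2 / W ?q"
      using W_pos[of ?q] by (intro divide_right_mono) (auto simp: frac_le power2_eq_square)
    also have "\<dots> \<le> A * a M"
    proof -
      have "1 / W ?q \<le> A / m M" using A(2)[of M] W_pos[of ?q] m_pos[of M] by (simp add: field_simps)
      then have "1 / (real M + 1)^2 * (1 / W ?q) \<le> 1 / (real M + 1)^2 * (A / m M)"
        by (rule mult_left_mono) simp
      then show ?thesis by (simp add: a_def)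
    qed
    finally have "G ?q \<le> G ?p + A * a M" by simp
    then show ?case using Suc by (simp add: algebra_simps)
  qed (simp add: G_0)
  \<comment> \<open>The summands account for the constant 1, for \<open>G t\<close> with
    \<open>t \<le> 1/2\<close>, and for \<open>G t\<close> with \<open>t > 1/2\<close>.\<close>
  define K where "K = 1 / a 0 + G (1/2) / a 0 + exp 2 * A"
  have G12: "0 \<le> G (1/2)" by (rule G_nonneg) auto
  have "1 + G t \<le> K * S t" if t: "0 \<le> t" "t < 1" for t
  proof -
    have Sa: "a 0 \<le> S t" using sum_a_le_S[OF t, of 1] by simp
    have S0: "0 \<le> S t" using Sa a_pos[of 0] by linarith
    have 1: "1 \<le> 1 / a 0 * S t" using Sa a_pos[of 0] by (simp add: field_simps)
    have 2: "G t \<le> G (1/2) / a 0 * S t + exp 2 * A * S t"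
    proof (cases "t \<le> 1/2")
      case True
      have "G t \<le> G (1/2) * 1" using True t G_mono[of t "1/2"] by simp
      also have "\<dots> \<le> G (1/2) * (1 / a 0 * S t)" by (rule mult_left_mono[OF 1 G12])
      finally show ?thesis using S0 A by (simp add: add_increasing2)
    next
      case False
      define x where "x = 1 - t"
      have x: "0 < x" "x \<le> 1/2" "t = 1 - x" using t False by (auto simp: x_def)
      \<comment> \<open>Large enough that \<open>t \<le> 1 - 1 / (M + 1)\<close>, yet small enough
        that \<open>n < M\<close> implies \<open>x * n \<le> 1\<close>, hence
        \<open>t ^ n \<ge> exp (- 2)\<close>.\<close>
      define M where "M = nat \<lceil>1 / x\<rceil>"
      have x1: "0 < 1 / x" using x by simp
      have M: "1 / x \<le> M" "real M \<le> 1 / x + 1" using x1 unfolding M_def by linarith+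
      have "1 / (real M + 1) \<le> x" using M x by (simp add: field_simps)
      then have "G t \<le> G (1 - 1 / (real M + 1))" using x t by (intro G_mono) auto
      also have "\<dots> \<le> A * (\<Sum>n<M. a n)" by (rule G_le)
      also have "(\<Sum>n<M. a n) \<le> (\<Sum>n<M. exp 2 * (a n * t ^ n))"
      proof (rule sum_mono)
        fix n assume "n \<in> {..<M}"
        then have "real n \<le> 1 / x" using M by auto
        then have "x * n \<le> 1" using x by (simp add: field_simps)
        then have "exp (- 2) \<le> exp (- 2 * x * n)" by simp
        also have "\<dots> \<le> t ^ n" using power_ge_exp[of x n] x by simp
        finally have "exp 2 * exp (- 2) \<le> exp 2 * t ^ n" by (intro mult_left_mono) auto
        then have "1 \<le> exp 2 * t ^ n" by (simp flip: exp_add)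
        then have "a n * 1 \<le> a n * (exp 2 * t ^ n)" using a_pos[of n] by (intro mult_left_mono) auto
        then show "a n \<le> exp 2 * (a n * t ^ n)" by (simp add: mult_ac)
      qed
      also have "\<dots> = exp 2 * (\<Sum>n<M. a n * t ^ n)" by (simp add: sum_distrib_left)
      also have "\<dots> \<le> exp 2 * S t" by (intro mult_left_mono sum_a_le_S t) simp
      finally have "G t \<le> A * (exp 2 * S t)" using A by simp
      then show ?thesis using S0 G12 a_pos[of 0] by (simp add: add_increasing mult_ac)
    qed
    have "K * S t = 1 / a 0 * S t + (G (1/2) / a 0 * S t + exp 2 * A * S t)"
      by (simp add: K_def algebra_simps)
    then show ?thesis using 1 2 by linarith
  qed
  moreover have "0 < K" using a_pos[of 0] G12 A by (auto simp: K_def intro!: add_pos_nonneg)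
  ultimately show ?thesis by blast
qed

end

section \<open>Calculus of slowly varying sequences\<close>

text \<open>With \<open>x = s^2\<close> this exchanges a block of powers for the factor
  \<open>1 - s^2\<close> that each difference of moments puts under the integral.\<close>

lemma power_mult_one_minus_le:
  fixes x :: real
  assumes "0 \<le> x" "x \<le> 1"
  shows "x ^ k * (1 - x) \<le> 1 / (real k + 1)"
proof -
  have "(real k + 1) * x ^ k = (\<Sum>i\<in>{..k}. x ^ k)" by simp
  also have "\<dots> \<le> (\<Sum>i\<in>{..k}. x ^ i)" using assms by (intro sum_mono power_decreasing) auto
  finally have "(real k + 1) * x ^ k * (1 - x) \<le> (\<Sum>i\<in>{..k}. x ^ i) * (1 - x)"
    using assms by (intro mult_right_mono) auto
  also have "\<dots> = 1 - x ^ Suc k" using sum_gp_basic[of x k] by (simp add: mult.commute)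
  also have "\<dots> \<le> 1" using assms by simp
  finally show ?thesis by (simp add: field_simps)
qed

lemma abs_mult_le: "\<bar>x\<bar> \<le> a \<Longrightarrow> \<bar>y\<bar> \<le> b \<Longrightarrow> \<bar>x * y\<bar> \<le> a * (b::real)"
  unfolding abs_mult by (intro mult_mono) auto

text \<open>The discrete Leibniz rule. Shifted values of \<open>v\<close> are traced back to index
  \<open>n\<close>, at the price of factors 2 and 4; the three terms of the second difference then
  contribute 4 + 4 + 1 = 9.\<close>

lemma slow_mult:
  assumes b: "slow A b \<beta>" and v: "slow B v \<gamma>" and A: "0 \<le> A" "0 \<le> B" "\<And>n. 0 \<le> \<beta> n" "\<And>n. 0 \<le> \<gamma> n"
  shows "slow (9 * A * B) (\<lambda>n. b n * v n) (\<lambda>n. \<beta> n * \<gamma> n)"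
  unfolding slow_def
proof (intro allI)
  fix n :: nat
  define N where "N = real n + 1"
  have N: "1 \<le> N" by (simp add: N_def)
  define p where "p = A * \<beta> n"
  define q where "q = B * \<gamma> n"
  have pq: "0 \<le> p" "0 \<le> q" using A by (auto simp: p_def q_def)
  define b1 where "b1 = b (n + 1) - b n"
  define b2 where "b2 = b (n + 2) - 2 * b (n + 1) + b n"
  define v1 where "v1 = v (n + 1) - v n"
  define v2 where "v2 = v (n + 2) - 2 * v (n + 1) + v n"
  have b: "\<bar>b n\<bar> \<le> p" "\<bar>b1\<bar> \<le> p / N" "\<bar>b2\<bar> \<le> p / N^2"
    using b unfolding slow_def p_def b1_def b2_def N_def by auto
  have v: "\<bar>v n\<bar> \<le> q" "\<bar>v1\<bar> \<le> q / N" "\<bar>v2\<bar> \<le> q / N^2"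
    using v unfolding slow_def q_def v1_def v2_def N_def by auto
  have NN: "N \<le> N^2" using N by (simp add: power2_eq_square)
  have qN2: "q / N^2 \<le> q / N" using NN N pq by (intro divide_left_mono) auto
  have qN: "q / N \<le> q" using N pq by (simp add: divide_le_eq mult_le_cancel_left1)
  have vv: "\<bar>v (n + 1)\<bar> \<le> 2 * q" "\<bar>v (n + 2)\<bar> \<le> 4 * q" "\<bar>v (n + 2) - v (n + 1)\<bar> \<le> 2 * (q / N)"
  proof -
    have "\<bar>v (n + 1)\<bar> \<le> \<bar>v n\<bar> + \<bar>v1\<bar>" "\<bar>v (n + 2)\<bar> \<le> \<bar>v (n + 1)\<bar> + \<bar>v (n + 2) - v (n + 1)\<bar>"
      by (simp_all add: v1_def)
    moreover have "\<bar>v (n + 2) - v (n + 1)\<bar> \<le> \<bar>v1\<bar> + \<bar>v2\<bar>" by (simp add: v1_def v2_def)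
    ultimately show "\<bar>v (n + 1)\<bar> \<le> 2 * q" "\<bar>v (n + 2)\<bar> \<le> 4 * q" "\<bar>v (n + 2) - v (n + 1)\<bar> \<le> 2 * (q / N)"
      using v qN qN2 by simp_all
  qed
  have pq0: "0 \<le> p * q" "0 \<le> p * q / N" using pq N by auto
  have 1: "\<bar>b n * v n\<bar> \<le> 9 * (p * q)" using abs_mult_le[OF b(1) v(1)] pq0 by linarith
  have "b (n + 1) * v (n + 1) - b n * v n = b1 * v (n + 1) + b n * v1"
    by (simp add: b1_def v1_def algebra_simps)
  then have "\<bar>b (n + 1) * v (n + 1) - b n * v n\<bar> \<le> \<bar>b1 * v (n + 1)\<bar> + \<bar>b n * v1\<bar>"
    by (simp only: abs_triangle_ineq)
  also have "\<dots> \<le> p / N * (2 * q) + p * (q / N)"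
    by (intro add_mono abs_mult_le b v vv)
  also have "\<dots> = 3 * (p * q / N)" by simp
  also have "\<dots> \<le> 9 * (p * q / N)" using pq0 by linarith
  finally have 2: "\<bar>b (n + 1) * v (n + 1) - b n * v n\<bar> \<le> 9 * (p * q) / N" by simp
  have "b (n + 2) * v (n + 2) - 2 * (b (n + 1) * v (n + 1)) + b n * v n
      = b2 * v (n + 2) + 2 * (b1 * (v (n + 2) - v (n + 1))) + b n * v2"
    by (simp add: b1_def b2_def v2_def algebra_simps)
  then have "\<bar>b (n + 2) * v (n + 2) - 2 * (b (n + 1) * v (n + 1)) + b n * v n\<bar>
      \<le> \<bar>b2 * v (n + 2)\<bar> + 2 * \<bar>b1 * (v (n + 2) - v (n + 1))\<bar> + \<bar>b n * v2\<bar>"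
    by linarith
  also have "\<dots> \<le> p / N^2 * (4 * q) + 2 * (p / N * (2 * (q / N))) + p * (q / N^2)"
    by (intro add_mono mult_left_mono abs_mult_le b v vv) simp
  also have "\<dots> = 9 * (p * q) / N^2" by (simp add: power2_eq_square)
  finally have 3: "\<bar>b (n + 2) * v (n + 2) - 2 * (b (n + 1) * v (n + 1)) + b n * v n\<bar> \<le> 9 * (p * q) / N^2" .
  show "\<bar>b n * v n\<bar> \<le> 9 * A * B * (\<beta> n * \<gamma> n) \<and>
    \<bar>b (n + 1) * v (n + 1) - b n * v n\<bar> \<le> 9 * A * B * (\<beta> n * \<gamma> n) / (real n + 1) \<and>
    \<bar>b (n + 2) * v (n + 2) - 2 * (b (n + 1) * v (n + 1)) + b n * v n\<bar> \<le> 9 * A * B * (\<beta> n * \<gamma> n) / (real n + 1)^2"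
    using 1 2 3 by (simp add: p_def q_def N_def mult_ac add.commute)
qed

lemma slow_inverse_Suc: "slow 2 (\<lambda>n. 1 / (real n + 1)) (\<lambda>n. 1 / (real n + 1))"
  unfolding slow_def
proof (intro allI)
  fix n :: nat
  define N where "N = real n + 1"
  have N: "1 \<le> N" by (simp add: N_def)
  have 0: "\<bar>1 / N\<bar> \<le> 2 * (1 / N)" using N by (simp add: divide_right_mono)
  have "\<bar>1 / (N + 1) - 1 / N\<bar> = 1 / (N * (N + 1))" using N by (simp add: field_simps)
  also have "\<dots> \<le> 1 / (N * N)" using N by (intro divide_left_mono mult_left_mono) auto
  also have "\<dots> \<le> 2 * (1 / N) / N" using N by (simp add: divide_right_mono)
  finally have 1: "\<bar>1 / (N + 1) - 1 / N\<bar> \<le> 2 * (1 / N) / N" .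
  have "1 / (N + 2) - 2 * (1 / (N + 1)) + 1 / N = 2 / (N * (N + 1) * (N + 2))"
    using N by (simp add: divide_simps) (simp add: algebra_simps)
  moreover have "2 / (N * (N + 1) * (N + 2)) \<le> 2 / (N * N * N)"
    using N by (intro divide_left_mono mult_mono) auto
  moreover have "0 \<le> 2 / (N * (N + 1) * (N + 2))" using N by simp
  ultimately have 2: "\<bar>1 / (N + 2) - 2 * (1 / (N + 1)) + 1 / N\<bar> \<le> 2 * (1 / N) / N^2"
    by (simp add: power2_eq_square mult.assoc)
  show "\<bar>1 / (real n + 1)\<bar> \<le> 2 * (1 / (real n + 1)) \<and>
    \<bar>1 / (real (n + 1) + 1) - 1 / (real n + 1)\<bar> \<le> 2 * (1 / (real n + 1)) / (real n + 1) \<and>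
    \<bar>1 / (real (n + 2) + 1) - 2 * (1 / (real (n + 1) + 1)) + 1 / (real n + 1)\<bar>
      \<le> 2 * (1 / (real n + 1)) / (real n + 1)^2"
    using 0 1 2 unfolding N_def by (simp add: add_ac)
qed

text \<open>This quotient appears on differentiating: \<open>(n + 1) * kernel_coeff (n + 1)\<close>
  is \<open>1 / m (n + 1)\<close> times it.\<close>

lemma slow_ratio: "slow 2 (\<lambda>n. (real n + 1) / (real n + 2)) (\<lambda>_. 1)"
  unfolding slow_def
proof (intro allI)
  fix n :: nat
  define N where "N = real n + 1"
  have N: "1 \<le> N" by (simp add: N_def)
  have 0: "\<bar>N / (N + 1)\<bar> \<le> 2" using N by (simp add: divide_le_eq)
  have "\<bar>(N + 1) / (N + 2) - N / (N + 1)\<bar> = 1 / ((N + 1) * (N + 2))" using N by (simp add: field_simps)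
  also have "\<dots> \<le> 2 / (N * 1)" using N by (intro frac_le mult_mono) auto
  finally have 1: "\<bar>(N + 1) / (N + 2) - N / (N + 1)\<bar> \<le> 2 / N" by simp
  have "(N + 2) / (N + 3) - 2 * ((N + 1) / (N + 2)) + N / (N + 1) = - (2 / ((N + 1) * (N + 2) * (N + 3)))"
    using N by (simp add: divide_simps) (simp add: algebra_simps)
  moreover have "2 / ((N + 1) * (N + 2) * (N + 3)) \<le> 2 / (N * N * 1)"
    using N by (intro divide_left_mono mult_mono) auto
  moreover have "0 \<le> 2 / ((N + 1) * (N + 2) * (N + 3))" using N by simp
  ultimately have 2: "\<bar>(N + 2) / (N + 3) - 2 * ((N + 1) / (N + 2)) + N / (N + 1)\<bar> \<le> 2 / N^2"
    by (simp add: power2_eq_square)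
  show "\<bar>(real n + 1) / (real n + 2)\<bar> \<le> 2 * 1 \<and>
    \<bar>(real (n + 1) + 1) / (real (n + 1) + 2) - (real n + 1) / (real n + 2)\<bar> \<le> 2 * 1 / (real n + 1) \<and>
    \<bar>(real (n + 2) + 1) / (real (n + 2) + 2) - 2 * ((real (n + 1) + 1) / (real (n + 1) + 2)) + (real n + 1) / (real n + 2)\<bar>
      \<le> 2 * 1 / (real n + 1)^2"
    using 0 1 2 unfolding N_def by (simp add: add_ac)
qed

text \<open>Used for \<open>1 / m (n + 1)\<close>, which occurs in the derivative. The majorant
  stays at index \<open>n\<close>, the factor \<open>K\<close> absorbing its growth over one
  step.\<close>

lemma slow_shift:
  assumes b: "slow A b \<beta>" and \<beta>: "\<And>n. \<beta> (n + 1) \<le> K * \<beta> n" "\<And>n. 0 \<le> \<beta> n" and A: "0 \<le> A"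
  shows "slow (A * K) (\<lambda>n. b (n + 1)) \<beta>"
  unfolding slow_def
proof (intro allI)
  fix n :: nat
  define N where "N = real n + 1"
  have N: "1 \<le> N" by (simp add: N_def)
  have p: "0 \<le> A * \<beta> (n + 1)" "A * \<beta> (n + 1) \<le> A * K * \<beta> n"
    using A \<beta> mult_left_mono[OF \<beta>(1)[of n] A] by (auto simp: mult.assoc)
  then have p0: "0 \<le> A * K * \<beta> n" by linarith
  have b: "\<bar>b (n + 1)\<bar> \<le> A * \<beta> (n + 1)" "\<bar>b (n + 1 + 1) - b (n + 1)\<bar> \<le> A * \<beta> (n + 1) / (N + 1)"
    "\<bar>b (n + 1 + 2) - 2 * b (n + 1 + 1) + b (n + 1)\<bar> \<le> A * \<beta> (n + 1) / (N + 1)^2"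
    using b[unfolded slow_def, rule_format, of "n + 1"] by (auto simp: N_def)
  have "A * \<beta> (n + 1) / (N + 1) \<le> A * K * \<beta> n / N" using p p0 N by (intro frac_le) auto
  moreover have "A * \<beta> (n + 1) / (N + 1)^2 \<le> A * K * \<beta> n / N^2" using p p0 N by (intro frac_le power_mono) auto
  ultimately show "\<bar>b (n + 1)\<bar> \<le> A * K * \<beta> n \<and> \<bar>b (n + 1 + 1) - b (n + 1)\<bar> \<le> A * K * \<beta> n / (real n + 1) \<and>
    \<bar>b (n + 2 + 1) - 2 * b (n + 1 + 1) + b (n + 1)\<bar> \<le> A * K * \<beta> n / (real n + 1)^2"
    using b p by (auto simp: N_def add.commute intro: order_trans)
qed

section \<open>Slow variation of the reciprocal moments\<close>

context doubling_weight
begin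

lemma m_Suc_ge: "k \<le> 3 * n + 2 \<Longrightarrow> m n \<le> C ^ 3 * m k"
  using m_le[of n] m_antimono[of k "3 * n + 2"] C
  by (meson less_eq_real_def mult_left_mono order_trans zero_le_power zero_less_one less_trans)

text \<open>Differences of the moments are integrals of \<open>s ^ (2 * n + 1)\<close> times
  \<open>1 - s^2\<close> or its square, which gives the signs. For the size, \<open>n\<close> is
  split into blocks of length \<open>k = n div 3\<close>: one block is kept to rebuild
  \<open>m k\<close>, and each of the at most two others absorbs one factor \<open>1 - s^2\<close>,
  yielding \<open>1 / (k + 1)\<close>. Doubling returns from \<open>m k\<close> to
  \<open>m n\<close>, and \<open>n + 1 \<le> 3 * (k + 1)\<close> gives the constants 3 and
  9.\<close>

lemma m_differences:
  shows "0 \<le> m n - m (n + 1)" "m n - m (n + 1) \<le> 3 * C ^ 3 * m n / (real n + 1)"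
    and "0 \<le> m n - 2 * m (n + 1) + m (n + 2)" "m n - 2 * m (n + 1) + m (n + 2) \<le> 9 * C ^ 3 * m n / (real n + 1)^2"
proof -
  define k where "k = n div 3"
  have k: "3 * k \<le> n" "n \<le> 3 * k + 2" by (auto simp: k_def)
  have "real n \<le> real (3 * k + 2)" using k by (simp only: of_nat_le_iff)
  then have rk: "real n + 1 \<le> 3 * (real k + 1)" by simp
  have mk: "m k \<le> C ^ 3 * m n"
    using m_le[of k] m_antimono[OF k(2)] C by (smt (verit) mult_left_mono zero_le_power)
  define \<phi> where "\<phi> = (\<lambda>s::real. s ^ (2 * n + 1) * (1 - s^2))"
  define \<psi> where "\<psi> = (\<lambda>s::real. s ^ (2 * n + 1) * (1 - s^2)^2)"
  have meas [measurable]: "\<phi> \<in> borel_measurable borel" "\<psi> \<in> borel_measurable borel"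
    unfolding \<phi>_def \<psi>_def by measurable
  have s2: "0 \<le> 1 - s^2 \<and> 1 - s^2 \<le> 1" if "0 \<le> s" "s < 1" for s :: real
    using that by (simp add: power_le_one)
  have \<phi>b: "\<bar>\<phi> s\<bar> \<le> 1" "0 \<le> \<phi> s" and \<psi>b: "\<bar>\<psi> s\<bar> \<le> 1" "0 \<le> \<psi> s" if s: "0 \<le> s" "s < 1" for s
  proof -
    have p: "0 \<le> s ^ (2 * n + 1)" "s ^ (2 * n + 1) \<le> 1" using s by (auto intro!: power_le_one mult_le_one)
    show "0 \<le> \<phi> s" "0 \<le> \<psi> s" using p(1) s2[OF s] unfolding \<phi>_def \<psi>_def by (auto intro!: mult_nonneg_nonneg)
    moreover have "\<phi> s \<le> 1 * 1" unfolding \<phi>_def by (rule mult_mono) (use p s2[OF s] in auto)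
    moreover have "\<psi> s \<le> 1 * 1" unfolding \<psi>_def by (rule mult_mono) (use p s2[OF s] in \<open>auto intro: power_le_one\<close>)
    ultimately show "\<bar>\<phi> s\<bar> \<le> 1" "\<bar>\<psi> s\<bar> \<le> 1" by auto
  qed
  have "mom (2 * n + 1) = I (\<lambda>s. \<phi> s + s ^ (2 * (n + 1) + 1))"
    unfolding mom_def \<phi>_def by (simp add: algebra_simps power2_eq_square)
  also have "\<dots> = I \<phi> + mom (2 * (n + 1) + 1)"
    unfolding mom_def
  proof (rule I_add[where K=1 and K'=1])
    show "\<bar>s ^ (2 * (n + 1) + 1)\<bar> \<le> 1" if "0 \<le> s" "s < 1" for s :: real using that by (rule power_bounded)
  qed (use \<phi>b in auto)
  finally have d1: "m n - m (n + 1) = 2 * I \<phi>" by (simp add: m_def)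
  have "I \<phi> = I (\<lambda>s. \<psi> s + s^2 * \<phi> s)"
    by (rule arg_cong[of _ _ I]) (auto simp: \<phi>_def \<psi>_def algebra_simps power2_eq_square)
  also have "\<dots> = I \<psi> + I (\<lambda>s. s^2 * \<phi> s)"
  proof (rule I_add[where K=1 and K'=1])
    show "\<bar>s^2 * \<phi> s\<bar> \<le> 1" if "0 \<le> s" "s < 1" for s
      unfolding abs_mult using \<phi>b(1)[OF that] that by (intro mult_le_one) (auto simp: power_le_one)
  qed (use \<psi>b in auto)
  finally have I_phi: "I \<phi> = I \<psi> + I (\<lambda>s. s^2 * \<phi> s)" .
  have "2 * I (\<lambda>s. s^2 * \<phi> s) = m (n + 1) - m (n + 2)"
  proof -
    have "mom (2 * (n + 1) + 1) = I (\<lambda>s. s^2 * \<phi> s + s ^ (2 * (n + 2) + 1))"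
      unfolding mom_def \<phi>_def by (simp add: algebra_simps power2_eq_square)
    also have "\<dots> = I (\<lambda>s. s^2 * \<phi> s) + mom (2 * (n + 2) + 1)"
      unfolding mom_def
    proof (rule I_add[where K=1 and K'=1])
      show "\<bar>s ^ (2 * (n + 2) + 1)\<bar> \<le> 1" if "0 \<le> s" "s < 1" for s :: real using that by (rule power_bounded)
      show "\<bar>s^2 * \<phi> s\<bar> \<le> 1" if "0 \<le> s" "s < 1" for s
        unfolding abs_mult using \<phi>b(1)[OF that] that by (intro mult_le_one) (auto simp: power_le_one)
    qed auto
    finally show ?thesis by (simp add: m_def)
  qed
  then have d2: "m n - 2 * m (n + 1) + m (n + 2) = 2 * I \<psi>" using d1 I_phi by simp
  have I0: "0 \<le> I f" if "\<And>s. 0 \<le> s \<Longrightarrow> s < 1 \<Longrightarrow> 0 \<le> f s" for f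
    unfolding I_def set_lebesgue_integral_def using that omega_nonneg
    by (intro integral_nonneg_AE) (auto simp: indicator_def)
  show "0 \<le> m n - m (n + 1)" "0 \<le> m n - 2 * m (n + 1) + m (n + 2)"
    unfolding d1 d2 using I0[of \<phi>] I0[of \<psi>] \<phi>b \<psi>b by auto
  have key: "\<phi> s \<le> 1 / (real k + 1) * s ^ (2 * k + 1)" "\<psi> s \<le> 1 / (real k + 1)^2 * s ^ (2 * k + 1)"
    if s: "0 \<le> s" "s < 1" for s
  proof -
    define x where "x = s^2"
    have x: "0 \<le> x" "x \<le> 1" using s by (auto simp: x_def power_le_one)
    have pw: "s ^ (2 * j + 1) = s * x ^ j" for j by (simp add: x_def power_mult)
    have e: "x ^ k * (1 - x) \<le> 1 / (real k + 1)" by (rule power_mult_one_minus_le[OF x])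
    have e0: "0 \<le> x ^ k * (1 - x)" using x by simp
    have "x ^ n \<le> x ^ (k + k)" using x k by (intro power_decreasing) auto
    then have "x ^ n * (1 - x) \<le> x ^ k * (x ^ k * (1 - x))"
      using x mult_right_mono[of "x ^ n" "x ^ (k + k)" "1 - x"] by (simp add: power_add mult_ac)
    also have "\<dots> \<le> x ^ k * (1 / (real k + 1))" using e x by (intro mult_left_mono) auto
    finally have "s * (x ^ n * (1 - x)) \<le> s * (x ^ k * (1 / (real k + 1)))" using s by (intro mult_left_mono) auto
    then show "\<phi> s \<le> 1 / (real k + 1) * s ^ (2 * k + 1)"
      unfolding \<phi>_def pw x_def[symmetric] by (simp add: mult_ac)
    have "x ^ n \<le> x ^ (k + (k + k))" using x k by (intro power_decreasing) auto
    then have "x ^ n * (1 - x)^2 \<le> x ^ k * (x ^ k * (1 - x))^2"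
      using x mult_right_mono[of "x ^ n" "x ^ (k + (k + k))" "(1 - x)^2"]
      by (simp add: power_add power_mult_distrib power2_eq_square mult_ac)
    also have "\<dots> \<le> x ^ k * (1 / (real k + 1))^2" using e e0 x by (intro mult_left_mono power_mono) auto
    finally have "s * (x ^ n * (1 - x)^2) \<le> s * (x ^ k * (1 / (real k + 1))^2)" using s by (intro mult_left_mono) auto
    then show "\<psi> s \<le> 1 / (real k + 1)^2 * s ^ (2 * k + 1)"
      unfolding \<psi>_def pw x_def[symmetric] by (simp add: power_one_over mult_ac)
  qed
  have cb: "\<bar>1 / (real k + 1) ^ j * s ^ (2 * k + 1)\<bar> \<le> 1" if s: "0 \<le> s" "s < 1" for s j
  proof -
    have "1 / (real k + 1) ^ j * s ^ (2 * k + 1) \<le> 1 * 1"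
      by (intro mult_mono power_le_one) (use s in auto)
    moreover have "0 \<le> 1 / (real k + 1) ^ j * s ^ (2 * k + 1)" using s by simp
    ultimately show ?thesis by linarith
  qed
  have "I \<phi> \<le> I (\<lambda>s. 1 / (real k + 1) * s ^ (2 * k + 1))"
    using I_mono[of \<phi> "\<lambda>s. 1 / (real k + 1) * s ^ (2 * k + 1)" 1 1] \<phi>b key(1) cb[of _ 1] by simp
  then have "2 * I \<phi> \<le> 2 * (1 / (real k + 1) * mom (2 * k + 1))" unfolding I_cmult mom_def by simp
  also have "\<dots> = m k / (real k + 1)" by (simp add: m_def)
  also have "\<dots> \<le> C ^ 3 * m n / ((real n + 1) / 3)"
    using mk rk m_pos[of n] C by (intro frac_le) auto
  finally show "m n - m (n + 1) \<le> 3 * C ^ 3 * m n / (real n + 1)" unfolding d1 by (simp add: mult_ac)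
  have "I \<psi> \<le> I (\<lambda>s. 1 / (real k + 1)^2 * s ^ (2 * k + 1))"
    using I_mono[of \<psi> "\<lambda>s. 1 / (real k + 1)^2 * s ^ (2 * k + 1)" 1 1] \<psi>b key(2) cb[of _ 2] by simp
  then have "2 * I \<psi> \<le> 2 * (1 / (real k + 1)^2 * mom (2 * k + 1))" unfolding I_cmult mom_def by simp
  also have "\<dots> = m k / (real k + 1)^2" by (simp add: m_def)
  also have "\<dots> \<le> C ^ 3 * m n / ((real n + 1) / 3)^2"
    using mk rk m_pos[of n] C by (intro frac_le power_mono) auto
  finally show "m n - 2 * m (n + 1) + m (n + 2) \<le> 9 * C ^ 3 * m n / (real n + 1)^2"
    unfolding d2 by (simp add: power_divide mult_ac)
qed

text \<open>With \<open>x, y, z\<close> for three successive values of \<open>m\<close>, the second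
  difference of the reciprocals is
  \<open>((x - y) * (x - z) - x * (x - 2 * y + z)) / (x * y * z)\<close>. Convexity gives
  \<open>x - z \<le> 2 * (x - y)\<close>, so the two parts of the numerator contribute 18 and 9.
  Replacing \<open>1 / y\<close> and \<open>1 / z\<close> by \<open>D / x\<close> costs
  \<open>D^2\<close>, besides the \<open>D^2\<close> from \<open>m_differences\<close>.\<close>

lemma slow_inverse_m: "slow (27 * (C ^ 3) ^ 4) (\<lambda>n. 1 / m n) (\<lambda>n. 1 / m n)"
  unfolding slow_def
proof (intro allI)
  fix n :: nat
  define N where "N = real n + 1"
  have N: "1 \<le> N" by (simp add: N_def)
  define D where "D = C ^ 3"
  have D: "1 \<le> D" using C by (simp add: D_def)
  define x where "x = m n" define y where "y = m (n + 1)" define z where "z = m (n + 2)"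
  have pos: "0 < x" "0 < y" "0 < z" and xy: "z \<le> y" "y \<le> x" and xz: "x \<le> D * z"
    using m_pos m_antimono m_Suc_ge[of "n + 2" n] by (auto simp: x_def y_def z_def D_def)
  have u: "0 \<le> x - y" "x - y \<le> 3 * D * x / N" and v: "0 \<le> x - 2 * y + z" "x - 2 * y + z \<le> 9 * D * x / N^2"
    using m_differences[of n] by (auto simp: x_def y_def z_def D_def N_def)
  have D4: "D \<le> D ^ 4" "D ^ 2 \<le> D ^ 4" using D power_increasing[of 1 4 D] power_increasing[of 2 4 D] by auto
  have xD: "1 / y \<le> D / x" "1 / z \<le> D / x"
  proof -
    have "x \<le> D * y" using xz xy D mult_left_mono[of z y D] by linarith
    then show "1 / y \<le> D / x" "1 / z \<le> D / x" using xz pos by (auto simp: field_simps)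
  qed
  have "\<bar>1 / x\<bar> \<le> 27 * D ^ 4 * (1 / x)" using pos one_le_power[OF D, of 4] divide_right_mono[of 1 "27 * D ^ 4" x] by simp
  moreover have "\<bar>1 / y - 1 / x\<bar> \<le> 27 * D ^ 4 * (1 / x) / N"
  proof -
    have "\<bar>1 / y - 1 / x\<bar> = (x - y) / x * (1 / y)" using pos xy by (simp add: field_simps)
    also have "\<dots> \<le> (3 * D / N) * (D / x)"
      using u xD pos N D by (intro mult_mono) (auto simp: field_simps)
    also have "\<dots> = 3 * D^2 / (x * N)" by (simp add: power2_eq_square mult.commute)
    also have "\<dots> \<le> 27 * D^4 / (x * N)" using D4 N pos D by (intro divide_right_mono) auto
    finally show ?thesis by (simp add: mult.commute)
  qed
  moreover have "\<bar>1 / z - 2 * (1 / y) + 1 / x\<bar> \<le> 27 * D ^ 4 * (1 / x) / N^2"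
  proof -
    have "1 / z - 2 * (1 / y) + 1 / x = ((x - y) / x * ((x - z) / x) - (x - 2 * y + z) / x) * (x * (1 / y) * (1 / z))"
    proof -
      have "(p / x * (q / x) - r / x) * (x * (1 / y) * (1 / z)) = (p * q - x * r) / (x * y * z)" for p q r
        using pos by (simp add: field_simps)
      moreover have "1 / z - 2 * (1 / y) + 1 / x = ((x - y) * (x - z) - x * (x - 2 * y + z)) / (x * y * z)"
        using pos by (simp add: field_simps)
      ultimately show ?thesis by simp
    qed
    also have "\<bar>\<dots>\<bar> = \<bar>(x - y) / x * ((x - z) / x) - (x - 2 * y + z) / x\<bar> * (x * (1 / y) * (1 / z))"
      using pos by (simp add: abs_mult)
    also have "\<dots> \<le> (27 * D^2 / N^2) * (x * (D / x) * (D / x))"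
    proof (rule mult_mono)
      have "(x - y) / x \<le> 3 * D / N" using u pos N by (simp add: field_simps)
      moreover have "(x - z) / x \<le> 2 * (3 * D / N)"
      proof -
        have "x - z \<le> 2 * (x - y)" using v by simp
        then have "(x - z) / x \<le> 2 * (x - y) / x" using pos by (intro divide_right_mono) auto
        then have "(x - z) / x \<le> 2 * ((x - y) / x)" by simp
        then show ?thesis using calculation by linarith
      qed
      ultimately have "(x - y) / x * ((x - z) / x) \<le> (3 * D / N) * (2 * (3 * D / N))"
        using u xy pos D N by (intro mult_mono) auto
      also have "\<dots> = 18 * (D^2 / N^2)" by (simp add: power2_eq_square)
      finally have "(x - y) / x * ((x - z) / x) \<le> 18 * (D^2 / N^2)" .
      moreover have "(x - 2 * y + z) / x \<le> 9 * (D^2 / N^2)"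
      proof -
        have "(x - 2 * y + z) / x \<le> 9 * D / N^2" using v pos N by (simp add: field_simps)
        also have "\<dots> \<le> 9 * D^2 / N^2" using D N by (intro divide_right_mono) (auto simp: power2_eq_square)
        finally show ?thesis by simp
      qed
      moreover have "0 \<le> (x - y) / x * ((x - z) / x)" "0 \<le> (x - 2 * y + z) / x" using u v xy pos by auto
      moreover have "0 \<le> D^2 / N^2" by simp
      moreover have "\<bar>P - Q\<bar> \<le> 27 * e" if "P \<le> 18 * e" "Q \<le> 9 * e" "0 \<le> P" "0 \<le> Q" "0 \<le> e" for P Q e :: real
        using that by linarith
      ultimately have "\<bar>(x - y) / x * ((x - z) / x) - (x - 2 * y + z) / x\<bar> \<le> 27 * (D^2 / N^2)" by blast
      then show "\<bar>(x - y) / x * ((x - z) / x) - (x - 2 * y + z) / x\<bar> \<le> 27 * D^2 / N^2" by simp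
      show "x * (1 / y) * (1 / z) \<le> x * (D / x) * (D / x)"
        using xD pos D by (intro mult_mono) auto
    qed (use pos N in auto)
    also have "\<dots> = 27 * D ^ 4 * (1 / x) / N^2" using pos by (simp add: power2_eq_square power4_eq_xxxx mult_ac)
    finally show ?thesis .
  qed
  ultimately show "\<bar>1 / m n\<bar> \<le> 27 * (C ^ 3) ^ 4 * (1 / m n) \<and>
    \<bar>1 / m (n + 1) - 1 / m n\<bar> \<le> 27 * (C ^ 3) ^ 4 * (1 / m n) / (real n + 1) \<and>
    \<bar>1 / m (n + 2) - 2 * (1 / m (n + 1)) + 1 / m n\<bar> \<le> 27 * (C ^ 3) ^ 4 * (1 / m n) / (real n + 1)^2"
    by (simp add: x_def y_def z_def D_def N_def add.commute)
qed

section \<open>\<open>S\<close> bounded by \<open>1 + G\<close>\<close>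

text \<open>The increment of \<open>G\<close> from \<open>t\<close> to \<open>(1 + t) / 2\<close> is
  at most \<open>C * ((1 - t) / W t)\<close> by doubling. The interval from \<open>2 * t - 1\<close>
  to \<open>t\<close> also has length \<open>1 - t\<close>, and doubling makes the increment of
  \<open>G\<close> over it at least \<open>(1 - t) / (C * W t)\<close>. For
  \<open>t \<le> 1/2\<close> that interval may leave the domain, and the constant
  \<open>1 / W (1/2)\<close> takes over.\<close>

lemma G_halving: "\<exists>c\<ge>1. \<forall>t. 0 \<le> t \<longrightarrow> t < 1 \<longrightarrow> 1 + G ((1 + t) / 2) \<le> c * (1 + G t)"
proof -
  define c where "c = 1 + C * (C + 1 / W (1/2))"
  have Wh: "0 < W (1/2)" by (rule W_pos) auto
  have c: "1 \<le> c" using C Wh by (simp add: c_def)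
  have "1 + G ((1 + t) / 2) \<le> c * (1 + G t)" if t: "0 \<le> t" "t < 1" for t
  proof -
    have Gt: "0 \<le> G t" using t by (rule G_nonneg)
    have 1: "(1 - t) / W t \<le> (C + 1 / W (1/2)) * (1 + G t)"
    proof (cases "t \<le> 1/2")
      case True
      have "(1 - t) / W t \<le> 1 / W (1/2)" using True t Wh by (intro frac_le W_antimono) auto
      also have "\<dots> \<le> (C + 1 / W (1/2)) * 1" using C by simp
      also have "\<dots> \<le> (C + 1 / W (1/2)) * (1 + G t)" using C Wh Gt by (intro mult_left_mono) auto
      finally show ?thesis .
    next
      case False
      have "W (2 * t - 1) \<le> C * W t" using hat[of "2 * t - 1"] t False by simp
      then have "(1 - t) / (C * W t) \<le> (1 - t) / W (2 * t - 1)"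
        using t False W_pos[of "2 * t - 1"] by (intro divide_left_mono mult_pos_pos) (use W_pos[of t] C in auto)
      also have "\<dots> \<le> G t - G (2 * t - 1)" using G_diff(1)[of "2 * t - 1" t] t False by simp
      also have "\<dots> \<le> 1 + G t" using G_nonneg[of "2 * t - 1"] t False by simp
      finally have "(1 - t) / W t \<le> C * (1 + G t)" using C W_pos[OF t] by (simp add: field_simps)
      also have "\<dots> \<le> (C + 1 / W (1/2)) * (1 + G t)" using Wh Gt by (intro mult_right_mono) auto
      finally show ?thesis .
    qed
    have "G ((1 + t) / 2) - G t \<le> ((1 + t) / 2 - t) / W ((1 + t) / 2)" using t by (intro G_diff) auto
    also have "\<dots> \<le> (1 - t) / W ((1 + t) / 2)" using t W_pos[of "(1 + t) / 2"] by (intro divide_right_mono) auto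
    also have "\<dots> \<le> C * ((1 - t) / W t)"
    proof -
      have "1 / W ((1 + t) / 2) \<le> C / W t"
        using hat[OF t] W_pos[OF t] W_pos[of "(1 + t) / 2"] t by (simp add: field_simps)
      then have "(1 - t) * (1 / W ((1 + t) / 2)) \<le> (1 - t) * (C / W t)" using t by (intro mult_left_mono) auto
      then show ?thesis by (simp add: mult.commute)
    qed
    also have "\<dots> \<le> C * ((C + 1 / W (1/2)) * (1 + G t))" using 1 C by (intro mult_left_mono) auto
    finally show ?thesis by (simp add: c_def algebra_simps)
  qed
  then show ?thesis using c by blast
qed

lemma G_halving_iterate: "\<exists>c\<ge>1. \<forall>t. 0 \<le> t \<longrightarrow> t < 1 \<longrightarrow> 1 + G (1 - (1 - t) / 2 ^ j) \<le> c * (1 + G t)"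
proof (induction j)
  case 0
  show ?case by (rule exI[of _ 1]) simp
next
  case (Suc j)
  then obtain c where c: "1 \<le> c" "\<And>t. 0 \<le> t \<Longrightarrow> t < 1 \<Longrightarrow> 1 + G (1 - (1 - t) / 2 ^ j) \<le> c * (1 + G t)" by blast
  obtain d where d: "1 \<le> d" "\<And>t. 0 \<le> t \<Longrightarrow> t < 1 \<Longrightarrow> 1 + G ((1 + t) / 2) \<le> d * (1 + G t)" using G_halving by blast
  have "1 + G (1 - (1 - t) / 2 ^ Suc j) \<le> c * d * (1 + G t)" if t: "0 \<le> t" "t < 1" for t
  proof -
    have "1 + G (1 - (1 - (1 + t) / 2) / 2 ^ j) \<le> c * (1 + G ((1 + t) / 2))" using t by (intro c) auto
    also have "\<dots> \<le> c * (d * (1 + G t))" using t c d by (intro mult_left_mono) auto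
    also have "1 - (1 - (1 + t) / 2) / 2 ^ j = 1 - (1 - t) / 2 ^ Suc j" by (simp add: field_simps)
    finally show ?thesis by (simp add: mult.assoc)
  qed
  moreover have "1 \<le> c * d" using c d mult_mono[of 1 c 1 d] by simp
  ultimately show ?case by blast
qed

text \<open>With \<open>u = sqrt t\<close>, the terms of index \<open>2 * k\<close> and
  \<open>2 * k + 1\<close> have \<open>u\<close>-powers at most \<open>t ^ k\<close>, and
  \<open>a\<close> is almost decreasing: its values there are at most \<open>C ^ 3 * a k\<close>.
  Two terms are thus charged to each term of \<open>S t\<close>.\<close>

lemma S_sqrt_le: "0 \<le> t \<Longrightarrow> t < 1 \<Longrightarrow> S (sqrt t) \<le> 2 * C ^ 3 * S t"
proof -
  assume t: "0 \<le> t" "t < 1"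
  define u where "u = sqrt t"
  have u: "0 \<le> u" "u < 1" "u^2 = t" using t by (auto simp: u_def)
  have C3: "1 \<le> C ^ 3" using C by simp
  have a_le: "a i \<le> C ^ 3 * a k" if "k \<le> i" "i \<le> 2 * k + 1" for i k
  proof -
    have "m k \<le> C ^ 3 * m i" using that by (intro m_Suc_ge) auto
    then have "1 / m i \<le> C ^ 3 / m k" using m_pos[of k] m_pos[of i] by (simp add: field_simps)
    then have "1 / (real i + 1)^2 * (1 / m i) \<le> 1 / (real k + 1)^2 * (C ^ 3 / m k)"
    proof (rule mult_mono[rotated])
      show "1 / (real i + 1)^2 \<le> 1 / (real k + 1)^2"
        using that by (intro divide_left_mono power_mono) auto
    qed (use m_pos[of i] in auto)
    then show ?thesis by (simp add: a_def)
  qed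
  have pairs: "(\<Sum>n<2 * M. a n * u ^ n) \<le> 2 * C ^ 3 * (\<Sum>k<M. a k * t ^ k)" for M
  proof (induction M)
    case (Suc M)
    have "u ^ (2 * M) = t ^ M" "u ^ (2 * M + 1) \<le> t ^ M"
      using u by (auto simp: power_mult mult_left_le_one_le)
    moreover have "0 \<le> C ^ 3 * a M"
      by (intro mult_nonneg_nonneg less_imp_le[OF a_pos] zero_le_power) (use C in simp)
    ultimately have "a i * u ^ i \<le> C ^ 3 * a M * t ^ M" if "i = 2 * M \<or> i = 2 * M + 1" for i
      using that u by (intro mult_mono a_le) auto
    from this[of "2 * M"] this[of "2 * M + 1"] show ?case using Suc by (simp add: algebra_simps)
  qed simp
  show ?thesis unfolding u_def[symmetric] S_def[of u]
  proof (rule suminf_le_const[OF summable_S[OF u(1,2)]])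
    fix M
    have "(\<Sum>n<M. a n * u ^ n) \<le> (\<Sum>n<2 * M. a n * u ^ n)"
      using u by (intro sum_mono2) (auto intro!: mult_nonneg_nonneg less_imp_le[OF a_pos])
    also note pairs
    also have "2 * C ^ 3 * (\<Sum>k<M. a k * t ^ k) \<le> 2 * C ^ 3 * S t"
      using C by (intro mult_left_mono sum_a_le_S t) auto
    finally show "(\<Sum>n<M. a n * u ^ n) \<le> 2 * C ^ 3 * S t" .
  qed
qed

text \<open>The tail of \<open>S t\<close> is at most \<open>sqrt t ^ M * S (sqrt t)\<close>, which is absorbed into \<open>S t\<close>.\<close>

lemma S_le_partial_sum:
  assumes t: "0 \<le> t" "t < 1" and M: "2 * C ^ 3 * sqrt t ^ M \<le> 1/2"
  shows "S t \<le> 2 * (\<Sum>n<M. a n)"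
proof -
  define u where "u = sqrt t"
  have u: "0 \<le> u" "u < 1" "u * u = t" using t by (auto simp: u_def)
  have "S t = (\<Sum>n. a (n + M) * t ^ (n + M)) + (\<Sum>n<M. a n * t ^ n)"
    unfolding S_def by (rule suminf_split_initial_segment[OF summable_S[OF t]])
  also have "(\<Sum>n<M. a n * t ^ n) \<le> (\<Sum>n<M. a n)"
    using t by (intro sum_mono) (auto intro!: mult_left_le power_le_one less_imp_le[OF a_pos])
  also have "(\<Sum>n. a (n + M) * t ^ (n + M)) \<le> (\<Sum>n. u ^ M * (a (n + M) * u ^ (n + M)))"
  proof (rule suminf_le)
    fix n
    have "t ^ (n + M) = u ^ (n + M) * u ^ (n + M)" using u by (simp flip: power_mult_distrib)
    also have "\<dots> \<le> u ^ M * u ^ (n + M)" using u by (intro mult_right_mono power_decreasing) auto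
    finally have "a (n + M) * t ^ (n + M) \<le> a (n + M) * (u ^ M * u ^ (n + M))"
      by (intro mult_left_mono less_imp_le[OF a_pos])
    then show "a (n + M) * t ^ (n + M) \<le> u ^ M * (a (n + M) * u ^ (n + M))" by (simp add: mult_ac)
    show "summable (\<lambda>n. a (n + M) * t ^ (n + M))" using summable_S[OF t] by (subst summable_iff_shift)
    show "summable (\<lambda>n. u ^ M * (a (n + M) * u ^ (n + M)))"
      by (rule summable_mult) (subst summable_iff_shift, rule summable_S[OF u(1,2)])
  qed
  also have "\<dots> = u ^ M * (\<Sum>n. a (n + M) * u ^ (n + M))"
    by (rule suminf_mult) (subst summable_iff_shift, rule summable_S[OF u(1,2)])
  also have "(\<Sum>n. a (n + M) * u ^ (n + M)) \<le> S u"
    unfolding S_def suminf_split_initial_segment[OF summable_S[OF u(1,2)], of M]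
    using u by (simp add: sum_nonneg less_imp_le[OF a_pos])
  also have "u ^ M * S u \<le> u ^ M * (2 * C ^ 3 * S t)"
    using u S_sqrt_le[OF t] by (intro mult_left_mono) (auto simp: u_def)
  also have "\<dots> \<le> 1/2 * S t"
    using M S_nonneg[OF t] mult_right_mono[of "2 * C ^ 3 * u ^ M" "1/2" "S t"] by (simp add: u_def mult_ac)
  finally have "S t \<le> 1/2 * S t + (\<Sum>n<M. a n)" using u by (simp add: mult_left_mono)
  then show ?thesis by simp
qed

text \<open>\<open>mom_ge\<close> bounds \<open>a M\<close> by the increment of \<open>G\<close>
  between consecutive points \<open>1 - 1 / (M + 2)\<close>. Cutting the series at an
  \<open>M\<close> of order \<open>1 / (1 - t)\<close> by \<open>S_le_partial_sum\<close> leaves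
  \<open>G\<close> at a point whose distance from 1 is smaller than \<open>1 - t\<close> by at most
  the factor \<open>2 ^ j\<close>, and iterated halving brings it back to \<open>t\<close>.\<close>

lemma S_le_one_plus_G: "\<exists>K>0. \<forall>t. 0 \<le> t \<longrightarrow> t < 1 \<longrightarrow> S t \<le> K * (1 + G t)"
proof -
  have sum_le: "(\<Sum>n<M. a n) \<le> 3 * exp 4 * G (1 - 1 / (real M + 2))" for M
  proof (induction M)
    case 0
    show ?case by (simp add: G_nonneg)
  next
    case (Suc M)
    \<comment> \<open>The grid starts at 1/2, because \<open>power_ge_exp\<close> is applied with
      \<open>x = 1 / (M + 2) \<le> 1/2\<close>. The factor 6 below compares
      \<open>(M + 2) * (M + 3)\<close> with \<open>(M + 1)^2\<close>, with equality at
      \<open>M = 0\<close>.\<close>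
    let ?p = "1 - 1 / (real M + 2)" and ?q = "1 - 1 / (real M + 3)"
    have Wp: "0 < W ?p" by (rule W_pos) auto
    have "exp (- 4) * W ?p \<le> mom (2 * M + 1)"
    proof -
      have "exp (- 4) \<le> exp (- 2 * (1 / (real M + 2)) * (2 * M + 1))" by (simp add: field_simps)
      also have "\<dots> \<le> ?p ^ (2 * M + 1)"
        using power_ge_exp[of "1 / (real M + 2)" "2 * M + 1"] by simp
      finally have "exp (- 4) * W ?p \<le> ?p ^ (2 * M + 1) * W ?p" using Wp by (intro mult_right_mono) auto
      also have "\<dots> \<le> mom (2 * M + 1)" by (rule mom_ge) simp
      finally show ?thesis .
    qed
    then have "2 * (exp (- 4) * W ?p) \<le> m M" by (simp add: m_def)
    then have "1 / m M \<le> 1 / (2 * (exp (- 4) * W ?p))" using Wp m_pos[of M] by (intro divide_left_mono) auto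
    also have "\<dots> = exp 4 / 2 / W ?p" by (simp add: exp_minus field_simps)
    finally have "1 / (real M + 1)^2 * (1 / m M) \<le> 6 / ((real M + 2) * (real M + 3)) * (exp 4 / 2 / W ?p)"
    proof (rule mult_mono[rotated])
      have "(real M + 2) * (real M + 3) \<le> 6 * (real M + 1)^2" by (simp add: power2_eq_square algebra_simps)
      then show "1 / (real M + 1)^2 \<le> 6 / ((real M + 2) * (real M + 3))" by (simp add: divide_simps)
    qed (use m_pos[of M] in auto)
    also have "\<dots> = 3 * exp 4 * ((?q - ?p) / W ?p)" by (simp add: divide_simps) (simp add: algebra_simps)
    also have "\<dots> \<le> 3 * exp 4 * (G ?q - G ?p)" by (intro mult_left_mono G_diff) (auto simp: frac_le)
    finally have "a M \<le> 3 * exp 4 * G ?q - 3 * exp 4 * G ?p" by (simp add: a_def right_diff_distrib)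
    then show ?case using Suc by (simp add: add_ac)
  qed
  \<comment> \<open>Then \<open>D * sqrt t ^ M \<le> 1\<close> is exactly the smallness condition of
    \<open>S_le_partial_sum\<close>.\<close>
  define D where "D = 4 * C ^ 3"
  have D: "1 < D" using one_le_power[OF less_imp_le[OF C], of 3] by (simp add: D_def)
  define L where "L = ln D"
  have L: "exp (- L) = 1 / D" "0 < L" using D by (auto simp: L_def exp_minus field_simps)
  \<comment> \<open>For the \<open>M\<close> chosen below, \<open>(1 - t) * (M + 2)\<close> is at
    most \<open>2 * L + 3\<close>; hence \<open>1 - 1 / (M + 2)\<close> does not exceed the point
    reached after \<open>j\<close> halvings.\<close>
  obtain j where j: "2 * L + 3 < 2 ^ j" using real_arch_pow[of 2 "2 * L + 3"] by auto
  obtain c where c: "1 \<le> c" "\<And>t. 0 \<le> t \<Longrightarrow> t < 1 \<Longrightarrow> 1 + G (1 - (1 - t) / 2 ^ j) \<le> c * (1 + G t)"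
    using G_halving_iterate[of j] by blast
  have "S t \<le> 6 * exp 4 * c * (1 + G t)" if t: "0 \<le> t" "t < 1" for t
  proof -
    define x where "x = 1 - t"
    have x: "0 < x" "x \<le> 1" "t = 1 - x" using t by (auto simp: x_def)
    define M where "M = nat \<lceil>2 * L / x\<rceil>"
    have "0 < 2 * L / x" using L x by simp
    then have M: "2 * L / x \<le> M" "M \<le> 2 * L / x + 1" unfolding M_def by linarith+
    have "sqrt t \<le> 1 - x / 2"
      using x t by (intro real_le_lsqrt) (auto simp: power2_eq_square algebra_simps)
    then have "sqrt t ^ M \<le> (1 - x / 2) ^ M" using t by (intro power_mono) auto
    also have "\<dots> \<le> exp (- (x / 2) * M)" using x by (intro power_le_exp) auto
    also have "\<dots> \<le> exp (- L)" using M(1) x by (simp add: field_simps)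
    finally have "D * sqrt t ^ M \<le> 1" using L(1) D by (simp add: field_simps)
    then have "2 * C ^ 3 * sqrt t ^ M \<le> 1/2" by (simp add: D_def)
    then have "S t \<le> 2 * (\<Sum>n<M. a n)" by (rule S_le_partial_sum[OF t])
    also have "\<dots> \<le> 6 * exp 4 * G (1 - 1 / (real M + 2))" using sum_le[of M] by simp
    also have "\<dots> \<le> 6 * exp 4 * (1 + G (1 - (1 - t) / 2 ^ j))"
    proof (rule mult_left_mono)
      have "x * (real M + 2) \<le> 2 * L + 3 * x" using M(2) x by (simp add: field_simps)
      also have "\<dots> \<le> 2 ^ j" using j x by simp
      finally have "x / 2 ^ j \<le> 1 / (real M + 2)" by (simp add: field_simps)
      then have "G (1 - 1 / (real M + 2)) \<le> G (1 - x / 2 ^ j)" using x by (intro G_mono) auto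
      then show "G (1 - 1 / (real M + 2)) \<le> 1 + G (1 - (1 - t) / 2 ^ j)" by (simp add: x_def)
    qed simp
    also have "\<dots> \<le> 6 * exp 4 * (c * (1 + G t))" using c t by (intro mult_left_mono) auto
    finally show ?thesis by (simp add: mult_ac)
  qed
  then show ?thesis using c by (intro exI[of _ "6 * exp 4 * c"]) auto
qed

end

section \<open>Norms of power series on the disc\<close>

lemma nn_integral_power_series:
  assumes "\<And>n. 0 \<le> a n"
  shows "(\<integral>\<^sup>+r\<in>{0<..<1}. (\<Sum>n. ennreal (a n * r ^ (n + k))) \<partial>lborel) = (\<Sum>n. ennreal (a n / (real n + real k + 1)))"
proof -
  have 1: "(\<integral>\<^sup>+r\<in>{0<..<1}. ennreal (a n * r ^ (n + k)) \<partial>lborel) = ennreal (a n / (real n + real k + 1))" for n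
  proof -
    have "((\<lambda>r. a n * r ^ (n + k)) has_integral (a n * (1 ^ (n + k + 1) / (real n + real k + 1)) - a n * (0 ^ (n + k + 1) / (real n + real k + 1)))) {0..1}"
    proof (rule fundamental_theorem_of_calculus)
      fix x :: real
      have "((\<lambda>r. a n * (r ^ (n + k + 1) / (real n + real k + 1))) has_real_derivative a n * x ^ (n + k)) (at x within {0..1})"
      proof -
        have N: "real n + real k + 1 = real (n + k + 1)" by simp
        have "((\<lambda>r. a n * (r ^ (n + k + 1) / real (n + k + 1))) has_real_derivative
            a n * (real (n + k + 1) * x ^ (n + k + 1 - Suc 0) / real (n + k + 1))) (at x within {0..1})"
          by (intro DERIV_cmult DERIV_cdivide DERIV_pow)
        then show ?thesis unfolding N by (simp del: of_nat_add of_nat_Suc)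
      qed
      then show "((\<lambda>r. a n * (r ^ (n + k + 1) / (real n + real k + 1))) has_vector_derivative a n * x ^ (n + k)) (at x within {0..1})"
        by (simp add: has_real_derivative_iff_has_vector_derivative)
    qed simp
    then have "((\<lambda>r. a n * r ^ (n + k)) has_integral (a n / (real n + real k + 1))) {0<..<1}"
      by (simp add: has_integral_Icc_iff_Ioo)
    then show ?thesis
      by (intro nn_integral_has_integral_lebesgue') (use assms in auto)
  qed
  have "(\<integral>\<^sup>+r\<in>{0<..<1}. (\<Sum>n. ennreal (a n * r ^ (n + k))) \<partial>lborel)
      = (\<integral>\<^sup>+r. (\<Sum>n. ennreal (a n * r ^ (n + k)) * indicator {0<..<1} r) \<partial>lborel)"
    by simp
  also have "\<dots> = (\<Sum>n. \<integral>\<^sup>+r\<in>{0<..<1}. ennreal (a n * r ^ (n + k)) \<partial>lborel)"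
    by (rule nn_integral_suminf) measurable
  finally show ?thesis unfolding 1 .
qed

lemma set_nn_integral_Ico_Ioo:
  fixes f :: "real \<Rightarrow> ennreal"
  shows "(\<integral>\<^sup>+r\<in>{0..<1}. f r \<partial>lebesgue) = (\<integral>\<^sup>+r\<in>{0<..<1}. f r \<partial>lborel)"
proof -
  have "(\<integral>\<^sup>+r\<in>{0..<1}. f r \<partial>lborel) = (\<integral>\<^sup>+r\<in>{0<..<1}. f r \<partial>lborel)"
    by (rule nn_integral_cong_AE) (use AE_lborel_singleton[of 0] in eventually_elim, auto simp: indicator_def)
  then show ?thesis by (simp add: nn_integral_completion)
qed

text \<open>Nothing is required of \<open>g\<close> outside the disc, where the integral defining an
  operator need not converge.\<close>

locale disc_series =
  fixes c :: "nat \<Rightarrow> complex" and g :: "complex \<Rightarrow> complex"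
  assumes summable_norm_c: "0 \<le> r \<Longrightarrow> r < 1 \<Longrightarrow> summable (\<lambda>n. norm (c n) * r ^ n)"
    and g_eq: "norm z < 1 \<Longrightarrow> g z = (\<Sum>n. c n * z ^ n)"
begin

lemma summable_c: "norm z < 1 \<Longrightarrow> summable (\<lambda>n. c n * z ^ n)"
  by (rule summable_norm_cancel) (use summable_norm_c[of "norm z"] in \<open>simp add: norm_mult norm_power\<close>)

lemma has_field_derivative_g:
  assumes z: "norm z < 1"
  shows "(g has_field_derivative (\<Sum>n. of_nat (n + 1) * c (n + 1) * z ^ n)) (at z)"
proof -
  have "((\<lambda>z. \<Sum>n. c n * z ^ n) has_field_derivative (\<Sum>n. diffs c n * z ^ n)) (at z)"
    by (rule termdiffs_strong'[OF summable_c z])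
  then have "((\<lambda>z. \<Sum>n. c n * z ^ n) has_field_derivative (\<Sum>n. of_nat (n + 1) * c (n + 1) * z ^ n)) (at z)"
    by (simp add: diffs_def)
  moreover have "\<forall>\<^sub>F w in nhds z. w \<in> ball 0 1" using z by (intro eventually_nhds_in_open) auto
  then have "\<forall>\<^sub>F w in nhds z. g w = (\<Sum>n. c n * w ^ n)" by eventually_elim (simp add: g_eq)
  ultimately show ?thesis by (subst DERIV_cong_ev[OF refl _ refl]) 
qed

lemma holomorphic_g: "g holomorphic_on ball 0 1"
  unfolding holomorphic_on_open[OF open_ball] using has_field_derivative_g by force

lemma fps_nth_g: "fps_nth (fps_expansion g 0) n = c n"
proof -
  have "norm (1/2 :: complex) \<le> conv_radius c"
    by (rule conv_radius_geI[OF summable_c]) simp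
  then have r: "0 < fps_conv_radius (Abs_fps c)"
    unfolding fps_conv_radius_def by (simp add: less_le_trans[OF _ \<open>_ \<le> conv_radius c\<close>])
  have "\<forall>\<^sub>F z in nhds 0. z \<in> ball (0::complex) 1" by (intro eventually_nhds_in_open) auto
  then have "\<forall>\<^sub>F z in nhds 0. eval_fps (Abs_fps c) z = g z"
    by eventually_elim (simp add: eval_fps_def g_eq)
  then have "g has_fps_expansion Abs_fps c" using r by (simp add: has_fps_expansion_def)
  from fps_nth_fps_expansion[OF this, of n] show ?thesis by (simp add: fps_expansion_def)
qed

lemma HL_1_norm_g: "HL_1_norm g = (\<Sum>n. ennreal (norm (c n) / (real n + 1)))"
  unfolding HL_1_norm_def fps_nth_g ..

lemma H_inf_1_norm_le: "H_inf_1_norm g \<le> (\<Sum>n. ennreal (norm (c n) / (real n + 1)))"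
proof -
  have "H_inf_1_norm g \<le> (\<integral>\<^sup>+r\<in>{0..<1}. (\<Sum>n. ennreal (norm (c n) * r ^ (n + 0))) \<partial>lebesgue)"
    unfolding H_inf_1_norm_def
  proof (intro nn_integral_mono)
    fix r :: real
    show "M_inf r g * indicator {0..<1} r \<le> (\<Sum>n. ennreal (norm (c n) * r ^ (n + 0))) * indicator {0..<1} r"
    proof (cases "r \<in> {0..<1}")
      case True
      then have r: "0 \<le> r" "r < 1" by auto
      have "M_inf r g \<le> ennreal (\<Sum>n. norm (c n) * r ^ n)"
        unfolding M_inf_def
      proof (rule SUP_least, rule ennreal_leI)
        fix s
        let ?z = "complex_of_real r * cis s"
        have nz: "norm ?z = r" using r by (simp add: norm_mult)
        have "norm (g ?z) = norm (\<Sum>n. c n * ?z ^ n)" using nz r by (simp add: g_eq)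
        also have "\<dots> \<le> (\<Sum>n. norm (c n * ?z ^ n))"
          by (rule summable_norm) (use summable_norm_c[OF r] nz in \<open>simp add: norm_mult norm_power\<close>)
        also have "\<dots> = (\<Sum>n. norm (c n) * r ^ n)" unfolding norm_mult norm_power nz[unfolded norm_mult] using r by (simp add: norm_mult)
        finally show "norm (g ?z) \<le> (\<Sum>n. norm (c n) * r ^ n)" .
      qed
      also have "\<dots> = (\<Sum>n. ennreal (norm (c n) * r ^ n))"
        using r by (intro suminf_ennreal2[symmetric] summable_norm_c) auto
      finally show ?thesis using True by simp
    qed simp
  qed
  also have "\<dots> = (\<Sum>n. ennreal (norm (c n) / (real n + 1)))"
    unfolding set_nn_integral_Ico_Ioo by (subst nn_integral_power_series) auto
  finally show ?thesis .
qed

lemma Dirichlet_1_norm_polar: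
  "Dirichlet_1_norm g = ennreal (norm (g 0)) + ennreal (1 / pi) *
    (\<integral>\<^sup>+r\<in>{0<..<1}. ennreal r * (\<integral>\<^sup>+s\<in>{0<..<2*pi}. ennreal (norm (deriv g (rcis r s))) \<partial>lborel) \<partial>lborel)"
proof -
  \<comment> \<open>Cutting off with the indicator makes the integrand Borel on the whole plane;
    continuity of \<open>deriv g\<close> is at hand only on the disc.\<close>
  define h where "h = (\<lambda>z. ennreal (norm (indicator (ball 0 1) z *\<^sub>R deriv g z)))"
  have "continuous_on (ball 0 1) (deriv g)"
    by (intro holomorphic_on_imp_continuous_on holomorphic_deriv holomorphic_g) simp
  then have "(\<lambda>z. indicator (ball 0 1) z *\<^sub>R deriv g z) \<in> borel_measurable borel"
    by (intro borel_measurable_continuous_on_indicator) simp_all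
  then have "(\<lambda>z. norm (indicator (ball 0 1) z *\<^sub>R deriv g z)) \<in> borel_measurable borel"
    by (rule measurable_compose[OF _ borel_measurable_norm])
  then have h: "h \<in> borel_measurable borel"
    unfolding h_def by (rule measurable_compose[OF _ measurable_ennreal])
  have "(\<integral>\<^sup>+z\<in>ball 0 1. ennreal (norm (deriv g z)) \<partial>lebesgue) = (\<integral>\<^sup>+z\<in>ball 0 1. h z \<partial>lborel)"
    unfolding nn_integral_completion by (intro nn_integral_cong) (auto simp: h_def indicator_def)
  also have "\<dots> = (\<integral>\<^sup>+r\<in>{0<..<1}. ennreal r * (\<integral>\<^sup>+s\<in>{0<..<2*pi}. h (rcis r s) \<partial>lborel) \<partial>lborel)"
    by (rule set_nn_integral_polar[OF h])
  also have "\<dots> = (\<integral>\<^sup>+r\<in>{0<..<1}. ennreal r * (\<integral>\<^sup>+s\<in>{0<..<2*pi}. ennreal (norm (deriv g (rcis r s))) \<partial>lborel) \<partial>lborel)"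
  proof (intro nn_integral_cong)
    fix r :: real
    have "h (rcis r s) = ennreal (norm (deriv g (rcis r s)))" if "r \<in> {0<..<1}" for s
      using that by (simp add: h_def rcis_def norm_mult)
    then show "ennreal r * (\<integral>\<^sup>+s\<in>{0<..<2*pi}. h (rcis r s) \<partial>lborel) * indicator {0<..<1} r
      = ennreal r * (\<integral>\<^sup>+s\<in>{0<..<2*pi}. ennreal (norm (deriv g (rcis r s))) \<partial>lborel) * indicator {0<..<1} r"
      by (cases "r \<in> {0<..<1}") simp_all
  qed
  finally show ?thesis unfolding Dirichlet_1_norm_def by simp
qed

end

section \<open>Lower bounds for series with nonnegative coefficients\<close>

locale nonneg_disc_series = disc_series "\<lambda>n. complex_of_real (a n)" g for a :: "nat \<Rightarrow> real" and g +
  assumes a_nonneg: "0 \<le> a n"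
begin

lemma summable_a: "0 \<le> r \<Longrightarrow> r < 1 \<Longrightarrow> summable (\<lambda>n. a n * r ^ n)"
  using summable_norm_c[of r] a_nonneg by simp

lemma g_of_real: "0 \<le> r \<Longrightarrow> r < 1 \<Longrightarrow> g (of_real r) = of_real (\<Sum>n. a n * r ^ n)"
proof -
  assume r: "0 \<le> r" "r < 1"
  then have "g (of_real r) = (\<Sum>n. of_real (a n * r ^ n))" by (subst g_eq) auto
  also have "\<dots> = of_real (\<Sum>n. a n * r ^ n)" by (rule suminf_of_real[OF summable_a[OF r], symmetric])
  finally show ?thesis .
qed

lemma H_inf_1_norm_ge: "(\<Sum>n. ennreal (a n / (real n + 1))) \<le> H_inf_1_norm g"
proof -
  have "(\<Sum>n. ennreal (a n / (real n + 1))) = (\<integral>\<^sup>+r\<in>{0..<1}. (\<Sum>n. ennreal (a n * r ^ (n + 0))) \<partial>lebesgue)"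
    unfolding set_nn_integral_Ico_Ioo by (subst nn_integral_power_series) (auto simp: a_nonneg)
  also have "\<dots> \<le> H_inf_1_norm g"
    unfolding H_inf_1_norm_def
  proof (intro nn_integral_mono)
    fix r :: real
    show "(\<Sum>n. ennreal (a n * r ^ (n + 0))) * indicator {0..<1} r \<le> M_inf r g * indicator {0..<1} r"
    proof (cases "r \<in> {0..<1}")
      case True
      then have r: "0 \<le> r" "r < 1" by auto
      have "(\<Sum>n. ennreal (a n * r ^ (n + 0))) = ennreal (\<Sum>n. a n * r ^ n)"
        using r a_nonneg by (simp add: suminf_ennreal2 summable_a)
      also have "\<dots> \<le> ennreal (norm (g (of_real r * cis 0)))" using r by (simp add: g_of_real)
      also have "\<dots> \<le> M_inf r g" unfolding M_inf_def by (rule SUP_upper) simp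
      finally show ?thesis using True by simp
    qed simp
  qed
  finally show ?thesis .
qed

text \<open>The primitive of \<open>g\<close> vanishing at 0. At a real \<open>r\<close> it sums
  \<open>a n / (n + 1) * r ^ (n + 1)\<close>, which links circle means of \<open>g\<close> to the
  \<open>HL(1)\<close> norm; it also evaluates the contour integral in the kernel mean.\<close>

definition prim :: "complex \<Rightarrow> complex" where
  "prim z = (\<Sum>n. (if n = 0 then 0 else of_real (a (n - 1) / real n)) * z ^ n)"

sublocale P: disc_series "\<lambda>n. if n = 0 then 0 else complex_of_real (a (n - 1) / real n)" prim
proof
  show "summable (\<lambda>n. norm (if n = 0 then 0 else complex_of_real (a (n - 1) / real n)) * r ^ n)" if r: "0 \<le> r" "r < 1" for r
  proof (subst summable_Suc_iff[symmetric], rule summable_comparison_test'[OF summable_mult[OF summable_a[OF r], of r], of 0])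
    fix n
    have "a n / real (Suc n) \<le> a n" using a_nonneg[of n] by (simp add: divide_le_eq mult_le_cancel_left1)
    then have "a n / real (Suc n) * r ^ Suc n \<le> a n * r ^ Suc n" using r by (intro mult_right_mono) auto
    then show "norm (norm (if Suc n = 0 then 0 else complex_of_real (a (Suc n - 1) / real (Suc n))) * r ^ Suc n) \<le> r * (a n * r ^ n)"
      using a_nonneg[of n] r by (simp add: norm_divide norm_mult mult_ac del: of_nat_Suc)
  qed
qed (simp add: prim_def)

lemma prim_derivative: "norm z < 1 \<Longrightarrow> (prim has_field_derivative g z) (at z)"
  using P.has_field_derivative_g[of z] by (simp add: g_eq of_nat_Suc[symmetric] del: of_nat_Suc)

lemma prim_of_real:
  assumes "0 \<le> r" "r < 1"
  shows "norm (prim (of_real r) - prim 0) \<ge> (\<Sum>n<M. a n / (real n + 1) * r ^ (n + 1))"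
proof -
  let ?b = "\<lambda>n. if n = 0 then 0 else a (n - 1) / real n"
  have b: "0 \<le> ?b n" for n using a_nonneg by simp
  have sm: "summable (\<lambda>n. ?b n * r ^ n)"
    using P.summable_norm_c[OF assms] b by (simp add: if_distrib[of norm] norm_divide a_nonneg cong: if_cong)
  have "prim (of_real r) = (\<Sum>n. of_real (?b n * r ^ n))"
    unfolding prim_def by (intro suminf_cong) auto
  also have "\<dots> = of_real (\<Sum>n. ?b n * r ^ n)" by (rule suminf_of_real[OF sm, symmetric])
  finally have e: "prim (of_real r) = of_real (\<Sum>n. ?b n * r ^ n)" .
  have "prim 0 = (\<Sum>n\<in>{0}. (if n = 0 then 0 else of_real (a (n - 1) / real n)) * (0::complex) ^ n)"
    unfolding prim_def by (rule suminf_finite) auto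
  then have "prim 0 = 0" by simp
  moreover have "(\<Sum>n<M. a n / (real n + 1) * r ^ (n + 1)) \<le> (\<Sum>n. ?b n * r ^ n)"
  proof -
    have "(\<Sum>n<M. a n / (real n + 1) * r ^ (n + 1)) = (\<Sum>n<M. ?b (Suc n) * r ^ Suc n)" by (simp add: add.commute)
    also have "\<dots> = (\<Sum>n<Suc M. ?b n * r ^ n)" by (subst sum.lessThan_Suc_shift) simp
    also have "\<dots> \<le> (\<Sum>n. ?b n * r ^ n)"
      by (rule sum_le_suminf[OF sm finite_lessThan mult_nonneg_nonneg[OF b zero_le_power[OF assms(1)]]])
    finally show ?thesis .
  qed
  ultimately show ?thesis unfolding e by simp
qed

text \<open>Hardy's inequality: \<open>circle_mean_primitive\<close> is applied to the primitive of
  \<open>g\<close>, and \<open>r\<close> tends to 1 in each finite partial sum.\<close>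

lemma Hardy_1_norm_ge: "(\<Sum>n. ennreal (a n / (real n + 1))) \<le> ennreal pi * Hardy_1_norm g"
proof (cases "Hardy_1_norm g = top")
  case True
  then show ?thesis by (simp add: ennreal_mult_top)
next
  case False
  then obtain H where H: "Hardy_1_norm g = ennreal H" "0 \<le> H" by (cases "Hardy_1_norm g") auto
  have le: "(\<Sum>n<M. a n / (real n + 1) * r ^ (n + 1)) \<le> pi * H" if r: "0 < r" "r < 1" for r M
  proof -
    let ?I = "\<integral>\<^sup>+s\<in>{0..2*pi}. ennreal (norm (g (rcis r s))) \<partial>lborel"
    have "ennreal (1 / (2 * pi)) * ?I \<le> Hardy_1_norm g"
      unfolding Hardy_1_norm_def nn_integral_completion rcis_def by (rule SUP_upper) (use r in auto)
    then have 1: "ennreal (2 * pi) * (ennreal (1 / (2 * pi)) * ?I) \<le> ennreal (2 * pi) * ennreal H"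
      unfolding H by (rule mult_left_mono) simp
    have 2: "?I \<le> ennreal (2 * pi * H)"
      using 1 H by (simp add: mult.assoc[symmetric] ennreal_mult[symmetric])
    have "ennreal (2 * norm (prim (of_real r) - prim 0)) \<le> ennreal r * ?I"
      by (rule circle_mean_primitive[OF _ holomorphic_g r]) (use prim_derivative in auto)
    also have "\<dots> \<le> 1 * ennreal (2 * pi * H)" using 2 r by (intro mult_mono) auto
    finally have "norm (prim (of_real r) - prim 0) \<le> pi * H" using H by (simp add: ennreal_le_iff)
    then show ?thesis using prim_of_real[of r M] r by linarith
  qed
  have lim: "(\<Sum>n<M. a n / (real n + 1)) \<le> pi * H" for M
  proof (rule tendsto_upperbound)
    have "((\<lambda>r. \<Sum>n<M. a n / (real n + 1) * r ^ (n + 1)) \<longlongrightarrow> (\<Sum>n<M. a n / (real n + 1) * 1 ^ (n + 1))) (at_left 1)"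
      by (intro tendsto_intros)
    then show "((\<lambda>r. \<Sum>n<M. a n / (real n + 1) * r ^ (n + 1)) \<longlongrightarrow> (\<Sum>n<M. a n / (real n + 1))) (at_left 1)" by simp
    have "\<forall>\<^sub>F r in at_left 1. r \<in> {0<..<1::real}" by (rule eventually_at_left_real) simp
    then show "\<forall>\<^sub>F r in at_left 1. (\<Sum>n<M. a n / (real n + 1) * r ^ (n + 1)) \<le> pi * H"
      by eventually_elim (use le in auto)
  qed simp
  have "(\<Sum>n. ennreal (a n / (real n + 1))) \<le> ennreal (pi * H)"
  proof (rule suminf_le_const)
    show "(\<Sum>n<M. ennreal (a n / (real n + 1))) \<le> ennreal (pi * H)" for M
      using lim[of M] a_nonneg by (subst sum_ennreal) (auto intro: ennreal_leI)
  qed simp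
  then show ?thesis using H by (simp add: ennreal_mult)
qed

text \<open>\<open>circle_mean_primitive\<close> with \<open>H = g\<close> shows that
  \<open>r\<close> times the angular integral of the derivative's modulus is at least
  \<open>2 * (g r - g 0)\<close>; integrating over \<open>r\<close> produces the divisors
  \<open>n + 1\<close>. The constant coefficient is invisible to the derivative and is recovered
  from the summand \<open>norm (g 0)\<close>. The constant \<open>pi / 2\<close> is rounded up to
  2.\<close>

lemma Dirichlet_1_norm_ge: "(\<Sum>n. ennreal (a n / (real n + 1))) \<le> 2 * Dirichlet_1_norm g"
proof -
  have dg: "(g has_field_derivative deriv g z) (at z)" if "norm z < 1" for z
    using has_field_derivative_g[OF that] DERIV_imp_deriv by metis
  let ?b = "\<lambda>n. if n = 0 then 0 else a n"
  have "(\<integral>\<^sup>+r\<in>{0<..<1}. (\<Sum>n. ennreal (2 * ?b n * r ^ (n + 0))) \<partial>lborel)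
    \<le> (\<integral>\<^sup>+r\<in>{0<..<1}. ennreal r * (\<integral>\<^sup>+s\<in>{0<..<2*pi}. ennreal (norm (deriv g (rcis r s))) \<partial>lborel) \<partial>lborel)"
  proof (intro nn_integral_mono)
    fix r :: real
    let ?J = "\<integral>\<^sup>+s\<in>{0<..<2*pi}. ennreal (norm (deriv g (rcis r s))) \<partial>lborel"
    show "(\<Sum>n. ennreal (2 * ?b n * r ^ (n + 0))) * indicator {0<..<1} r \<le> ennreal r * ?J * indicator {0<..<1} r"
    proof (cases "r \<in> {0<..<1}")
      case True
      then have r: "0 < r" "r < 1" by auto
      have smb: "summable (\<lambda>n. ?b n * r ^ n)"
        by (rule summable_comparison_test'[OF summable_a[of r], of 0]) (use r a_nonneg in auto)
      have "(\<Sum>n. a n * r ^ n) = (\<Sum>n. ?b (Suc n) * r ^ Suc n) + a 0"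
        using suminf_split_head[OF summable_a[of r]] r by simp
      moreover have "(\<Sum>n. ?b n * r ^ n) = (\<Sum>n. ?b (Suc n) * r ^ Suc n)"
        using suminf_split_head[OF smb] by simp
      moreover have "g 0 = of_real (a 0)" using g_of_real[of 0] powser_zero[of a] by simp
      ultimately have "g (of_real r) - g 0 = of_real (\<Sum>n. ?b n * r ^ n)"
        using g_of_real[of r] r by (simp only: of_real_add add_diff_cancel_right')
      moreover have b0: "0 \<le> ?b n * r ^ n" for n using a_nonneg r by simp
      ultimately have e: "norm (g (of_real r) - g 0) = (\<Sum>n. ?b n * r ^ n)"
        using suminf_nonneg[OF smb b0] by (simp only: norm_of_real abs_of_nonneg)
      have "(\<Sum>n. ennreal (2 * ?b n * r ^ (n + 0))) = ennreal (\<Sum>n. 2 * (?b n * r ^ n))"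
        using r a_nonneg smb by (subst suminf_ennreal2[symmetric]) (auto simp: mult.assoc intro!: suminf_cong summable_mult)
      also have "(\<Sum>n. 2 * (?b n * r ^ n)) = 2 * norm (g (of_real r) - g 0)" unfolding e by (rule suminf_mult[OF smb])
      also have "ennreal \<dots> \<le> ennreal r * (\<integral>\<^sup>+s\<in>{0..2*pi}. ennreal (norm (deriv g (rcis r s))) \<partial>lborel)"
        by (rule circle_mean_primitive[OF _ _ r]) (use dg holomorphic_g in \<open>auto intro: holomorphic_deriv\<close>)
      also have "(\<integral>\<^sup>+s\<in>{0..2*pi}. ennreal (norm (deriv g (rcis r s))) \<partial>lborel) = ?J"
        by (rule nn_integral_cong_AE)
           (use AE_lborel_singleton[of 0] AE_lborel_singleton[of "2*pi"] in eventually_elim, auto simp: indicator_def)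
      finally show ?thesis using True by simp
    qed simp
  qed
  also have "(\<integral>\<^sup>+r\<in>{0<..<1}. (\<Sum>n. ennreal (2 * ?b n * r ^ (n + 0))) \<partial>lborel) = (\<Sum>n. ennreal (2 * ?b n / (real n + real 0 + 1)))"
    by (rule nn_integral_power_series) (use a_nonneg in auto)
  finally have "ennreal (1 / pi) * (\<Sum>n. ennreal (2 * ?b n / (real n + real 0 + 1))) + ennreal (norm (g 0)) \<le> Dirichlet_1_norm g"
    unfolding Dirichlet_1_norm_polar by (subst add.commute) (intro add_mono mult_left_mono; simp)
  then have up: "ennreal 2 * (ennreal (1 / pi) * (\<Sum>n. ennreal (2 * ?b n / (real n + real 0 + 1))) + ennreal (norm (g 0))) \<le> ennreal 2 * Dirichlet_1_norm g"
    by (rule mult_left_mono) simp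
  have e1: "(\<Sum>n. ennreal (a n / (real n + 1))) = (\<Sum>n. ennreal (?b n / (real n + 1))) + ennreal (a 0)"
    by (subst (1 2) suminf_offset[of _ 1]) auto
  have "(\<Sum>n. ennreal (?b n / (real n + 1))) \<le> (\<Sum>n. ennreal 2 * (ennreal (1 / pi) * ennreal (2 * ?b n / (real n + real 0 + 1))))"
  proof (intro suminf_le summableI)
    fix n
    have b0: "0 \<le> ?b n" using a_nonneg by simp
    have "1 * (?b n / (real n + 1)) \<le> 4 / pi * (?b n / (real n + 1))"
      using pi_less_4 b0 by (intro mult_right_mono) auto
    also have "\<dots> = 2 * (1 / pi * (2 * ?b n / (real n + real 0 + 1)))" by simp
    finally have "ennreal (?b n / (real n + 1)) \<le> ennreal (2 * (1 / pi * (2 * ?b n / (real n + real 0 + 1))))"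
      by (intro ennreal_leI) simp
    also have "\<dots> = ennreal 2 * (ennreal (1 / pi) * ennreal (2 * ?b n / (real n + real 0 + 1)))"
      using b0 by (simp only: ennreal_mult' zero_le_numeral zero_le_divide_1_iff pi_ge_zero)
    finally show "ennreal (?b n / (real n + 1)) \<le> ennreal 2 * (ennreal (1 / pi) * ennreal (2 * ?b n / (real n + real 0 + 1)))" .
  qed
  also have "\<dots> = ennreal 2 * (ennreal (1 / pi) * (\<Sum>n. ennreal (2 * ?b n / (real n + real 0 + 1))))"
    by (simp only: ennreal_suminf_cmult)
  finally have e2: "(\<Sum>n. ennreal (?b n / (real n + 1))) \<le> ennreal 2 * (ennreal (1 / pi) * (\<Sum>n. ennreal (2 * ?b n / (real n + real 0 + 1))))" .
  have "a 0 \<le> 2 * norm (g 0)" using g_of_real[of 0] powser_zero[of a] a_nonneg[of 0] by simp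
  then have "ennreal (a 0) \<le> ennreal (2 * norm (g 0))" by (rule ennreal_leI)
  then have e3: "ennreal (a 0) \<le> ennreal 2 * ennreal (norm (g 0))" by (simp only: ennreal_mult' zero_le_numeral)
  have "(\<Sum>n. ennreal (a n / (real n + 1))) \<le> ennreal 2 * Dirichlet_1_norm g"
    by (rule order_trans[OF _ up]) (unfold e1 distrib_left, rule add_mono[OF e2 e3])
  then show ?thesis by simp
qed

end

section \<open>Power series with moment coefficients\<close>

text \<open>With \<open>F = f * \<omega>\<close>, the image of \<open>f\<close> under
  \<open>H_op\<close> has Taylor coefficients \<open>kernel_coeff n * coef F n\<close>.\<close>

definition coef :: "(real \<Rightarrow> complex) \<Rightarrow> nat \<Rightarrow> complex" where
  "coef F n = (LINT t:{0..<1}|lebesgue. F t * of_real t ^ n)"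

definition abs_coef :: "(real \<Rightarrow> complex) \<Rightarrow> nat \<Rightarrow> real" where
  "abs_coef F n = (LINT t:{0..<1}|lebesgue. norm (F t) * t ^ n)"

lemma set_integrable_mult_bounded:
  fixes F :: "real \<Rightarrow> complex"
  assumes F: "set_integrable lebesgue {0..<1} F"
    and \<phi>: "\<phi> \<in> borel_measurable borel" and K: "\<And>t. 0 \<le> t \<Longrightarrow> t < 1 \<Longrightarrow> norm (\<phi> t) \<le> K"
  shows "set_integrable lebesgue {0..<1} (\<lambda>t. F t * \<phi> t)"
proof (rule set_integrable_bound)
  show "set_integrable lebesgue {0..<1} (\<lambda>t. of_real K * F t)" using F by simp
  have m: "\<phi> \<in> borel_measurable lebesgue" using \<phi> by (intro measurable_completion) simp
  have "(\<lambda>x. indicator {0..<1} x *\<^sub>R F x) \<in> borel_measurable lebesgue"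
    using F by (auto simp: set_integrable_def)
  then have "(\<lambda>x. (indicator {0..<1} x *\<^sub>R F x) * \<phi> x) \<in> borel_measurable lebesgue"
    using m by (rule borel_measurable_times)
  then show "set_borel_measurable lebesgue {0..<1} (\<lambda>t. F t * \<phi> t)"
    by (simp add: set_borel_measurable_def)
  show "AE x in lebesgue. x \<in> {0..<1} \<longrightarrow> norm (F x * \<phi> x) \<le> norm (of_real K * F x)"
  proof (intro AE_I2 impI)
    fix x :: real assume "x \<in> {0..<1}"
    then have "norm (\<phi> x) \<le> \<bar>K\<bar>" using K[of x] by auto
    then show "norm (F x * \<phi> x) \<le> norm (of_real K * F x)"
      using mult_right_mono[OF _ norm_ge_zero[of "F x"]] by (simp add: norm_mult mult.commute[of "norm (F x)"])
  qed
qed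

lemma set_integrable_mult_power:
  fixes F :: "real \<Rightarrow> complex"
  assumes "set_integrable lebesgue {0..<1} F"
  shows "set_integrable lebesgue {0..<1} (\<lambda>t. F t * of_real t ^ n)"
  by (rule set_integrable_mult_bounded[OF assms, where K=1]) (auto simp: norm_power power_le_one)

lemma set_integrable_norm_mult_power:
  fixes F :: "real \<Rightarrow> complex"
  assumes "set_integrable lebesgue {0..<1} F"
  shows "set_integrable lebesgue {0..<1} (\<lambda>t. norm (F t) * t ^ n)"
proof -
  have "set_integrable lebesgue {0..<1} (\<lambda>t. norm (F t * of_real t ^ n))"
    by (rule set_integrable_norm[OF set_integrable_mult_power[OF assms]])
  then show ?thesis
    unfolding set_integrable_def
    by (rule Bochner_Integration.integrable_cong[THEN iffD1, rotated -1])
       (auto simp: indicator_def norm_mult norm_power)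
qed

lemma abs_coef_nonneg: "0 \<le> abs_coef F n"
  unfolding abs_coef_def set_lebesgue_integral_def
  by (rule integral_nonneg_AE) (auto simp: indicator_def)

lemma norm_coef_le:
  assumes "set_integrable lebesgue {0..<1} F"
  shows "norm (coef F n) \<le> abs_coef F n"
proof -
  have "norm (coef F n) \<le> (LINT t:{0..<1}|lebesgue. norm (F t * of_real t ^ n))"
    unfolding coef_def by (rule set_integral_norm_bound[OF set_integrable_mult_power[OF assms]])
  also have "\<dots> = abs_coef F n"
    unfolding abs_coef_def set_lebesgue_integral_def
    by (intro Bochner_Integration.integral_cong) (auto simp: indicator_def norm_mult norm_power)
  finally show ?thesis .
qed

lemma abs_coef_antimono:
  assumes "set_integrable lebesgue {0..<1} F" "n \<le> k"
  shows "abs_coef F k \<le> abs_coef F n"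
  unfolding abs_coef_def
  by (rule set_integral_mono) (use assms in \<open>auto intro!: set_integrable_norm_mult_power mult_left_mono power_decreasing\<close>)

lemma ennreal_abs_coef:
  assumes "set_integrable lebesgue {0..<1} F"
  shows "ennreal (abs_coef F n) = (\<integral>\<^sup>+t\<in>{0..<1}. ennreal (norm (F t)) * ennreal (t ^ n) \<partial>lebesgue)"
proof -
  have "ennreal (abs_coef F n) = (\<integral>\<^sup>+t. ennreal (indicator {0..<1} t *\<^sub>R (norm (F t) * t ^ n)) \<partial>lebesgue)"
    unfolding abs_coef_def set_lebesgue_integral_def
    by (rule nn_integral_eq_integral[symmetric])
       (use set_integrable_norm_mult_power[OF assms] in \<open>auto simp: set_integrable_def indicator_def\<close>)
  also have "\<dots> = (\<integral>\<^sup>+t\<in>{0..<1}. ennreal (norm (F t)) * ennreal (t ^ n) \<partial>lebesgue)"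
    by (intro nn_integral_cong) (auto simp: indicator_def ennreal_mult)
  finally show ?thesis .
qed

text \<open>For \<open>b = a\<close> and \<open>F = f * \<omega>\<close> the left side is the
  integral of \<open>norm f * \<omega> * S\<close>. This is the passage between coefficient
  estimates and the pointwise condition on \<open>\<omega> * S\<close>.\<close>

lemma nn_integral_abs_coef_series:
  assumes F: "set_integrable lebesgue {0..<1} F" and b: "\<And>n. 0 \<le> b n"
  shows "(\<integral>\<^sup>+t\<in>{0..<1}. ennreal (norm (F t)) * (\<Sum>n. ennreal (b n * t ^ n)) \<partial>lebesgue) = (\<Sum>n. ennreal (b n * abs_coef F n))"
proof -
  have Fm: "(\<lambda>t. indicator {0..<1} t *\<^sub>R (norm (F t) * t ^ n)) \<in> borel_measurable lebesgue" for n
    using set_integrable_norm_mult_power[OF F] by (auto simp: set_integrable_def)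
  have m: "(\<lambda>t. ennreal (b n * (indicator {0..<1} t *\<^sub>R (norm (F t) * t ^ n)))) \<in> borel_measurable lebesgue" for n
    using Fm[of n] by (intro measurable_compose[OF _ measurable_ennreal] borel_measurable_times) auto
  have "(\<integral>\<^sup>+t\<in>{0..<1}. ennreal (norm (F t)) * (\<Sum>n. ennreal (b n * t ^ n)) \<partial>lebesgue)
      = (\<integral>\<^sup>+t. (\<Sum>n. ennreal (b n * (indicator {0..<1} t *\<^sub>R (norm (F t) * t ^ n)))) \<partial>lebesgue)"
  proof (intro nn_integral_cong)
    fix t :: real
    show "ennreal (norm (F t)) * (\<Sum>n. ennreal (b n * t ^ n)) * indicator {0..<1} t
       = (\<Sum>n. ennreal (b n * (indicator {0..<1} t *\<^sub>R (norm (F t) * t ^ n))))"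
    proof (cases "t \<in> {0..<1}")
      case True
      then have t: "0 \<le> t" by simp
      have "ennreal (norm (F t)) * (\<Sum>n. ennreal (b n * t ^ n)) = (\<Sum>n. ennreal (norm (F t)) * ennreal (b n * t ^ n))"
        by (simp only: ennreal_suminf_cmult)
      also have "\<dots> = (\<Sum>n. ennreal (b n * (norm (F t) * t ^ n)))"
        by (intro suminf_cong) (use b t in \<open>simp add: mult_ac flip: ennreal_mult\<close>)
      finally show ?thesis using True by simp
    qed simp
  qed
  also have "\<dots> = (\<Sum>n. \<integral>\<^sup>+t. ennreal (b n * (indicator {0..<1} t *\<^sub>R (norm (F t) * t ^ n))) \<partial>lebesgue)"
    by (rule nn_integral_suminf[OF m])
  also have "\<dots> = (\<Sum>n. ennreal (b n * abs_coef F n))"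
  proof (intro suminf_cong)
    fix n
    have "(\<integral>\<^sup>+t. ennreal (b n * (indicator {0..<1} t *\<^sub>R (norm (F t) * t ^ n))) \<partial>lebesgue)
       = (\<integral>\<^sup>+t. ennreal (b n) * ennreal (indicator {0..<1} t *\<^sub>R (norm (F t) * t ^ n)) \<partial>lebesgue)"
      using b by (intro nn_integral_cong) (simp add: ennreal_mult')
    also have "\<dots> = ennreal (b n) * (\<integral>\<^sup>+t. ennreal (indicator {0..<1} t *\<^sub>R (norm (F t) * t ^ n)) \<partial>lebesgue)"
      by (rule nn_integral_cmult) (use Fm[of n] in measurable)
    also have "(\<integral>\<^sup>+t. ennreal (indicator {0..<1} t *\<^sub>R (norm (F t) * t ^ n)) \<partial>lebesgue) = ennreal (abs_coef F n)"
      unfolding abs_coef_def set_lebesgue_integral_def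
      by (rule nn_integral_eq_integral)
         (use set_integrable_norm_mult_power[OF F] in \<open>auto simp: set_integrable_def indicator_def\<close>)
    finally show "(\<integral>\<^sup>+t. ennreal (b n * (indicator {0..<1} t *\<^sub>R (norm (F t) * t ^ n))) \<partial>lebesgue) = ennreal (b n * abs_coef F n)"
      using b by (simp add: ennreal_mult')
  qed
  finally show ?thesis .
qed

lemma coef_series:
  fixes z :: complex and c :: "nat \<Rightarrow> complex"
  assumes F: "set_integrable lebesgue {0..<1} F" and sm: "summable (\<lambda>n. norm (c n) * norm z ^ n)"
  shows "set_integrable lebesgue {0..<1} (\<lambda>t. F t * (\<Sum>n. c n * (of_real t * z) ^ n))"
    and "(LINT t:{0..<1}|lebesgue. F t * (\<Sum>n. c n * (of_real t * z) ^ n)) = (\<Sum>n. c n * coef F n * z ^ n)"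
    and "summable (\<lambda>n. norm (c n * coef F n * z ^ n))"
proof -
  define f where "f = (\<lambda>n t. (c n * z ^ n) * (indicator {0..<1} t *\<^sub>R (F t * of_real t ^ n)))"
  have int: "integrable lebesgue (f n)" for n
    unfolding f_def using set_integrable_mult_power[OF F, of n] unfolding set_integrable_def
    by (intro integrable_mult_right) auto
  have If: "integral\<^sup>L lebesgue (f n) = c n * coef F n * z ^ n" for n
    unfolding f_def coef_def set_lebesgue_integral_def integral_mult_right_zero by (simp add: mult_ac)
  have nf: "norm (f n t) \<le> norm (indicator {0..<1} t *\<^sub>R F t) * (norm (c n) * norm z ^ n)" for n t
  proof (cases "t \<in> {0..<1}")
    case True
    then have "\<bar>t\<bar> ^ n \<le> 1" by (intro power_le_one) auto
    then have "\<bar>t\<bar> ^ n * (norm (F t) * (norm (c n) * norm z ^ n)) \<le> 1 * (norm (F t) * (norm (c n) * norm z ^ n))"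
      by (intro mult_right_mono) auto
    then show ?thesis using True by (simp add: f_def norm_mult norm_power mult_ac)
  qed (simp add: f_def)
  have ae: "AE t in lebesgue. summable (\<lambda>n. norm (f n t))"
  proof (rule AE_I2)
    fix t
    show "summable (\<lambda>n. norm (f n t))"
      by (rule summable_comparison_test'[OF summable_mult[OF sm, of "norm (indicator {0..<1} t *\<^sub>R F t)"], of 0])
         (use nf in simp)
  qed
  have s: "summable (\<lambda>n. \<integral>t. norm (f n t) \<partial>lebesgue)"
  proof (rule summable_comparison_test'[OF summable_mult[OF sm, of "\<integral>t. norm (indicator {0..<1} t *\<^sub>R F t) \<partial>lebesgue"], of 0])
    fix n
    have "(\<integral>t. norm (f n t) \<partial>lebesgue) \<le> (\<integral>t. norm (indicator {0..<1} t *\<^sub>R F t) * (norm (c n) * norm z ^ n) \<partial>lebesgue)"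
      using F nf int[of n] unfolding set_integrable_def
      by (intro integral_mono integrable_norm integrable_mult_left) auto
    then show "norm (\<integral>t. norm (f n t) \<partial>lebesgue) \<le> (\<integral>t. norm (indicator {0..<1} t *\<^sub>R F t) \<partial>lebesgue) * (norm (c n) * norm z ^ n)"
      by simp
  qed
  have eq: "(\<Sum>n. f n t) = indicator {0..<1} t *\<^sub>R (F t * (\<Sum>n. c n * (of_real t * z) ^ n))" for t
  proof (cases "t \<in> {0..<1}")
    case True
    have "summable (\<lambda>n. c n * (of_real t * z) ^ n)"
    proof (rule summable_comparison_test'[OF sm, of 0])
      fix n
      have "\<bar>t\<bar> ^ n \<le> 1" using True by (intro power_le_one) auto
      then have "\<bar>t\<bar> ^ n * (norm (c n) * norm z ^ n) \<le> 1 * (norm (c n) * norm z ^ n)" by (intro mult_right_mono) auto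
      then show "norm (c n * (of_real t * z) ^ n) \<le> norm (c n) * norm z ^ n"
        by (simp add: norm_mult norm_power power_mult_distrib mult_ac)
    qed
    then have "F t * (\<Sum>n. c n * (of_real t * z) ^ n) = (\<Sum>n. F t * (c n * (of_real t * z) ^ n))"
      by (rule suminf_mult[symmetric])
    then show ?thesis using True by (simp add: f_def power_mult_distrib mult_ac)
  qed (simp add: f_def)
  show "set_integrable lebesgue {0..<1} (\<lambda>t. F t * (\<Sum>n. c n * (of_real t * z) ^ n))"
    using integrable_suminf[OF int ae s] unfolding eq set_integrable_def .
  show "(LINT t:{0..<1}|lebesgue. F t * (\<Sum>n. c n * (of_real t * z) ^ n)) = (\<Sum>n. c n * coef F n * z ^ n)"
    using integral_suminf[OF int ae s] unfolding eq set_lebesgue_integral_def If .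
  show "summable (\<lambda>n. norm (c n * coef F n * z ^ n))"
  proof (rule summable_comparison_test'[OF s, of 0])
    fix n
    show "norm (norm (c n * coef F n * z ^ n)) \<le> (\<integral>t. norm (f n t) \<partial>lebesgue)"
      unfolding If[symmetric] using integral_norm_bound[of lebesgue "f n"] by simp
  qed
qed

text \<open>The pointwise bound on the kernel is a power series in \<open>t\<close>, so that integrating it against \<open>\<bar>F\<bar>\<close>
  and then over the circle only needs interchanges of integrals with sums.\<close>

lemma circle_mean_coef_series:
  assumes F: "set_integrable lebesgue {0..<1} F"
    and slow: "slow A b \<beta>" and \<beta>: "\<And>n. 0 \<le> \<beta> n" and A: "0 \<le> A"
    and sm: "\<And>r. 0 \<le> r \<Longrightarrow> r < 1 \<Longrightarrow> summable (\<lambda>n. \<beta> n * r ^ n)"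
    and r: "0 \<le> r" "r < 1"
  shows "(\<integral>\<^sup>+s\<in>{0<..<2*pi}. ennreal (norm (\<Sum>n. of_real (b n) * coef F n * rcis r s ^ n)) \<partial>lborel)
    \<le> (\<Sum>n. ennreal (12 * pi * A * (\<beta> n * r ^ n * abs_coef F n / (real n + 1))))"
proof -
  have point: "ennreal (norm (\<Sum>n. of_real (b n) * coef F n * rcis r s ^ n))
    \<le> (\<Sum>n. ennreal (A * \<beta> n * r ^ n * abs_coef F n) * ennreal (cutoff n (circle_gap s)))" if s: "s \<in> {0<..<2*pi}" for s
  proof -
    define z where "z = rcis r s"
    have nz: "norm z = r" using r by (simp add: z_def rcis_def norm_mult)
    define d where "d = circle_gap s"
    have d: "0 < d" using s by (auto simp: d_def circle_gap_def)
    have smb: "summable (\<lambda>n. norm (complex_of_real (b n)) * norm z ^ n)"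
    proof (rule summable_comparison_test'[OF summable_mult[OF sm[OF r], of A], of 0])
      fix n
      have "\<bar>b n\<bar> \<le> A * \<beta> n" using slow by (auto simp: slow_def)
      then have "\<bar>b n\<bar> * r ^ n \<le> A * \<beta> n * r ^ n" using r by (intro mult_right_mono) auto
      then show "norm (norm (complex_of_real (b n)) * norm z ^ n) \<le> A * (\<beta> n * r ^ n)"
        using r by (simp add: nz abs_mult mult.assoc)
    qed
    note cs = coef_series[OF F smb]
    have bound: "norm (\<Sum>n. of_real (b n) * (of_real t * z) ^ n) \<le> A * (\<Sum>n. \<beta> n * r ^ n * cutoff n d * t ^ n)"
      and sum: "summable (\<lambda>n. \<beta> n * r ^ n * cutoff n d * t ^ n)" if t: "0 \<le> t" "t < 1" for t
    proof -
      define w where "w = of_real t * z"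
      have w: "w = rcis (t * r) s" by (simp add: w_def z_def rcis_def)
      have nw: "norm w = t * r" using t r by (simp add: w_def norm_mult nz)
      have tr: "0 \<le> t * r" "t * r < 1" using t r mult_strict_mono'[of t 1 r 1] by auto
      \<comment> \<open>The gap \<open>d\<close> depends on the angle alone, so one cutoff serves
        all \<open>t\<close> and the bound is a power series in \<open>t\<close> with fixed
        coefficients.\<close>
      have dw: "d \<le> norm (1 - w)" unfolding d_def w using s by (intro circle_gap_le tr) auto
      have sw: "summable (\<lambda>n. \<beta> n * norm w ^ n)" unfolding nw by (rule sm[OF tr])
      have e: "\<beta> n * norm w ^ n * cutoff n d = \<beta> n * r ^ n * cutoff n d * t ^ n" for n
        unfolding nw by (simp add: power_mult_distrib mult_ac)
      have "norm w < 1" unfolding nw by (rule tr)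
      note b = slow_power_series_bound[OF slow \<beta> A d dw this sw, unfolded e]
      show "norm (\<Sum>n. of_real (b n) * (of_real t * z) ^ n) \<le> A * (\<Sum>n. \<beta> n * r ^ n * cutoff n d * t ^ n)"
        using b(1) unfolding w_def .
      show "summable (\<lambda>n. \<beta> n * r ^ n * cutoff n d * t ^ n)" by (rule b(2))
    qed
    have nn: "0 \<le> \<beta> n * r ^ n * cutoff n d" for n using \<beta> r cutoff_nonneg[OF d] by simp
    have "ennreal (norm (\<Sum>n. of_real (b n) * coef F n * z ^ n))
      = ennreal (norm (LINT t:{0..<1}|lebesgue. F t * (\<Sum>n. of_real (b n) * (of_real t * z) ^ n)))"
      unfolding cs(2) ..
    also have "\<dots> \<le> (\<integral>\<^sup>+t. ennreal (norm (indicator {0..<1} t *\<^sub>R (F t * (\<Sum>n. of_real (b n) * (of_real t * z) ^ n)))) \<partial>lebesgue)"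
      unfolding set_lebesgue_integral_def
      by (rule integral_norm_bound_ennreal) (use cs(1) in \<open>simp add: set_integrable_def\<close>)
    also have "\<dots> \<le> (\<integral>\<^sup>+t\<in>{0..<1}. ennreal (norm (F t)) * (\<Sum>n. ennreal (A * (\<beta> n * r ^ n * cutoff n d) * t ^ n)) \<partial>lebesgue)"
    proof (rule nn_integral_mono)
      fix t :: real
      show "ennreal (norm (indicator {0..<1} t *\<^sub>R (F t * (\<Sum>n. of_real (b n) * (of_real t * z) ^ n))))
        \<le> ennreal (norm (F t)) * (\<Sum>n. ennreal (A * (\<beta> n * r ^ n * cutoff n d) * t ^ n)) * indicator {0..<1} t"
      proof (cases "t \<in> {0..<1}")
        case True
        then have t: "0 \<le> t" "t < 1" by auto
        have "ennreal (norm (F t * (\<Sum>n. of_real (b n) * (of_real t * z) ^ n)))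
           \<le> ennreal (norm (F t) * (A * (\<Sum>n. \<beta> n * r ^ n * cutoff n d * t ^ n)))"
          unfolding norm_mult by (intro ennreal_leI mult_left_mono bound[OF t]) simp
        also have "\<dots> = ennreal (norm (F t)) * ennreal (\<Sum>n. A * (\<beta> n * r ^ n * cutoff n d * t ^ n))"
          unfolding suminf_mult[OF sum[OF t]] by (simp add: ennreal_mult')
        also have "ennreal (\<Sum>n. A * (\<beta> n * r ^ n * cutoff n d * t ^ n)) = (\<Sum>n. ennreal (A * (\<beta> n * r ^ n * cutoff n d * t ^ n)))"
          using A nn t by (intro suminf_ennreal2[symmetric] summable_mult[OF sum[OF t]] mult_nonneg_nonneg[OF A]) auto
        finally show ?thesis using True by (simp add: mult.assoc)
      qed simp
    qed
    also have "\<dots> = (\<Sum>n. ennreal (A * (\<beta> n * r ^ n * cutoff n d) * abs_coef F n))"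
      by (rule nn_integral_abs_coef_series[OF F]) (use A nn in auto)
    also have "\<dots> = (\<Sum>n. ennreal (A * \<beta> n * r ^ n * abs_coef F n) * ennreal (cutoff n d))"
    proof (intro suminf_cong)
      fix n
      have e: "A * (\<beta> n * r ^ n * cutoff n d) * abs_coef F n = (A * \<beta> n * r ^ n * abs_coef F n) * cutoff n d"
        by (simp add: mult_ac)
      have "0 \<le> A * \<beta> n * r ^ n * abs_coef F n" using A \<beta> r abs_coef_nonneg by simp
      then show "ennreal (A * (\<beta> n * r ^ n * cutoff n d) * abs_coef F n) = ennreal (A * \<beta> n * r ^ n * abs_coef F n) * ennreal (cutoff n d)"
        unfolding e by (rule ennreal_mult')
    qed
    finally show ?thesis unfolding z_def d_def .
  qed
  have "(\<integral>\<^sup>+s\<in>{0<..<2*pi}. ennreal (norm (\<Sum>n. of_real (b n) * coef F n * rcis r s ^ n)) \<partial>lborel)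
    \<le> (\<integral>\<^sup>+s. (\<Sum>n. ennreal (A * \<beta> n * r ^ n * abs_coef F n) * (ennreal (cutoff n (circle_gap s)) * indicator {0<..<2*pi} s)) \<partial>lborel)"
  proof (rule nn_integral_mono)
    fix s
    show "ennreal (norm (\<Sum>n. of_real (b n) * coef F n * rcis r s ^ n)) * indicator {0<..<2*pi} s
      \<le> (\<Sum>n. ennreal (A * \<beta> n * r ^ n * abs_coef F n) * (ennreal (cutoff n (circle_gap s)) * indicator {0<..<2*pi} s))"
      using point[of s] by (cases "s \<in> {0<..<2*pi}") simp_all
  qed
  also have "\<dots> = (\<Sum>n. \<integral>\<^sup>+s. ennreal (A * \<beta> n * r ^ n * abs_coef F n) * (ennreal (cutoff n (circle_gap s)) * indicator {0<..<2*pi} s) \<partial>lborel)"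
    by (rule nn_integral_suminf) measurable
  also have "\<dots> \<le> (\<Sum>n. ennreal (12 * pi * A * (\<beta> n * r ^ n * abs_coef F n / (real n + 1))))"
  proof (intro suminf_le summableI)
    fix n
    have nn: "0 \<le> A * \<beta> n * r ^ n * abs_coef F n" using A \<beta> r abs_coef_nonneg by simp
    have "(\<integral>\<^sup>+s. ennreal (A * \<beta> n * r ^ n * abs_coef F n) * (ennreal (cutoff n (circle_gap s)) * indicator {0<..<2*pi} s) \<partial>lborel)
      = ennreal (A * \<beta> n * r ^ n * abs_coef F n) * (\<integral>\<^sup>+s\<in>{0<..<2*pi}. ennreal (cutoff n (circle_gap s)) \<partial>lborel)"
      by (rule nn_integral_cmult) measurable
    also have "\<dots> \<le> ennreal (A * \<beta> n * r ^ n * abs_coef F n) * ennreal (12 * pi / (real n + 1))"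
      by (intro mult_left_mono nn_integral_cutoff_circle_gap) simp
    also have "\<dots> = ennreal (12 * pi * A * (\<beta> n * r ^ n * abs_coef F n / (real n + 1)))"
      unfolding ennreal_mult'[OF nn, symmetric] by (simp add: mult_ac)
    finally show "(\<integral>\<^sup>+s. ennreal (A * \<beta> n * r ^ n * abs_coef F n) * (ennreal (cutoff n (circle_gap s)) * indicator {0<..<2*pi} s) \<partial>lborel)
      \<le> ennreal (12 * pi * A * (\<beta> n * r ^ n * abs_coef F n / (real n + 1)))" .
  qed
  finally show ?thesis .
qed

section \<open>The Hilbert-type operators\<close>

lemma abs_coef_0: "abs_coef f 0 = L1_norm f"
  by (simp add: abs_coef_def L1_norm_def)

lemma L1_space_norm: "f \<in> L1_space \<Longrightarrow> (\<lambda>t. complex_of_real (norm (f t))) \<in> L1_space"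
proof -
  assume "f \<in> L1_space"
  then have "set_integrable lebesgue {0..<1} (\<lambda>t. norm (f t))"
    by (auto simp: L1_space_def intro: set_integrable_norm)
  then have "integrable lebesgue (\<lambda>t. complex_of_real (indicator {0..<1} t *\<^sub>R norm (f t)))"
    unfolding set_integrable_def by (rule integrable_of_real)
  then show ?thesis by (simp add: L1_space_def set_integrable_def scaleR_conv_of_real)
qed

context weight
begin

definition kernel_coeff :: "nat \<Rightarrow> real" where "kernel_coeff n = 1 / ((real n + 1) * m n)"

lemma kernel_coeff_pos: "0 < kernel_coeff n"
  using m_pos by (simp add: kernel_coeff_def)

lemma kernel_coeff_div: "kernel_coeff n / (real n + 1) = a n"
  by (simp add: kernel_coeff_def a_def power2_eq_square mult_ac)

lemma kernel_coeff_0: "kernel_coeff 0 = a 0"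
  by (simp add: kernel_coeff_def a_def)

lemma summable_kc:
  assumes "0 \<le> r" "r < 1"
  shows "summable (\<lambda>n. kernel_coeff n * r ^ n)"
proof (rule summable_comparison_test'[OF summable_inverse_m[OF assms], of 0])
  fix n
  have "kernel_coeff n \<le> 1 / m n" using m_pos[of n] by (simp add: kernel_coeff_def frac_le)
  then show "norm (kernel_coeff n * r ^ n) \<le> r ^ n / m n"
    using mult_right_mono[of "kernel_coeff n" "1 / m n" "r ^ n"] kernel_coeff_pos[of n] assms by simp
qed

lemma kernel_mean_eq:
  assumes t: "0 \<le> t" "t < 1" and z: "norm z < 1"
  shows "kernel_mean \<omega> t z = (\<Sum>n. of_real (kernel_coeff n) * (of_real t * z) ^ n)"
proof -
  let ?B = "bergman_kernel \<omega> (of_real t)"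
  have B: "?B w = (\<Sum>n. of_real (t ^ n / m n) * w ^ n)" for w
  proof -
    have "2 * moment \<omega> (2 * real n + 1) = m n" for n by (simp only: moment_eq_mom m_def)
    then show ?thesis by (simp add: bergman_kernel_def power_mult_distrib mult_ac)
  qed
  have sm: "summable (\<lambda>n. norm (complex_of_real (t ^ n / m n)) * r ^ n)" if r: "0 \<le> r" "r < 1" for r
  proof (rule summable_comparison_test'[OF summable_inverse_m[OF r], of 0])
    fix n
    have "t ^ n * (r ^ n / m n) \<le> 1 * (r ^ n / m n)"
      using t r m_pos[of n] by (intro mult_right_mono power_le_one) auto
    then show "norm (norm (complex_of_real (t ^ n / m n)) * r ^ n) \<le> r ^ n / m n"
      using t r m_pos[of n] by (simp add: norm_mult norm_divide norm_power)
  qed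
  interpret K: nonneg_disc_series "\<lambda>n. t ^ n / m n" ?B
    using sm B t m_pos by unfold_locales (auto simp: less_imp_le)
  show ?thesis
  proof (cases "z = 0")
    case True
    have "(\<Sum>n. complex_of_real (t ^ n / m n) * 0 ^ n) = of_real (t ^ 0 / m 0)"
      by (rule powser_zero)
    moreover have "(\<Sum>n. complex_of_real (kernel_coeff n) * 0 ^ n) = of_real (kernel_coeff 0)"
      by (rule powser_zero)
    ultimately show ?thesis using True by (simp add: kernel_mean_def B kernel_coeff_def)
  next
    case False
    have seg: "path_image (linepath 0 z) \<subseteq> ball 0 1"
      using z by (simp add: closed_segment_subset)
    have "(?B has_contour_integral (K.prim (pathfinish (linepath 0 z)) - K.prim (pathstart (linepath 0 z)))) (linepath 0 z)"
      by (rule contour_integral_primitive[OF _ _ seg])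
         (use K.prim_derivative in \<open>auto intro: has_field_derivative_at_within\<close>)
    then have "contour_integral (linepath 0 z) ?B = K.prim z - K.prim 0"
      by (simp add: contour_integral_unique)
    moreover have "K.prim 0 = 0"
    proof -
      have "K.prim 0 = (if (0::nat) = 0 then 0 else of_real (t ^ (0 - 1) / m (0 - 1) / real 0))"
        unfolding K.prim_def by (rule powser_zero)
      then show ?thesis by simp
    qed
    moreover have "K.prim z = z * (\<Sum>n. of_real (kernel_coeff n) * (of_real t * z) ^ n)"
    proof -
      let ?f = "\<lambda>n. (if n = 0 then 0 else complex_of_real (t ^ (n - 1) / m (n - 1) / real n)) * z ^ n"
      have "K.prim z = (\<Sum>n. ?f (Suc n))"
        using suminf_split_head[OF K.P.summable_c[OF z]] unfolding K.prim_def by simp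
      also have "\<dots> = (\<Sum>n. z * (of_real (kernel_coeff n) * (of_real t * z) ^ n))"
        by (intro suminf_cong) (simp add: kernel_coeff_def power_mult_distrib mult_ac add.commute)
      also have "\<dots> = z * (\<Sum>n. of_real (kernel_coeff n) * (of_real t * z) ^ n)"
      proof (rule suminf_mult, rule summable_norm_cancel)
        have tz: "0 \<le> t * norm z" "t * norm z < 1" using t z mult_strict_mono'[of t 1 "norm z" 1] by auto
        show "summable (\<lambda>n. norm (complex_of_real (kernel_coeff n) * (of_real t * z) ^ n))"
          using summable_kc[OF tz] kernel_coeff_pos t by (simp add: norm_mult norm_power less_imp_le abs_of_pos)
      qed
      finally show ?thesis .
    qed
    ultimately show ?thesis using False by (simp add: kernel_mean_def)
  qed
qed

text \<open>For fixed \<open>z\<close> in the disc the kernel mean is bounded in \<open>t\<close>,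
  so integrability of \<open>f * \<omega>\<close> alone makes the transform exist at every
  point.\<close>

lemma H_op_series:
  fixes f :: "real \<Rightarrow> complex"
  defines "F \<equiv> \<lambda>t. f t * of_real (\<omega> t)"
  assumes F: "set_integrable lebesgue {0..<1} F"
  shows "\<exists>g. H_op \<omega> f = Some g \<and> disc_series (\<lambda>n. of_real (kernel_coeff n) * coef F n) g"
proof -
  let ?X = "\<lambda>z t. f t * kernel_mean \<omega> t z * complex_of_real (\<omega> t)"
  have sm: "summable (\<lambda>n. norm (complex_of_real (kernel_coeff n)) * norm z ^ n)" if "norm z < 1" for z :: complex
    using summable_kc[of "norm z"] that kernel_coeff_pos by (simp add: less_imp_le abs_of_pos)
  have X: "?X z t = F t * (\<Sum>n. of_real (kernel_coeff n) * (of_real t * z) ^ n)" if "t \<in> {0..<1}" "norm z < 1" for z t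
    using that by (simp add: kernel_mean_eq F_def mult_ac)
  have int: "set_integrable lebesgue {0..<1} (?X z)" if z: "norm z < 1" for z
    using coef_series(1)[OF F sm[OF z]]
    by (rule set_integrable_cong[THEN iffD1, OF refl refl, rotated]) (use X z in auto)
  define g where "g = (\<lambda>z. LINT t:{0..<1}|lebesgue. ?X z t)"
  have "H_op \<omega> f = Some g"
    unfolding H_op_def integral_transform_def g_def using int by simp
  moreover have "disc_series (\<lambda>n. of_real (kernel_coeff n) * coef F n) g"
  proof
    fix r :: real assume r: "0 \<le> r" "r < 1"
    then show "summable (\<lambda>n. norm (complex_of_real (kernel_coeff n) * coef F n) * r ^ n)"
      using coef_series(3)[OF F sm[of "of_real r"]] by (simp add: norm_mult norm_power)
  next
    fix z :: complex assume z: "norm z < 1"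
    have "g z = (LINT t:{0..<1}|lebesgue. F t * (\<Sum>n. of_real (kernel_coeff n) * (of_real t * z) ^ n))"
      unfolding g_def by (rule set_lebesgue_integral_cong) (use X z in auto)
    then show "g z = (\<Sum>n. of_real (kernel_coeff n) * coef F n * z ^ n)"
      using coef_series(2)[OF F sm[OF z]] by simp
  qed
  ultimately show ?thesis by blast
qed

text \<open>At the centre the kernel mean is the positive constant \<open>kernel_coeff 0\<close>,
  independent of \<open>t\<close>, so existence of the integral there already forces integrability
  of \<open>f * \<omega>\<close>.\<close>

lemma H_op_Some_imp_integrable:
  assumes "H_op \<omega> f = Some g"
  shows "set_integrable lebesgue {0..<1} (\<lambda>t. f t * of_real (\<omega> t))"
proof -
  have "\<forall>z\<in>ball 0 1. set_integrable lebesgue {0..<1} (\<lambda>t. f t * kernel_mean \<omega> t z * of_real (\<omega> t))"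
    using assms by (auto simp: H_op_def integral_transform_def split: if_splits)
  then have i: "set_integrable lebesgue {0..<1} (\<lambda>t. f t * kernel_mean \<omega> t 0 * of_real (\<omega> t))" by simp
  have k0: "kernel_mean \<omega> t 0 = of_real (kernel_coeff 0)" if "t \<in> {0..<1}" for t
    using that kernel_mean_eq[of t 0] powser_zero[of "\<lambda>n. complex_of_real (kernel_coeff n)"] by simp
  have "set_integrable lebesgue {0..<1} (\<lambda>t. of_real (1 / kernel_coeff 0) * (f t * kernel_mean \<omega> t 0 * of_real (\<omega> t)))"
    using i by simp
  then show ?thesis
    by (rule set_integrable_cong[THEN iffD1, OF refl refl, rotated]) (use k0 kernel_coeff_pos[of 0] in auto)
qed

lemma H_tilde_op_eq: "H_tilde_op \<omega> f = H_op \<omega> (\<lambda>t. of_real (norm (f t)))"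
  by (simp add: H_tilde_op_def H_op_def)

lemma norm_series_le:
  assumes "set_integrable lebesgue {0..<1} F"
  shows "(\<Sum>n. ennreal (norm (of_real (kernel_coeff n) * coef F n) / (real n + 1))) \<le> (\<Sum>n. ennreal (a n * abs_coef F n))"
proof (intro suminf_le summableI ennreal_leI)
  fix n
  have "kernel_coeff n * norm (coef F n) / (real n + 1) = a n * norm (coef F n)"
    by (simp add: kernel_coeff_div[symmetric])
  also have "\<dots> \<le> a n * abs_coef F n"
    by (intro mult_left_mono norm_coef_le assms less_imp_le[OF a_pos])
  finally show "norm (of_real (kernel_coeff n) * coef F n) / (real n + 1) \<le> a n * abs_coef F n"
    using kernel_coeff_pos[of n] by (simp add: norm_mult)
qed

text \<open>The factor 4 dominates the four constants 1, \<open>pi\<close>, 2 and 1. The hypothesis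
  on \<open>coef\<close> expresses that all moments of \<open>F\<close> are nonnegative, as the
  lower bounds need.\<close>

lemma lower_bound:
  assumes N: "N \<in> {H_inf_1_norm, Hardy_1_norm, Dirichlet_1_norm, HL_1_norm}"
    and F: "set_integrable lebesgue {0..<1} F" and coef: "\<And>n. coef F n = of_real (abs_coef F n)"
    and g: "disc_series (\<lambda>n. of_real (kernel_coeff n) * coef F n) g"
  shows "(\<Sum>n. ennreal (a n * abs_coef F n)) \<le> 4 * N g"
proof -
  have "disc_series (\<lambda>n. complex_of_real (kernel_coeff n * abs_coef F n)) g"
    using g by (simp add: coef)
  then interpret nonneg_disc_series "\<lambda>n. kernel_coeff n * abs_coef F n" g
    by (intro nonneg_disc_series.intro nonneg_disc_series_axioms.intro)
       (auto intro!: mult_nonneg_nonneg abs_coef_nonneg less_imp_le[OF kernel_coeff_pos])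
  have e: "kernel_coeff n * abs_coef F n / (real n + 1) = a n * abs_coef F n" for n
    by (simp add: kernel_coeff_div[symmetric])
  have one: "x \<le> 4 * x" for x :: ennreal
    using mult_right_mono[of 1 4 x] by simp
  have pi4: "ennreal pi \<le> 4"
  proof -
    have "ennreal pi \<le> ennreal 4" using pi_less_4 by (intro ennreal_leI) simp
    then show ?thesis by simp
  qed
  have nn: "0 \<le> a n * abs_coef F n" for n using a_pos[of n] abs_coef_nonneg by simp
  have norm_e: "norm (complex_of_real (kernel_coeff n * abs_coef F n)) / (real n + 1) = a n * abs_coef F n" for n
    by (simp only: norm_of_real abs_of_nonneg[OF mult_nonneg_nonneg[OF less_imp_le[OF kernel_coeff_pos] abs_coef_nonneg]] e)
  consider "N = H_inf_1_norm" | "N = Hardy_1_norm" | "N = Dirichlet_1_norm" | "N = HL_1_norm" using N by blast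
  then show ?thesis
  proof cases
    case 1
    then show ?thesis using H_inf_1_norm_ge unfolding e by (auto intro: order_trans one)
  next
    case 2
    have "ennreal pi * Hardy_1_norm g \<le> 4 * Hardy_1_norm g" using pi4 by (rule mult_right_mono) simp
    then show ?thesis using Hardy_1_norm_ge 2 unfolding e by (auto intro: order_trans)
  next
    case 3
    have "2 * Dirichlet_1_norm g \<le> 4 * Dirichlet_1_norm g" by (rule mult_right_mono) auto
    then show ?thesis using Dirichlet_1_norm_ge 3 unfolding e by (auto intro: order_trans)
  next
    case 4
    then show ?thesis using HL_1_norm_g unfolding norm_e by (simp add: one)
  qed
qed

section \<open>Finiteness of \<open>m1\<close>\<close>

lemma m1_eq: "m1 \<omega> = esssup (lebesgue_on {0..<1}) (\<lambda>t. ereal (\<omega> t * (1 + (LINT s:{0..t}|lebesgue. 1 / W s))))"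
  by (simp add: m1_def)

lemma m1_finite_iff: "m1 \<omega> < \<infinity> \<longleftrightarrow> (\<exists>M. AE t in lebesgue_on {0..<1}. \<omega> t * (1 + G t) \<le> M)"
proof -
  let ?L = "lebesgue_on {0..<1::real}"
  let ?f = "\<lambda>t. ereal (\<omega> t * (1 + (LINT s:{0..t}|lebesgue. 1 / W s)))"
  have ae: "AE t in ?L. ?f t = ereal (\<omega> t * (1 + G t))"
    by (rule AE_I2) (auto simp: LINT_inverse_W)
  have "integrable ?L \<omega>"
    using omega_integrable by (simp add: integrable_restrict_space set_integrable_def)
  then have \<omega>: "\<omega> \<in> borel_measurable ?L" by auto
  \<comment> \<open>Measurability is needed to pass from an almost everywhere bound to the essential
    supremum; for \<open>G\<close> it follows from monotonicity.\<close>
  have "mono_on {0..<1} G" by (auto intro!: mono_onI G_mono)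
  then have "G \<in> borel_measurable (restrict_space borel {0..<1})" by (rule borel_measurable_mono_on_fnc)
  then have G: "G \<in> borel_measurable ?L"
  proof (rule borel_measurable_subalgebra[rotated 2])
    have "sets borel \<subseteq> sets (lebesgue :: real measure)"
      by (rule subsetI) (rule sets_completionI_sets, simp)
    then show "sets (restrict_space borel {0..<1}) \<subseteq> sets ?L"
      unfolding sets_restrict_space by (rule image_mono)
  qed (simp add: space_restrict_space)
  have "(\<lambda>t. ereal (\<omega> t * (1 + G t))) \<in> borel_measurable ?L" using \<omega> G by measurable
  then have meas: "?f \<in> borel_measurable ?L"
    by (rule measurable_cong[THEN iffD1, rotated]) (simp add: LINT_inverse_W)
  show ?thesis
  proof
    assume fin: "m1 \<omega> < \<infinity>"
    obtain M where M: "m1 \<omega> \<le> ereal M" using fin by (cases "m1 \<omega>") auto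
    have "AE t in ?L. ?f t \<le> m1 \<omega>" unfolding m1_eq by (rule esssup_AE)
    then have "AE t in ?L. \<omega> t * (1 + G t) \<le> M"
      using ae
    proof eventually_elim
      case (elim t)
      then have "ereal (\<omega> t * (1 + G t)) \<le> ereal M" using M by (metis order_trans)
      then show ?case by simp
    qed
    then show "\<exists>M. AE t in ?L. \<omega> t * (1 + G t) \<le> M" ..
  next
    assume "\<exists>M. AE t in ?L. \<omega> t * (1 + G t) \<le> M"
    then obtain M where M: "AE t in ?L. \<omega> t * (1 + G t) \<le> M" ..
    have "AE t in ?L. ?f t \<le> ereal M" using M ae
    proof eventually_elim
      case (elim t)
      have "ereal (\<omega> t * (1 + G t)) \<le> ereal M" using elim(1) by simp
      then show ?case unfolding elim(2) .
    qed
    then have "m1 \<omega> \<le> ereal M" unfolding m1_eq by (rule esssup_I[OF meas])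
    then show "m1 \<omega> < \<infinity>" by (auto intro: le_less_trans)
  qed
qed

lemma D_class_iff:
  assumes "m1 \<omega> < \<infinity>"
  shows "\<omega> \<in> D_class \<longleftrightarrow> \<omega> \<in> D_hat"
  using assms D_check_if_bounded unfolding D_class_def m1_finite_iff by blast

section \<open>Necessity: testing boundedness on nonnegative functions\<close>

text \<open>For \<open>p \<ge> 0\<close> the two operators agree and give nonnegative Taylor coefficients, as the lower bounds need.\<close>

lemma bounded_test:
  assumes bd: "bounded_from_L1 T N" and N: "N \<in> {H_inf_1_norm, Hardy_1_norm, Dirichlet_1_norm, HL_1_norm}"
    and T: "T \<in> {H_op \<omega>, H_tilde_op \<omega>}"
  obtains K where "0 \<le> K" "\<And>p. \<lbrakk>\<And>t. 0 \<le> p t; set_integrable lebesgue {0..<1} (\<lambda>t. complex_of_real (p t));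
      L1_norm (\<lambda>t. complex_of_real (p t)) \<le> 1\<rbrakk> \<Longrightarrow>
      (\<Sum>n. ennreal (a n * abs_coef (\<lambda>t. complex_of_real (p t) * of_real (\<omega> t)) n)) \<le> ennreal K"
proof -
  let ?S = "SUP f\<in>{f \<in> L1_space. L1_norm f \<le> 1}. N (the (T f))"
  have S: "?S < \<infinity>" using bd by (auto simp: bounded_from_L1_def)
  have "4 * ?S < top" using S by (simp add: ennreal_mult_less_top)
  then obtain K where K: "0 \<le> K" "4 * ?S = ennreal K" by (cases "4 * ?S") auto
  have "(\<Sum>n. ennreal (a n * abs_coef (\<lambda>t. complex_of_real (p t) * of_real (\<omega> t)) n)) \<le> ennreal K"
    if p: "\<And>t. 0 \<le> p t" "set_integrable lebesgue {0..<1} (\<lambda>t. complex_of_real (p t))"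
      "L1_norm (\<lambda>t. complex_of_real (p t)) \<le> 1" for p
  proof -
    let ?f = "\<lambda>t. complex_of_real (p t)"
    let ?F = "\<lambda>t. ?f t * of_real (\<omega> t)"
    have f: "?f \<in> {f \<in> L1_space. L1_norm f \<le> 1}" using p by (simp add: L1_space_def)
    have Tf: "T ?f = H_op \<omega> ?f" using T p(1) by (auto simp: H_tilde_op_eq)
    obtain g where g: "T ?f = Some g" using bd f by (auto simp: bounded_from_L1_def)
    have F: "set_integrable lebesgue {0..<1} ?F"
      using H_op_Some_imp_integrable[of ?f g] g Tf by simp
    have "\<exists>g'. H_op \<omega> ?f = Some g' \<and> disc_series (\<lambda>n. of_real (kernel_coeff n) * coef ?F n) g'"
      by (rule H_op_series[OF F])
    then have ds: "disc_series (\<lambda>n. of_real (kernel_coeff n) * coef ?F n) g" using g Tf by auto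
    have co: "coef ?F n = of_real (abs_coef ?F n)" for n
    proof -
      have "coef ?F n = (LINT t:{0..<1}|lebesgue. complex_of_real (p t * \<omega> t * t ^ n))"
        unfolding coef_def by simp
      also have "\<dots> = of_real (LINT t:{0..<1}|lebesgue. p t * \<omega> t * t ^ n)"
        by (rule set_integral_complex_of_real)
      also have "(LINT t:{0..<1}|lebesgue. p t * \<omega> t * t ^ n) = abs_coef ?F n"
        unfolding abs_coef_def set_lebesgue_integral_def
        by (intro Bochner_Integration.integral_cong) (auto simp: indicator_def norm_mult p omega_nonneg abs_of_nonneg)
      finally show ?thesis .
    qed
    have "(\<Sum>n. ennreal (a n * abs_coef ?F n)) \<le> 4 * N g"
      by (rule lower_bound[OF N F co ds])
    also have "N g \<le> ?S"
      using SUP_upper[OF f, of "\<lambda>f. N (the (T f))"] g by simp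
    then have "4 * N g \<le> ennreal K" unfolding K(2)[symmetric] by (rule mult_left_mono) simp
    finally show ?thesis .
  qed
  then show ?thesis using that K by blast
qed

text \<open>The factor \<open>k + 1\<close> normalises the norm in \<open>L^1\<close> to 1, and the
  modulus keeps \<open>p k\<close> nonnegative on the whole line, as \<open>bounded_test\<close>
  demands. The moments against \<open>\<omega>\<close> are again moments of \<open>\<omega>\<close>,
  of order shifted by \<open>k\<close>.\<close>

lemma test_power:
  defines "p k t \<equiv> (real k + 1) * \<bar>t\<bar> ^ k"
  shows "0 \<le> p k t" "set_integrable lebesgue {0..<1} (\<lambda>t. complex_of_real (p k t))"
    "L1_norm (\<lambda>t. complex_of_real (p k t)) \<le> 1"
    "abs_coef (\<lambda>t. complex_of_real (p k t) * of_real (\<omega> t)) n = (real k + 1) * mom (n + k)"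
proof -
  show "0 \<le> p k t" for t by (simp add: p_def)
  have one: "set_integrable lebesgue {0..<1::real} (\<lambda>_. 1 :: complex)"
    unfolding set_integrable_def by (intro integrable_scaleR_left integrable_real_indicator) auto
  show i: "set_integrable lebesgue {0..<1} (\<lambda>t. complex_of_real (p k t))"
  proof -
    have "set_integrable lebesgue {0..<1} (\<lambda>t. 1 * complex_of_real (p k t))"
    proof (rule set_integrable_mult_bounded[OF one, where K="real k + 1"])
      show "norm (complex_of_real (p k t)) \<le> real k + 1" if "0 \<le> t" "t < 1" for t
      proof -
        have "(real k + 1) * \<bar>t\<bar> ^ k \<le> (real k + 1) * 1" using that by (intro mult_left_mono power_le_one) auto
        then show ?thesis unfolding norm_of_real p_def by simp
      qed
    qed (unfold p_def, measurable)
    then show ?thesis by simp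
  qed
  have "ennreal (L1_norm (\<lambda>t. complex_of_real (p k t)))
      = (\<integral>\<^sup>+t\<in>{0..<1}. (\<Sum>n. ennreal ((if n = 0 then real k + 1 else 0) * t ^ (n + k))) \<partial>lebesgue)"
    unfolding abs_coef_0[symmetric] ennreal_abs_coef[OF i]
  proof (intro nn_integral_cong)
    fix t :: real
    have "(\<Sum>n. ennreal ((if n = 0 then real k + 1 else 0) * t ^ (n + k))) = ennreal ((real k + 1) * t ^ k)"
      by (subst suminf_finite[of "{0}"]) auto
    moreover have "norm (complex_of_real (p k t)) = (real k + 1) * t ^ k" if "t \<in> {0..<1}"
      using that unfolding norm_of_real p_def by simp
    ultimately show "ennreal (norm (complex_of_real (p k t))) * ennreal (t ^ 0) * indicator {0..<1} t =
      (\<Sum>n. ennreal ((if n = 0 then real k + 1 else 0) * t ^ (n + k))) * indicator {0..<1} t"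
      by (cases "t \<in> {0..<1}") simp_all
  qed
  also have "\<dots> = (\<Sum>n. ennreal ((if n = 0 then real k + 1 else 0) / (real n + real k + 1)))"
    unfolding set_nn_integral_Ico_Ioo by (rule nn_integral_power_series) auto
  also have "\<dots> = ennreal 1" by (subst suminf_finite[of "{0}"]) auto
  finally have "ennreal (L1_norm (\<lambda>t. complex_of_real (p k t))) \<le> ennreal 1" by simp
  then show "L1_norm (\<lambda>t. complex_of_real (p k t)) \<le> 1" by (subst (asm) ennreal_le_iff) auto
  have "abs_coef (\<lambda>t. complex_of_real (p k t) * of_real (\<omega> t)) n
     = I (\<lambda>s. (real k + 1) * s ^ (n + k))"
    unfolding abs_coef_def I_def set_lebesgue_integral_def
  proof (intro Bochner_Integration.integral_cong refl)
    fix t :: real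
    have "norm (complex_of_real (p k t) * of_real (\<omega> t)) = (real k + 1) * t ^ k * \<omega> t" if "t \<in> {0..<1}"
      using that omega_nonneg[of t] unfolding norm_mult norm_of_real p_def by simp
    then show "indicator {0..<1} t *\<^sub>R (norm (complex_of_real (p k t) * of_real (\<omega> t)) * t ^ n) =
      indicator {0..<1} t *\<^sub>R ((real k + 1) * t ^ (n + k) * \<omega> t)"
      by (cases "t \<in> {0..<1}") (simp_all add: power_add)
  qed
  then show "abs_coef (\<lambda>t. complex_of_real (p k t) * of_real (\<omega> t)) n = (real k + 1) * mom (n + k)"
    by (simp add: I_cmult mom_def)
qed

text \<open>Test functions \<open>(N + 1) t\<^sup>N\<close>: the terms with \<open>3 N \<le> n < 4 N\<close> compare \<open>mom (5 * N)\<close> with \<open>mom (6 * N)\<close>.\<close>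

lemma D_hat_if_bounded:
  assumes "bounded_from_L1 T N" "N \<in> {H_inf_1_norm, Hardy_1_norm, Dirichlet_1_norm, HL_1_norm}"
    "T \<in> {H_op \<omega>, H_tilde_op \<omega>}"
  shows "\<omega> \<in> D_hat"
proof -
  obtain K where K: "0 \<le> K" "\<And>p. \<lbrakk>\<And>t. 0 \<le> p t; set_integrable lebesgue {0..<1} (\<lambda>t. complex_of_real (p t));
      L1_norm (\<lambda>t. complex_of_real (p t)) \<le> 1\<rbrakk> \<Longrightarrow>
      (\<Sum>n. ennreal (a n * abs_coef (\<lambda>t. complex_of_real (p t) * of_real (\<omega> t)) n)) \<le> ennreal K"
    using bounded_test[OF assms] by blast
  have "mom (5 * N) \<le> 32 * K * mom (6 * N)" if N: "1 \<le> N" for N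
  proof -
    have nn: "0 \<le> a n * ((real N + 1) * mom (n + N))" for n
      using a_pos[of n] mom_nonneg by simp
    have "(\<Sum>n. ennreal (a n * ((real N + 1) * mom (n + N)))) \<le> ennreal K"
      using K(2)[OF test_power(1-3)] unfolding test_power(4) .
    moreover have "(\<Sum>n\<in>{3*N..<4*N}. ennreal (a n * ((real N + 1) * mom (n + N)))) \<le> (\<Sum>n. ennreal (a n * ((real N + 1) * mom (n + N))))"
      by (rule sum_le_suminf) auto
    ultimately have "(\<Sum>n\<in>{3*N..<4*N}. ennreal (a n * ((real N + 1) * mom (n + N)))) \<le> ennreal K"
      by (rule order_trans[rotated])
    then have le: "(\<Sum>n\<in>{3*N..<4*N}. a n * ((real N + 1) * mom (n + N))) \<le> K"
      using K(1) nn by (subst (asm) sum_ennreal) (auto simp: ennreal_le_iff)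
    \<comment> \<open>A lower bound common to the \<open>N\<close> terms:
      \<open>n + N < 5 * N\<close> bounds the moment of the test function below,
      \<open>2 * n + 1 > 6 * N\<close> bounds \<open>m n\<close> above by
      \<open>2 * mom (6 * N)\<close>, and \<open>n + 1 \<le> 4 * N\<close>. The factors 16 and 2
      make the final 32.\<close>
    define c where "c = real N * mom (5 * N) / ((4 * real N)^2 * (2 * mom (6 * N)))"
    have "(\<Sum>n\<in>{3*N..<4*N}. c) \<le> (\<Sum>n\<in>{3*N..<4*N}. a n * ((real N + 1) * mom (n + N)))"
    proof (rule sum_mono)
      fix n assume n: "n \<in> {3*N..<4*N}"
      have 1: "m n \<le> 2 * mom (6 * N)" using n by (auto simp: m_def intro: mom_antimono)
      have 2: "(real n + 1)^2 \<le> (4 * real N)^2" using n by (intro power_mono) auto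
      have 3: "mom (5 * N) \<le> mom (n + N)" using n by (intro mom_antimono) auto
      have "1 / ((4 * real N)^2 * (2 * mom (6 * N))) \<le> a n"
        unfolding a_def using 1 2 m_pos[of n] by (intro divide_left_mono mult_mono mult_pos_pos) (use mom_pos N in auto)
      moreover have "real N * mom (5 * N) \<le> (real N + 1) * mom (n + N)"
        using 3 mom_nonneg by (intro mult_mono) auto
      ultimately have "1 / ((4 * real N)^2 * (2 * mom (6 * N))) * (real N * mom (5 * N)) \<le> a n * ((real N + 1) * mom (n + N))"
        by (rule mult_mono) (use a_pos[of n] mom_nonneg in auto)
      then show "c \<le> a n * ((real N + 1) * mom (n + N))" by (simp add: c_def)
    qed
    then have "real N * c \<le> K" using le by simp
    moreover have "real N * c = mom (5 * N) / (32 * mom (6 * N))"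
      using N by (simp add: c_def power2_eq_square)
    ultimately show ?thesis using mom_pos[of "6 * N"] by (simp add: field_simps)
  qed
  then show ?thesis by (rule D_hat_if_mom)
qed

text \<open>Duality of \<open>L^1\<close> and \<open>L^\<infinity>\<close> made concrete: on the
  normalised indicator of the set where \<open>\<omega> * S\<close> exceeds \<open>K + 1\<close>,
  the tested quantity would be at least \<open>K + 1\<close>, so that set is null.\<close>

lemma omega_S_bounded:
  assumes "bounded_from_L1 T N" "N \<in> {H_inf_1_norm, Hardy_1_norm, Dirichlet_1_norm, HL_1_norm}"
    "T \<in> {H_op \<omega>, H_tilde_op \<omega>}"
  shows "\<exists>K. AE t in lebesgue_on {0..<1}. \<omega> t * S t \<le> K"
proof -
  obtain K where K: "0 \<le> K" "\<And>p. \<lbrakk>\<And>t. 0 \<le> p t; set_integrable lebesgue {0..<1} (\<lambda>t. complex_of_real (p t));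
      L1_norm (\<lambda>t. complex_of_real (p t)) \<le> 1\<rbrakk> \<Longrightarrow>
      (\<Sum>n. ennreal (a n * abs_coef (\<lambda>t. complex_of_real (p t) * of_real (\<omega> t)) n)) \<le> ennreal K"
    using bounded_test[OF assms] by blast
  define E where "E = {t. K + 1 < indicator {0..<1} t * \<omega> t * S t}"
  have E_sub: "E \<subseteq> {0..<1}" using K(1) by (auto simp: E_def indicator_def split: if_splits)
  have \<omega>m: "(\<lambda>t. indicator {0..<1} t * \<omega> t) \<in> borel_measurable lebesgue"
    using omega_integrable by (auto simp: set_integrable_def)
  have "S \<in> borel_measurable borel" unfolding S_def[abs_def] by measurable
  then have "S \<in> borel_measurable lebesgue" by (intro measurable_completion) simp
  then have fm: "(\<lambda>t. indicator {0..<1} t * \<omega> t * S t) \<in> borel_measurable lebesgue"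
    by (rule borel_measurable_times[OF \<omega>m])
  have "E = {t \<in> space lebesgue. K + 1 < indicator {0..<1} t * \<omega> t * S t}" by (simp add: E_def)
  also have "\<dots> \<in> sets lebesgue" using fm by measurable
  finally have Em: "E \<in> sets lebesgue" .
  have E_fin: "emeasure lebesgue E < \<infinity>"
  proof -
    have "emeasure lebesgue E \<le> emeasure lebesgue {0..<1::real}" using E_sub by (intro emeasure_mono) auto
    also have "\<dots> < \<infinity>" by simp
    finally show ?thesis .
  qed
  have "emeasure lebesgue E = 0"
  proof (rule ccontr)
    assume "emeasure lebesgue E \<noteq> 0"
    moreover have eE: "emeasure lebesgue E = ennreal (measure lebesgue E)"
      using E_fin by (intro emeasure_eq_ennreal_measure) (simp add: less_top)
    ultimately have "measure lebesgue E \<noteq> 0" by auto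
    then have mE: "0 < measure lebesgue E" "emeasure lebesgue E = ennreal (measure lebesgue E)"
      using eE zero_less_measure_iff by blast+
    define e where "e = measure lebesgue E"
    define p where "p = (\<lambda>t. indicator E t / e)"
    have p0: "0 \<le> p t" for t using mE by (simp add: p_def e_def)
    have pi: "set_integrable lebesgue {0..<1} (\<lambda>t. complex_of_real (p t))"
    proof -
      have "integrable lebesgue (\<lambda>t. indicator E t *\<^sub>R complex_of_real (1 / e))"
        using Em E_fin by (intro integrable_scaleR_left integrable_real_indicator)
      then show ?thesis
        unfolding set_integrable_def
        by (rule Bochner_Integration.integrable_cong[THEN iffD1, rotated -1])
           (use E_sub in \<open>auto simp: p_def indicator_def\<close>)
    qed
    have "L1_norm (\<lambda>t. complex_of_real (p t)) = (\<integral>t. indicator E t *\<^sub>R (1 / e) \<partial>lebesgue)"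
      unfolding L1_norm_def set_lebesgue_integral_def norm_of_real abs_of_nonneg[OF p0]
      by (intro Bochner_Integration.integral_cong) (use E_sub in \<open>auto simp: p_def indicator_def\<close>)
    also have "\<dots> = 1" using Em E_fin mE by (simp add: e_def)
    finally have L1: "L1_norm (\<lambda>t. complex_of_real (p t)) \<le> 1" by simp
    let ?F = "\<lambda>t. complex_of_real (p t) * of_real (\<omega> t)"
    have F: "set_integrable lebesgue {0..<1} ?F"
    proof -
      have "integrable lebesgue (\<lambda>t. indicator {0..<1} t *\<^sub>R \<omega> t)"
        using omega_integrable by (simp add: set_integrable_def)
      then have "integrable lebesgue (\<lambda>t. (indicator {0..<1} t *\<^sub>R \<omega> t) * indicator E t)"
        by (rule integrable_real_mult_indicator[OF Em])
      then have "integrable lebesgue (\<lambda>t. complex_of_real ((1 / e) * ((indicator {0..<1} t *\<^sub>R \<omega> t) * indicator E t)))"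
        by (intro integrable_of_real integrable_mult_right)
      then show ?thesis unfolding set_integrable_def
        by (rule Bochner_Integration.integrable_cong[THEN iffD1, rotated -1])
           (auto simp: p_def indicator_def)
    qed
    have "ennreal (K + 1) = (\<integral>\<^sup>+t. ennreal ((K + 1) / e) * indicator E t \<partial>lebesgue)"
      using Em mE K(1) by (simp add: nn_integral_cmult_indicator e_def flip: ennreal_mult)
    also have "\<dots> \<le> (\<integral>\<^sup>+t\<in>{0..<1}. ennreal (norm (?F t)) * (\<Sum>n. ennreal (a n * t ^ n)) \<partial>lebesgue)"
    proof (rule nn_integral_mono)
      fix t :: real
      show "ennreal ((K + 1) / e) * indicator E t \<le> ennreal (norm (?F t)) * (\<Sum>n. ennreal (a n * t ^ n)) * indicator {0..<1} t"
      proof (cases "t \<in> E")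
        case True
        then have t: "0 \<le> t" "t < 1" using E_sub by auto
        have "(\<Sum>n. ennreal (a n * t ^ n)) = ennreal (S t)"
          unfolding S_def using t
          by (intro suminf_ennreal2 summable_S) (auto intro!: mult_nonneg_nonneg less_imp_le[OF a_pos])
        moreover have "norm (?F t) = \<omega> t / e"
          unfolding norm_mult norm_of_real abs_of_nonneg[OF p0] using True omega_nonneg[OF t] by (simp add: p_def)
        moreover have "ennreal ((K + 1) / e) \<le> ennreal (\<omega> t / e) * ennreal (S t)"
        proof -
          have "K + 1 \<le> \<omega> t * S t" using True t by (simp add: E_def)
          then have "(K + 1) / e \<le> \<omega> t * S t / e" using mE by (intro divide_right_mono) (auto simp: e_def)
          then have "ennreal ((K + 1) / e) \<le> ennreal (\<omega> t / e * S t)" by (intro ennreal_leI) simp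
          also have "\<dots> = ennreal (\<omega> t / e) * ennreal (S t)"
            using omega_nonneg[OF t] mE by (intro ennreal_mult') (auto simp: e_def)
          finally show ?thesis .
        qed
        ultimately show ?thesis using True t by simp
      qed simp
    qed
    also have "\<dots> = (\<Sum>n. ennreal (a n * abs_coef ?F n))"
      by (rule nn_integral_abs_coef_series[OF F less_imp_le[OF a_pos]])
    also have "\<dots> \<le> ennreal K" by (rule K(2)[OF p0 pi L1])
    finally show False using K(1) by (simp add: ennreal_le_iff)
  qed
  then have "E \<in> null_sets lebesgue" using Em by auto
  then have "AE t in lebesgue. t \<notin> E" by (rule AE_not_in)
  then have "AE t in lebesgue. t \<in> {0..<1} \<longrightarrow> \<omega> t * S t \<le> K + 1"
    by eventually_elim (auto simp: E_def)
  then have "AE t in lebesgue_on {0..<1}. \<omega> t * S t \<le> K + 1"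
    by (subst AE_restrict_space_iff) auto
  then show ?thesis ..
qed

end

section \<open>Sufficiency: upper bounds for the four norms\<close>

context doubling_weight
begin

text \<open>For \<open>H(inf,1)\<close> and \<open>HL(1)\<close> the triangle inequality suffices.
  For \<open>H^1\<close> the circle mean supplies the second factor \<open>1 / (n + 1)\<close>. For
  \<open>D^1_0\<close> differentiation removes the factor \<open>1 / (n + 1)\<close> of the kernel,
  leaving coefficients with majorant \<open>1 / m n\<close>; the circle mean and the radial integral
  then supply one factor each.\<close>

lemma upper_bound:
  assumes N: "N \<in> {H_inf_1_norm, Hardy_1_norm, Dirichlet_1_norm, HL_1_norm}"
  shows "\<exists>K\<ge>0. \<forall>F g. set_integrable lebesgue {0..<1} F \<longrightarrow> disc_series (\<lambda>n. of_real (kernel_coeff n) * coef F n) g \<longrightarrow>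
    N g \<le> ennreal K * (\<Sum>n. ennreal (a n * abs_coef F n))"
proof -
  define D where "D = 27 * (C ^ 3) ^ 4"
  have D: "0 \<le> D" using C by (simp add: D_def)
  have inv_m: "0 \<le> 1 / m n" for n using m_pos[of n] by simp
  have slow1: "slow (9 * D * 2) (\<lambda>n. 1 / m n * (1 / (real n + 1))) (\<lambda>n. 1 / m n * (1 / (real n + 1)))"
    by (rule slow_mult[OF slow_inverse_m[folded D_def] slow_inverse_Suc]) (use D inv_m in auto)
  have shift: "slow (D * C ^ 3) (\<lambda>n. 1 / m (n + 1)) (\<lambda>n. 1 / m n)"
  proof (rule slow_shift[OF slow_inverse_m[folded D_def] _ inv_m D])
    fix n
    have "m n \<le> C ^ 3 * m (n + 1)" by (rule m_Suc_ge) simp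
    then show "1 / m (n + 1) \<le> C ^ 3 * (1 / m n)" using m_pos[of n] m_pos[of "n + 1"] by (simp add: field_simps)
  qed
  have DC: "0 \<le> D * C ^ 3" using D C by simp
  have slow2: "slow (9 * (D * C ^ 3) * 2) (\<lambda>n. 1 / m (n + 1) * ((real n + 1) / (real n + 2))) (\<lambda>n. 1 / m n * 1)"
    by (rule slow_mult[OF shift slow_ratio]) (use DC inv_m in auto)
  define A1 where "A1 = 9 * D * 2"
  define A2 where "A2 = 9 * (D * C ^ 3) * 2"
  have A12: "0 \<le> A1" "0 \<le> A2" using D DC by (auto simp: A1_def A2_def)
  have sm_m: "summable (\<lambda>n. 1 / m n * 1 * r ^ n)" if "0 \<le> r" "r < 1" for r
    using summable_inverse_m[OF that] by simp
  have kernel_coeff_eq: "1 / m n * (1 / (real n + 1)) = kernel_coeff n" for n by (simp add: kernel_coeff_def mult_ac)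
  \<comment> \<open>One constant for all four norms: it dominates 1, the \<open>6 * A1\<close> of
    the Hardy norm, and \<open>1 + 12 * A2\<close> of the Dirichlet norm, where the 1 pays for
    \<open>norm (g 0)\<close>.\<close>
  define K where "K = 1 + 12 * pi * A1 + 12 * A2"
  have K: "0 \<le> K" "1 \<le> K" "6 * A1 \<le> K" "1 + 12 * A2 \<le> K"
  proof -
    have "6 * A1 \<le> 12 * pi * A1" by (rule mult_right_mono) (use A12 pi_gt3 in linarith)+
    then show "0 \<le> K" "1 \<le> K" "6 * A1 \<le> K" "1 + 12 * A2 \<le> K" using A12 unfolding K_def by linarith+
  qed
  have "N g \<le> ennreal K * (\<Sum>n. ennreal (a n * abs_coef F n))"
    if F: "set_integrable lebesgue {0..<1} F" and g: "disc_series (\<lambda>n. of_real (kernel_coeff n) * coef F n) g" for F g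
  proof -
    interpret disc_series "\<lambda>n. of_real (kernel_coeff n) * coef F n" g by (rule g)
    let ?X = "\<Sum>n. ennreal (a n * abs_coef F n)"
    have K_le: "y \<le> ennreal K * ?X" if "y \<le> ennreal k * ?X" "k \<le> K" for y k
      using that by (meson ennreal_leI mult_right_mono order_trans zero_le)
    have nn: "0 \<le> a n * abs_coef F n" for n using a_pos[of n] abs_coef_nonneg by simp
    consider "N = H_inf_1_norm" | "N = Hardy_1_norm" | "N = Dirichlet_1_norm" | "N = HL_1_norm" using N by blast
    then show ?thesis
    proof cases
      case 1
      have "N g \<le> ennreal 1 * ?X"
        using order_trans[OF H_inf_1_norm_le norm_series_le[OF F]] 1 by simp
      then show ?thesis by (rule K_le) (rule K)
    next
      case 4
      have "N g \<le> ennreal 1 * ?X"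
        using norm_series_le[OF F] HL_1_norm_g 4 by simp
      then show ?thesis by (rule K_le) (rule K)
    next
      case 2
      have "Hardy_1_norm g \<le> ennreal (6 * A1) * ?X"
        unfolding Hardy_1_norm_def
      proof (rule SUP_least)
        fix r :: real assume "r \<in> {0<..<1}"
        then have r: "0 \<le> r" "r < 1" by auto
        have "(\<integral>\<^sup>+s\<in>{0..2*pi}. ennreal (norm (g (of_real r * cis s))) \<partial>lebesgue)
            = (\<integral>\<^sup>+s\<in>{0<..<2*pi}. ennreal (norm (\<Sum>n. of_real (1 / m n * (1 / (real n + 1))) * coef F n * rcis r s ^ n)) \<partial>lborel)"
          unfolding nn_integral_completion
        proof (rule nn_integral_cong_AE)
          have gz: "g (of_real r * cis s) = (\<Sum>n. of_real (1 / m n * (1 / (real n + 1))) * coef F n * rcis r s ^ n)" for s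
            unfolding kernel_coeff_eq rcis_def by (rule g_eq) (use r in \<open>simp add: norm_mult\<close>)
          show "AE s in lborel. ennreal (norm (g (of_real r * cis s))) * indicator {0..2*pi} s =
            ennreal (norm (\<Sum>n. of_real (1 / m n * (1 / (real n + 1))) * coef F n * rcis r s ^ n)) * indicator {0<..<2*pi} s"
            unfolding gz using AE_lborel_singleton[of 0] AE_lborel_singleton[of "2*pi"]
            by eventually_elim (auto simp: indicator_def)
        qed
        also have "\<dots> \<le> (\<Sum>n. ennreal (12 * pi * A1 * (1 / m n * (1 / (real n + 1)) * r ^ n * abs_coef F n / (real n + 1))))"
        proof (rule circle_mean_coef_series[OF F slow1[folded A1_def] _ A12(1) _ r])
          show "0 \<le> 1 / m n * (1 / (real n + 1))" for n using inv_m[of n] by simp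
          show "summable (\<lambda>n. 1 / m n * (1 / (real n + 1)) * r ^ n)" if "0 \<le> r" "r < 1" for r
            unfolding kernel_coeff_eq by (rule summable_kc[OF that])
        qed
        also have "\<dots> \<le> (\<Sum>n. ennreal (12 * pi * A1) * ennreal (a n * abs_coef F n))"
        proof (intro suminf_le summableI)
          fix n
          have "1 / m n * (1 / (real n + 1)) * r ^ n * abs_coef F n / (real n + 1) = a n * abs_coef F n * r ^ n"
            unfolding kernel_coeff_eq kernel_coeff_div[symmetric] by simp
          also have "\<dots> \<le> a n * abs_coef F n" using nn[of n] r by (intro mult_left_le power_le_one) auto
          finally have "12 * pi * A1 * (1 / m n * (1 / (real n + 1)) * r ^ n * abs_coef F n / (real n + 1))
             \<le> 12 * pi * A1 * (a n * abs_coef F n)"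
            using A12 by (intro mult_left_mono) auto
          then show "ennreal (12 * pi * A1 * (1 / m n * (1 / (real n + 1)) * r ^ n * abs_coef F n / (real n + 1)))
             \<le> ennreal (12 * pi * A1) * ennreal (a n * abs_coef F n)"
            using A12 nn[of n] by (subst ennreal_mult[symmetric]) (auto intro: ennreal_leI)
        qed
        also have "\<dots> = ennreal (12 * pi * A1) * ?X" by (rule ennreal_suminf_cmult)
        finally have "ennreal (1 / (2 * pi)) * (\<integral>\<^sup>+s\<in>{0..2*pi}. ennreal (norm (g (of_real r * cis s))) \<partial>lebesgue)
           \<le> ennreal (1 / (2 * pi)) * (ennreal (12 * pi * A1) * ?X)"
          by (rule mult_left_mono) simp
        also have "\<dots> = ennreal (1 / (2 * pi) * (12 * pi * A1)) * ?X"
          using A12 by (simp only: mult.assoc[symmetric] ennreal_mult zero_le_divide_1_iff mult_nonneg_nonneg pi_ge_zero zero_le_numeral)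
        also have "1 / (2 * pi) * (12 * pi * A1) = 6 * A1" by simp
        finally show "ennreal (1 / (2 * pi)) * (\<integral>\<^sup>+s\<in>{0..2*pi}. ennreal (norm (g (of_real r * cis s))) \<partial>lebesgue)
           \<le> ennreal (6 * A1) * ?X" .
      qed
      then show ?thesis unfolding 2 by (rule K_le) (rule K)
    next
      case 3
      \<comment> \<open>The extra factor \<open>t\<close> absorbs the index shift caused by
        differentiation: \<open>coef F (n + 1) = coef F' n\<close>.\<close>
      define F' where "F' = (\<lambda>t. F t * of_real t ^ 1)"
      have F': "set_integrable lebesgue {0..<1} F'" unfolding F'_def by (rule set_integrable_mult_power[OF F])
      have cF': "coef F (n + 1) = coef F' n" for n by (simp add: coef_def F'_def mult.assoc)
      have aF': "abs_coef F' n \<le> abs_coef F n" for n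
      proof -
        have "abs_coef F' n = abs_coef F (n + 1)"
          unfolding abs_coef_def set_lebesgue_integral_def
          by (intro Bochner_Integration.integral_cong) (auto simp: F'_def indicator_def norm_mult)
        then show ?thesis using abs_coef_antimono[OF F, of n "n + 1"] by simp
      qed
      have dg: "deriv g z = (\<Sum>n. of_real (1 / m (n + 1) * ((real n + 1) / (real n + 2))) * coef F' n * z ^ n)" if "norm z < 1" for z
      proof -
        have "deriv g z = (\<Sum>n. of_nat (n + 1) * (of_real (kernel_coeff (n + 1)) * coef F (n + 1)) * z ^ n)"
          using has_field_derivative_g[OF that] by (rule DERIV_imp_deriv)
        moreover have "of_nat (n + 1) * (complex_of_real (kernel_coeff (n + 1)) * c) = of_real (1 / m (n + 1) * ((real n + 1) / (real n + 2))) * c" for n c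
          by (simp add: kernel_coeff_def field_simps)
        ultimately show ?thesis unfolding cF' by simp
      qed
      define b where "b = (\<lambda>n. 12 * pi * A2 * (1 / m n * abs_coef F n / (real n + 1)))"
      have b0: "0 \<le> b n" for n using A12 inv_m[of n] abs_coef_nonneg[of F n] by (simp add: b_def)
      have "(\<integral>\<^sup>+r\<in>{0<..<1}. ennreal r * (\<integral>\<^sup>+s\<in>{0<..<2*pi}. ennreal (norm (deriv g (rcis r s))) \<partial>lborel) \<partial>lborel)
          \<le> (\<integral>\<^sup>+r\<in>{0<..<1}. (\<Sum>n. ennreal (b n * r ^ (n + 1))) \<partial>lborel)"
      proof (intro nn_integral_mono)
        fix r :: real
        show "ennreal r * (\<integral>\<^sup>+s\<in>{0<..<2*pi}. ennreal (norm (deriv g (rcis r s))) \<partial>lborel) * indicator {0<..<1} r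
          \<le> (\<Sum>n. ennreal (b n * r ^ (n + 1))) * indicator {0<..<1} r"
        proof (cases "r \<in> {0<..<1}")
          case True
          then have r: "0 \<le> r" "r < 1" by auto
          have nr: "norm (rcis r s) < 1" for s using r by (simp add: rcis_def norm_mult)
          have "(\<integral>\<^sup>+s\<in>{0<..<2*pi}. ennreal (norm (deriv g (rcis r s))) \<partial>lborel)
            \<le> (\<Sum>n. ennreal (12 * pi * A2 * (1 / m n * 1 * r ^ n * abs_coef F' n / (real n + 1))))"
            unfolding dg[OF nr]
            by (rule circle_mean_coef_series[OF F' slow2[folded A2_def] _ A12(2) sm_m r]) (use inv_m in auto)
          then have "ennreal r * (\<integral>\<^sup>+s\<in>{0<..<2*pi}. ennreal (norm (deriv g (rcis r s))) \<partial>lborel)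
            \<le> ennreal r * (\<Sum>n. ennreal (12 * pi * A2 * (1 / m n * 1 * r ^ n * abs_coef F' n / (real n + 1))))"
            by (rule mult_left_mono) simp
          also have "\<dots> = (\<Sum>n. ennreal r * ennreal (12 * pi * A2 * (1 / m n * 1 * r ^ n * abs_coef F' n / (real n + 1))))"
            by (rule ennreal_suminf_cmult[symmetric])
          also have "\<dots> \<le> (\<Sum>n. ennreal (b n * r ^ (n + 1)))"
          proof (intro suminf_le summableI)
            fix n
            have "r * (12 * pi * A2 * (1 / m n * 1 * r ^ n * abs_coef F' n / (real n + 1)))
                = (12 * pi * A2 * (1 / m n) * r ^ (n + 1) / (real n + 1)) * abs_coef F' n" by (simp add: mult_ac)
            also have "\<dots> \<le> (12 * pi * A2 * (1 / m n) * r ^ (n + 1) / (real n + 1)) * abs_coef F n"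
              using A12 inv_m[of n] r by (intro mult_left_mono aF') auto
            also have "\<dots> = b n * r ^ (n + 1)" by (simp add: b_def mult_ac)
            finally show "ennreal r * ennreal (12 * pi * A2 * (1 / m n * 1 * r ^ n * abs_coef F' n / (real n + 1))) \<le> ennreal (b n * r ^ (n + 1))"
              unfolding ennreal_mult'[OF r(1), symmetric] by (rule ennreal_leI)
          qed
          finally show ?thesis using True by simp
        qed simp
      qed
      also have "\<dots> = (\<Sum>n. ennreal (b n / (real n + real 1 + 1)))"
        by (rule nn_integral_power_series[OF b0])
      also have "\<dots> \<le> (\<Sum>n. ennreal (12 * pi * A2) * ennreal (a n * abs_coef F n))"
      proof (intro suminf_le summableI)
        fix n
        have "b n / (real n + real 1 + 1) \<le> b n / (real n + 1)" using b0[of n] by (intro divide_left_mono) auto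
        also have "\<dots> = 12 * pi * A2 * (a n * abs_coef F n)"
          by (simp add: b_def a_def power2_eq_square mult_ac)
        finally show "ennreal (b n / (real n + real 1 + 1)) \<le> ennreal (12 * pi * A2) * ennreal (a n * abs_coef F n)"
          using A12 nn[of n] by (subst ennreal_mult[symmetric]) (auto intro: ennreal_leI)
      qed
      also have "\<dots> = ennreal (12 * pi * A2) * ?X" by (rule ennreal_suminf_cmult)
      finally have "ennreal (1 / pi) * (\<integral>\<^sup>+r\<in>{0<..<1}. ennreal r * (\<integral>\<^sup>+s\<in>{0<..<2*pi}. ennreal (norm (deriv g (rcis r s))) \<partial>lborel) \<partial>lborel)
         \<le> ennreal (1 / pi) * (ennreal (12 * pi * A2) * ?X)"
        by (rule mult_left_mono) simp
      also have "\<dots> = ennreal (1 / pi * (12 * pi * A2)) * ?X"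
        using A12 by (simp only: mult.assoc[symmetric] ennreal_mult zero_le_divide_1_iff mult_nonneg_nonneg pi_ge_zero zero_le_numeral)
      also have "1 / pi * (12 * pi * A2) = 12 * A2" by simp
      finally have area: "ennreal (1 / pi) * (\<integral>\<^sup>+r\<in>{0<..<1}. ennreal r * (\<integral>\<^sup>+s\<in>{0<..<2*pi}. ennreal (norm (deriv g (rcis r s))) \<partial>lborel) \<partial>lborel)
         \<le> ennreal (12 * A2) * ?X" .
      have g0: "ennreal (norm (g 0)) \<le> ?X"
      proof -
        have "g 0 = of_real (kernel_coeff 0) * coef F 0"
          using g_eq[of 0] powser_zero[of "\<lambda>n. of_real (kernel_coeff n) * coef F n"] by simp
        then have "norm (g 0) = a 0 * norm (coef F 0)" using a_pos[of 0] by (simp add: norm_mult kernel_coeff_0)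
        also have "\<dots> \<le> a 0 * abs_coef F 0" using a_pos[of 0] norm_coef_le[OF F] by (intro mult_left_mono) auto
        finally have "ennreal (norm (g 0)) \<le> ennreal (a 0 * abs_coef F 0)" by (rule ennreal_leI)
        also have "\<dots> = (\<Sum>n<1. ennreal (a n * abs_coef F n))" by simp
        also have "\<dots> \<le> ?X" by (rule sum_le_suminf) auto
        finally show ?thesis .
      qed
      have "N g \<le> ?X + ennreal (12 * A2) * ?X"
        unfolding 3 Dirichlet_1_norm_polar by (rule add_mono[OF g0 area])
      also have "\<dots> = ennreal (1 + 12 * A2) * ?X"
        using A12 by (simp add: distrib_right ennreal_plus del: ennreal_plus[symmetric])
      finally show ?thesis by (rule K_le) (rule K)
    qed
  qed
  then show ?thesis using K(1) by blast
qed

text \<open>Since \<open>1 + G \<ge> 1\<close>, the hypothesis bounds \<open>\<omega>\<close>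
  itself, which makes \<open>f * \<omega>\<close> integrable. The norm is then controlled by the
  integral of \<open>norm f * \<omega> * S\<close>, where \<open>S\<close> is at most a multiple of
  \<open>1 + G\<close>. The other operator is this one applied to \<open>norm f\<close>, a function
  of the same norm.\<close>

lemma bounded_if_m1:
  assumes M: "AE t in lebesgue_on {0..<1}. \<omega> t * (1 + G t) \<le> M"
    and N: "N \<in> {H_inf_1_norm, Hardy_1_norm, Dirichlet_1_norm, HL_1_norm}"
    and T: "T \<in> {H_op \<omega>, H_tilde_op \<omega>}"
  shows "bounded_from_L1 T N"
proof -
  define M' where "M' = max M 0"
  have ae: "AE t in lebesgue. t \<in> {0..<1} \<longrightarrow> \<omega> t * (1 + G t) \<le> M'"
  proof -
    have "AE t in lebesgue. t \<in> {0..<1} \<longrightarrow> \<omega> t * (1 + G t) \<le> M"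
      using M by (subst (asm) AE_restrict_space_iff) auto
    then show ?thesis by eventually_elim (auto simp: M'_def)
  qed
  obtain KS where KS: "0 < KS" "\<And>t. 0 \<le> t \<Longrightarrow> t < 1 \<Longrightarrow> S t \<le> KS * (1 + G t)"
    using S_le_one_plus_G by blast
  obtain K where K: "0 \<le> K" "\<And>F g. set_integrable lebesgue {0..<1} F \<Longrightarrow> disc_series (\<lambda>n. of_real (kernel_coeff n) * coef F n) g \<Longrightarrow>
    N g \<le> ennreal K * (\<Sum>n. ennreal (a n * abs_coef F n))"
    using upper_bound[OF N] by blast
  define B where "B = K * (KS * M')"
  have B: "0 \<le> B" using K KS by (simp add: B_def M'_def)
  have key: "\<exists>g\<in>analytic_space N. H_op \<omega> f = Some g \<and> N g \<le> ennreal (B * L1_norm f)" if f: "f \<in> L1_space" for f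
  proof -
    let ?F = "\<lambda>t. f t * of_real (\<omega> t)"
    have fi: "set_integrable lebesgue {0..<1} f" using f by (simp add: L1_space_def)
    have F: "set_integrable lebesgue {0..<1} ?F"
    proof (rule set_integrable_bound)
      show "set_integrable lebesgue {0..<1} (\<lambda>t. of_real M' * f t)" using fi by simp
      have 1: "(\<lambda>t. indicator {0..<1} t *\<^sub>R f t) \<in> borel_measurable lebesgue" using fi by (auto simp: set_integrable_def)
      have "(\<lambda>t. indicator {0..<1} t *\<^sub>R \<omega> t) \<in> borel_measurable lebesgue" using omega_integrable by (auto simp: set_integrable_def)
      then have "(\<lambda>t. complex_of_real (indicator {0..<1} t *\<^sub>R \<omega> t)) \<in> borel_measurable lebesgue"
        by (rule measurable_compose[OF _ borel_measurable_of_real])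
      from borel_measurable_times[OF 1 this]
      have "(\<lambda>t. (indicator {0..<1} t *\<^sub>R f t) * complex_of_real (indicator {0..<1} t *\<^sub>R \<omega> t)) \<in> borel_measurable lebesgue" .
      also have "(\<lambda>t. (indicator {0..<1} t *\<^sub>R f t) * complex_of_real (indicator {0..<1} t *\<^sub>R \<omega> t))
        = (\<lambda>t. indicator {0..<1} t *\<^sub>R ?F t)" by (auto simp: indicator_def)
      finally show "set_borel_measurable lebesgue {0..<1} ?F" by (simp add: set_borel_measurable_def)
      show "AE t in lebesgue. t \<in> {0..<1} \<longrightarrow> norm (?F t) \<le> norm (of_real M' * f t)"
        using ae
      proof eventually_elim
        case (elim t)
        show ?case
        proof
          assume t: "t \<in> {0..<1}"
          have "\<omega> t * 1 \<le> \<omega> t * (1 + G t)" using t omega_nonneg[of t] G_nonneg[of t] by (intro mult_left_mono) auto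
          then have "\<omega> t \<le> M'" using elim t by auto
          then have "norm (f t) * \<omega> t \<le> norm (f t) * M'" by (rule mult_left_mono) simp
          then show "norm (?F t) \<le> norm (of_real M' * f t)"
            using t omega_nonneg[of t] by (simp add: norm_mult M'_def mult.commute)
        qed
      qed
    qed
    obtain g where g: "H_op \<omega> f = Some g" "disc_series (\<lambda>n. of_real (kernel_coeff n) * coef ?F n) g"
      using H_op_series[OF F] by blast
    have "(\<Sum>n. ennreal (a n * abs_coef ?F n)) = (\<integral>\<^sup>+t\<in>{0..<1}. ennreal (norm (?F t)) * (\<Sum>n. ennreal (a n * t ^ n)) \<partial>lebesgue)"
      by (rule nn_integral_abs_coef_series[OF F less_imp_le[OF a_pos], symmetric])
    also have "\<dots> \<le> (\<integral>\<^sup>+t. ennreal (KS * M') * (ennreal (norm (f t)) * ennreal (t ^ 0) * indicator {0..<1} t) \<partial>lebesgue)"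
    proof (rule nn_integral_mono_AE)
      show "AE t in lebesgue. ennreal (norm (?F t)) * (\<Sum>n. ennreal (a n * t ^ n)) * indicator {0..<1} t
         \<le> ennreal (KS * M') * (ennreal (norm (f t)) * ennreal (t ^ 0) * indicator {0..<1} t)"
        using ae
      proof eventually_elim
        case (elim t)
        show ?case
        proof (cases "t \<in> {0..<1}")
          case True
          then have t: "0 \<le> t" "t < 1" by auto
          have w: "0 \<le> \<omega> t" by (rule omega_nonneg[OF t])
          have "(\<Sum>n. ennreal (a n * t ^ n)) = ennreal (S t)"
            unfolding S_def using t
            by (intro suminf_ennreal2 summable_S) (auto intro!: mult_nonneg_nonneg less_imp_le[OF a_pos])
          moreover have "norm (?F t) * S t \<le> KS * M' * norm (f t)"
          proof -
            have "\<omega> t * S t \<le> \<omega> t * (KS * (1 + G t))" by (intro mult_left_mono KS(2) t w)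
            also have "\<dots> = KS * (\<omega> t * (1 + G t))" by simp
            also have "\<dots> \<le> KS * M'" using elim True KS(1) by (intro mult_left_mono) auto
            finally have "norm (f t) * (\<omega> t * S t) \<le> norm (f t) * (KS * M')" by (rule mult_left_mono) simp
            then show ?thesis using w by (simp add: norm_mult mult_ac)
          qed
          then have "ennreal (norm (?F t) * S t) \<le> ennreal (KS * M' * norm (f t))" by (rule ennreal_leI)
          moreover have "ennreal (norm (?F t) * S t) = ennreal (norm (?F t)) * ennreal (S t)"
            by (rule ennreal_mult') simp
          moreover have "ennreal (KS * M' * norm (f t)) = ennreal (KS * M') * ennreal (norm (f t))"
            using KS(1) by (intro ennreal_mult') (simp add: M'_def)
          ultimately show ?thesis using True by simp
        qed simp
      qed
    qed
    also have "\<dots> = ennreal (KS * M') * (\<integral>\<^sup>+t\<in>{0..<1}. ennreal (norm (f t)) * ennreal (t ^ 0) \<partial>lebesgue)"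
    proof (rule nn_integral_cmult)
      have "(\<lambda>t. indicator {0..<1} t *\<^sub>R f t) \<in> borel_measurable lebesgue"
        using fi unfolding set_integrable_def by (rule borel_measurable_integrable)
      then have "(\<lambda>t. norm (indicator {0..<1} t *\<^sub>R f t)) \<in> borel_measurable lebesgue"
        by (rule measurable_compose[OF _ borel_measurable_norm])
      then have "(\<lambda>t. ennreal (norm (indicator {0..<1} t *\<^sub>R f t))) \<in> borel_measurable lebesgue"
        by (rule measurable_compose[OF _ measurable_ennreal])
      also have "(\<lambda>t. ennreal (norm (indicator {0..<1} t *\<^sub>R f t))) = (\<lambda>t. ennreal (norm (f t)) * ennreal (t ^ 0) * indicator {0..<1} t)"
        by (auto simp: indicator_def)
      finally show "(\<lambda>t. ennreal (norm (f t)) * ennreal (t ^ 0) * indicator {0..<1} t) \<in> borel_measurable lebesgue" .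
    qed
    also have "\<dots> = ennreal (KS * M') * ennreal (L1_norm f)"
      unfolding ennreal_abs_coef[OF fi, of 0, symmetric] abs_coef_0 ..
    finally have "ennreal K * (\<Sum>n. ennreal (a n * abs_coef ?F n)) \<le> ennreal K * (ennreal (KS * M') * ennreal (L1_norm f))"
      by (rule mult_left_mono) simp
    also have "\<dots> = ennreal (B * L1_norm f)"
      using K(1) KS(1) abs_coef_nonneg[of f 0] by (simp add: B_def abs_coef_0 M'_def ennreal_mult mult.assoc)
    finally have Ng: "N g \<le> ennreal (B * L1_norm f)" by (rule order_trans[OF K(2)[OF F g(2)]])
    then have "N g < \<infinity>" by (rule le_less_trans) simp
    moreover have "g holomorphic_on ball 0 1" using disc_series.holomorphic_g[OF g(2)] .
    ultimately show ?thesis using g(1) Ng by (auto simp: analytic_space_def)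
  qed
  have key': "\<exists>g\<in>analytic_space N. T f = Some g \<and> N g \<le> ennreal (B * L1_norm f)" if f: "f \<in> L1_space" for f
  proof (cases "T = H_op \<omega>")
    case True
    then show ?thesis using key[OF f] by simp
  next
    case False
    then have "T f = H_op \<omega> (\<lambda>t. of_real (norm (f t)))" using T by (simp add: H_tilde_op_eq)
    moreover have "L1_norm (\<lambda>t. complex_of_real (norm (f t))) = L1_norm f" by (simp add: L1_norm_def)
    ultimately show ?thesis using key[OF L1_space_norm[OF f]] by simp
  qed
  have "(SUP f\<in>{f \<in> L1_space. L1_norm f \<le> 1}. N (the (T f))) \<le> ennreal B"
  proof (rule SUP_least)
    fix f assume f: "f \<in> {f \<in> L1_space. L1_norm f \<le> 1}"
    then obtain g where g: "T f = Some g" "N g \<le> ennreal (B * L1_norm f)" using key' by blast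
    have "B * L1_norm f \<le> B" using f B by (intro mult_left_le) auto
    then have "N g \<le> ennreal B" using g(2) by (meson ennreal_leI order_trans)
    then show "N (the (T f)) \<le> ennreal B" using g(1) by simp
  qed
  then have "(SUP f\<in>{f \<in> L1_space. L1_norm f \<le> 1}. N (the (T f))) < \<infinity>" by (rule le_less_trans) simp
  moreover have "\<forall>f\<in>L1_space. \<exists>g\<in>analytic_space N. T f = Some g" using key' by blast
  ultimately show ?thesis by (simp add: bounded_from_L1_def)
qed

end

theorem theorem21:
  fixes \<omega> :: "real \<Rightarrow> real"
    and N :: "(complex \<Rightarrow> complex) \<Rightarrow> ennreal"
    and T :: "(real \<Rightarrow> complex) \<Rightarrow> (complex \<Rightarrow> complex) option"
  assumes "radial_weight \<omega>"
    and "N \<in> {H_inf_1_norm, Hardy_1_norm, Dirichlet_1_norm, HL_1_norm}"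
    and "T \<in> {H_op \<omega>, H_tilde_op \<omega>}"
  shows "(bounded_from_L1 T N \<longleftrightarrow> \<omega> \<in> D_class \<and> m1 \<omega> < \<infinity>) \<and>
         (\<omega> \<in> D_class \<and> m1 \<omega> < \<infinity> \<longleftrightarrow> \<omega> \<in> D_hat \<and> m1 \<omega> < \<infinity>)"
proof -
  interpret weight \<omega> by unfold_locales (rule assms(1))
  have doubling: "\<exists>C. doubling_weight \<omega> C" if D: "\<omega> \<in> D_hat"
  proof -
    obtain C where "1 < C" "\<And>r. 0 \<le> r \<Longrightarrow> r < 1 \<Longrightarrow> W r \<le> C * W ((1 + r) / 2)"
      using D by (auto simp: D_hat_def)
    then have "doubling_weight \<omega> C" by unfold_locales auto
    then show ?thesis ..
  qed
  have "bounded_from_L1 T N" if D: "\<omega> \<in> D_hat" and m1: "m1 \<omega> < \<infinity>"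
  proof -
    obtain C where "doubling_weight \<omega> C" using doubling[OF D] ..
    then interpret doubling_weight \<omega> C .
    show ?thesis using m1 bounded_if_m1 assms(2,3) unfolding m1_finite_iff by blast
  qed
  moreover have "\<omega> \<in> D_hat \<and> m1 \<omega> < \<infinity>" if bd: "bounded_from_L1 T N"
  proof
    \<comment> \<open>Doubling comes first: it is required for \<open>1 + G \<le> k * S\<close>,
      which converts the bound on \<open>\<omega> * S\<close> into finiteness of
      \<open>m1\<close>.\<close>
    show D: "\<omega> \<in> D_hat" by (rule D_hat_if_bounded[OF bd assms(2,3)])
    obtain C where "doubling_weight \<omega> C" using doubling[OF D] ..
    then interpret doubling_weight \<omega> C .
    obtain K where K: "AE t in lebesgue_on {0..<1}. \<omega> t * S t \<le> K"
      using omega_S_bounded[OF bd assms(2,3)] by blast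
    obtain k where k: "0 < k" "\<And>t. 0 \<le> t \<Longrightarrow> t < 1 \<Longrightarrow> 1 + G t \<le> k * S t"
      using one_plus_G_le_S by blast
    have "AE t in lebesgue_on {0..<1}. t \<in> {0..<1}" by (rule AE_I2) simp
    then have "AE t in lebesgue_on {0..<1}. \<omega> t * (1 + G t) \<le> k * K"
      using K
    proof eventually_elim
      case (elim t)
      then have "\<omega> t * (1 + G t) \<le> \<omega> t * (k * S t)" by (intro mult_left_mono k omega_nonneg) auto
      also have "\<dots> = k * (\<omega> t * S t)" by simp
      also have "\<dots> \<le> k * K" using elim k(1) by (intro mult_left_mono) auto
      finally show ?case .
    qed
    then show "m1 \<omega> < \<infinity>" unfolding m1_finite_iff ..
  qed
  ultimately show ?thesis using D_class_iff by blast
qed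

end
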